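(* Let $\gamma > 1$ be the root of the equation $$(1+\gamma)^{\frac{1}{2+\gamma}}\left(1+\frac{1}{1+\gamma}\right) - 1 - \frac{1}{\gamma} = 0.$$ Then for every real $\alpha > \frac{\gamma}{2(2+\gamma)}$ there exist a Hilbert space $H$, a dictionary $\mathbb{D}\subset H$, a nonzero function $f\in \mathcal{K}_1(\mathbb{D})$ and a constant $C>0$ such that the pure greedy algorithm (matching pursuit) applied to $f$ with dictionary $\mathbb{D}$ is well defined (the maximum is attained at every step) and its iterates $f_n$ satisfy $$\|f - f_n\| \geq C\,\|f\|_{\mathcal{K}_1(\mathbb{D})}\, n^{-\alpha}\qquad\text{for all } n\geq 1.$$
   Context: Let $H$ be a real Hilbert space with inner product $\langle\cdot,\cdot\rangle$ and norm $\|\cdot\|$. A dictionary is a set $\mathbb{D}\subset H$ of unit vectors ($\|d\|=1$ for all $d\in\mathbb{D}$) that is symmetric ($d\in\mathbb{D}$ implies $-d\in\mathbb{D}$). Variation norm: let $B_1(\mathbb{D})$ be the closed convex hull of $\mathbb{D}$ in $H$, i.e. the closure of $\{\sum_{i=1}^N a_i d_i : N\ge 1,\ a_i\geq 0,\ \sum_{i=1}^N a_i=1,\ d_i\in\mathbb{D}\}$. Then $\|f\|_{\mathcal{K}_1(\mathbb{D})}=\inf\{t>0 : f\in tB_1(\mathbb{D})\}$, and $f\in\mathcal{K}_1(\mathbb{D})$ means $\|f\|_{\mathcal{K}_1(\mathbb{D})}<\infty$. Pure greedy algorithm (matching pursuit) for a target $f\in H$: $f_0=0$, and for $n\geq 1$,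 with residual $r_{n-1}=f-f_{n-1}$, choose $$d_n\in\operatorname{arg\,max}_{d\in\mathbb{D}}\langle r_{n-1},d\rangle,\qquad f_n=f_{n-1}+\langle r_{n-1},d_n\rangle d_n.$$ *)

theory Defs
  imports "HOL-Analysis.Analysis"
begin

text \<open>
  HOL cannot quantify over types, so the existence of a Hilbert space is expressed by naming one:
  the real sequence space \<open>\<ell>\<^sup>2(\<nat>)\<close>, made an instance of \<open>real_inner\<close> and
  \<open>complete_space\<close>. This loses nothing: a witness in an arbitrary Hilbert space can be cut down to
  countably many dictionary elements, whose closed span embeds isometrically. The notions after it are stated for every real Hilbert space type.
\<close>

typedef ell2 = "{x :: nat \<Rightarrow> real. summable (\<lambda>i. (x i)\<^sup>2)}"
  by (rule exI[of _ "\<lambda>_. 0"]) simp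

setup_lifting type_definition_ell2

lemma summable_mult_ell2:
  fixes x y :: "nat \<Rightarrow> real"
  assumes "summable (\<lambda>i. (x i)\<^sup>2)" "summable (\<lambda>i. (y i)\<^sup>2)"
  shows "summable (\<lambda>i. x i * y i)"
proof (rule summable_comparison_test)
  show "summable (\<lambda>i. (x i)\<^sup>2 + (y i)\<^sup>2)"
    using assms by (rule summable_add)
  have "\<bar>a * b\<bar> \<le> a\<^sup>2 + b\<^sup>2" for a b :: real
  proof -
    have "2 * (\<bar>a\<bar> * \<bar>b\<bar>) \<le> a\<^sup>2 + b\<^sup>2"
      using sum_squares_bound[of "\<bar>a\<bar>" "\<bar>b\<bar>"] by (simp add: mult.assoc)
    moreover have "0 \<le> \<bar>a\<bar> * \<bar>b\<bar>" by simp
    ultimately show ?thesis unfolding abs_mult by linarith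
  qed
  then show "\<exists>N. \<forall>n\<ge>N. norm (x n * y n) \<le> (x n)\<^sup>2 + (y n)\<^sup>2" by simp
qed

lemma summable_add_ell2:
  fixes x y :: "nat \<Rightarrow> real"
  assumes "summable (\<lambda>i. (x i)\<^sup>2)" "summable (\<lambda>i. (y i)\<^sup>2)"
  shows "summable (\<lambda>i. (x i + y i)\<^sup>2)"
proof -
  have "summable (\<lambda>i. (x i)\<^sup>2 + (y i)\<^sup>2 + 2 * (x i * y i))"
    by (intro summable_add summable_mult assms summable_mult_ell2)
  then show ?thesis by (simp add: power2_sum mult.assoc)
qed

instantiation ell2 :: real_inner
begin

lift_definition zero_ell2 :: ell2 is "\<lambda>_. 0" by simp

lift_definition plus_ell2 :: "ell2 \<Rightarrow> ell2 \<Rightarrow> ell2" is "\<lambda>x y i. x i + y i"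
  by (rule summable_add_ell2)

lift_definition uminus_ell2 :: "ell2 \<Rightarrow> ell2" is "\<lambda>x i. - x i" by simp

lift_definition minus_ell2 :: "ell2 \<Rightarrow> ell2 \<Rightarrow> ell2" is "\<lambda>x y i. x i - y i"
  subgoal for x y using summable_add_ell2[of x "\<lambda>i. - y i"] by simp
  done

lift_definition scaleR_ell2 :: "real \<Rightarrow> ell2 \<Rightarrow> ell2" is "\<lambda>c x i. c * x i"
  by (simp add: power_mult_distrib summable_mult)

lift_definition inner_ell2 :: "ell2 \<Rightarrow> ell2 \<Rightarrow> real" is "\<lambda>x y. \<Sum>i. x i * y i" .

definition norm_ell2 :: "ell2 \<Rightarrow> real" where "norm_ell2 x = sqrt (x \<bullet> x)"

definition sgn_ell2 :: "ell2 \<Rightarrow> ell2" where "sgn_ell2 x = inverse (norm x) *\<^sub>R x"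

definition dist_ell2 :: "ell2 \<Rightarrow> ell2 \<Rightarrow> real" where "dist_ell2 x y = norm (x - y)"

definition uniformity_ell2 :: "(ell2 \<times> ell2) filter" where
  "uniformity_ell2 = (INF e\<in>{0<..}. principal {(x, y). dist x y < e})"

definition open_ell2 :: "ell2 set \<Rightarrow> bool" where
  "open_ell2 U = (\<forall>x\<in>U. \<forall>\<^sub>F (x', y) in uniformity. x' = x \<longrightarrow> y \<in> U)"

instance
proof
  fix x y z :: ell2 and a b c :: real
  show "x + y + z = x + (y + z)" by transfer (simp add: add.assoc)
  show "x + y = y + x" by transfer (simp add: add.commute)
  show "0 + x = x" by transfer simp
  show "- x + x = 0" by transfer simp
  show "x - y = x + - y" by transfer simp
  show "a *\<^sub>R (x + y) = a *\<^sub>R x + a *\<^sub>R y" by transfer (simp add: distrib_left)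
  show "(a + b) *\<^sub>R x = a *\<^sub>R x + b *\<^sub>R x" by transfer (simp add: distrib_right)
  show "a *\<^sub>R b *\<^sub>R x = (a * b) *\<^sub>R x" by transfer (simp add: mult.assoc)
  show "1 *\<^sub>R x = x" by transfer simp
  show "x \<bullet> y = y \<bullet> x" by transfer (simp add: mult.commute)
  show "(x + y) \<bullet> z = x \<bullet> z + y \<bullet> z"
    by transfer (simp add: distrib_right suminf_add[symmetric] summable_mult_ell2)
  show "(c *\<^sub>R x) \<bullet> y = c * (x \<bullet> y)"
    by transfer (simp add: mult.assoc suminf_mult summable_mult_ell2)
  show "0 \<le> x \<bullet> x"
    by transfer (auto intro!: suminf_nonneg simp flip: power2_eq_square)
  show "(x \<bullet> x = 0) = (x = 0)"
    by transfer (simp add: suminf_eq_zero_iff fun_eq_iff flip: power2_eq_square)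
qed (simp_all add: norm_ell2_def sgn_ell2_def dist_ell2_def uniformity_ell2_def open_ell2_def)

end

lift_definition ell2_nth :: "ell2 \<Rightarrow> nat \<Rightarrow> real" is "\<lambda>x. x" .

lemma summable_ell2_nth: "summable (\<lambda>i. (ell2_nth x i)\<^sup>2)"
  by transfer simp

lemma norm_ell2_sq: "(norm x)\<^sup>2 = (\<Sum>i. (ell2_nth x i)\<^sup>2)" for x :: ell2
  unfolding power2_norm_eq_inner by transfer (simp add: power2_eq_square)

lemma sum_le_norm_ell2: "(\<Sum>i<k. (ell2_nth x i)\<^sup>2) \<le> (norm x)\<^sup>2"
  unfolding norm_ell2_sq by (rule sum_le_suminf[OF summable_ell2_nth]) auto

lemma ell2_nth_diff: "ell2_nth (x - y) i = ell2_nth x i - ell2_nth y i"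
  by transfer simp

lemma abs_ell2_nth_le: "\<bar>ell2_nth x i\<bar> \<le> norm x"
proof (rule power2_le_imp_le)
  have "(ell2_nth x i)\<^sup>2 \<le> (\<Sum>j<Suc i. (ell2_nth x j)\<^sup>2)"
    by (rule member_le_sum) auto
  then show "\<bar>ell2_nth x i\<bar>\<^sup>2 \<le> (norm x)\<^sup>2"
    using sum_le_norm_ell2[of x "Suc i"] by simp
qed simp

instance ell2 :: complete_space
proof
  fix X :: "nat \<Rightarrow> ell2"
  assume X: "Cauchy X"
  have "Cauchy (\<lambda>n. ell2_nth (X n) i)" for i
  proof (rule metric_CauchyI)
    fix e :: real assume "0 < e"
    then obtain M where M: "\<forall>m\<ge>M. \<forall>n\<ge>M. dist (X m) (X n) < e"
      using X unfolding Cauchy_def by blast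
    have "dist (ell2_nth (X m) i) (ell2_nth (X n) i) \<le> dist (X m) (X n)" for m n
      using abs_ell2_nth_le[of "X m - X n" i]
      by (simp add: dist_norm dist_real_def ell2_nth_diff)
    then show "\<exists>M. \<forall>m\<ge>M. \<forall>n\<ge>M. dist (ell2_nth (X m) i) (ell2_nth (X n) i) < e"
      using M by (meson le_less_trans)
  qed
  then have "\<exists>l. \<forall>i. (\<lambda>n. ell2_nth (X n) i) \<longlonglongrightarrow> l i"
    by (intro choice allI) (simp add: Cauchy_convergent_iff convergent_def)
  then obtain l where l: "\<And>i. (\<lambda>n. ell2_nth (X n) i) \<longlonglongrightarrow> l i" by blast
  have part: "\<exists>M. \<forall>m\<ge>M. \<forall>k. (\<Sum>i<k. (ell2_nth (X m) i - l i)\<^sup>2) \<le> e\<^sup>2"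
    if "0 < e" for e
  proof -
    from that obtain M where M: "\<forall>m\<ge>M. \<forall>n\<ge>M. dist (X m) (X n) < e"
      using X unfolding Cauchy_def by blast
    have "(\<Sum>i<k. (ell2_nth (X m) i - l i)\<^sup>2) \<le> e\<^sup>2" if "M \<le> m" for m k
    proof (rule LIMSEQ_le_const2)
      show "(\<lambda>n. \<Sum>i<k. (ell2_nth (X m) i - ell2_nth (X n) i)\<^sup>2)
              \<longlonglongrightarrow> (\<Sum>i<k. (ell2_nth (X m) i - l i)\<^sup>2)"
        by (intro tendsto_intros l)
      have "(\<Sum>i<k. (ell2_nth (X m) i - ell2_nth (X n) i)\<^sup>2) \<le> e\<^sup>2" if "M \<le> n" for n
      proof -
        have "norm (X m - X n) \<le> e"
          using M \<open>M \<le> m\<close> that by (simp add: dist_norm less_imp_le)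
        then have "(norm (X m - X n))\<^sup>2 \<le> e\<^sup>2" by (simp add: power_mono)
        then show ?thesis
          using sum_le_norm_ell2[of "X m - X n" k] by (simp add: ell2_nth_diff)
      qed
      then show "\<exists>N. \<forall>n\<ge>N. (\<Sum>i<k. (ell2_nth (X m) i - ell2_nth (X n) i)\<^sup>2) \<le> e\<^sup>2"
        by blast
    qed
    then show ?thesis by blast
  qed
  have summ: "summable (\<lambda>i. (ell2_nth (X m) i - l i)\<^sup>2)"
    if "\<forall>k. (\<Sum>i<k. (ell2_nth (X m) i - l i)\<^sup>2) \<le> B" for m B
    by (rule bounded_imp_summable[where B = B])
      (use that in \<open>auto simp only: lessThan_Suc_atMost[symmetric] zero_le_power2\<close>)
  obtain m where "\<forall>k. (\<Sum>i<k. (ell2_nth (X m) i - l i)\<^sup>2) \<le> 1\<^sup>2"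
    using part[of 1] by auto
  then have "summable (\<lambda>i. (ell2_nth (X m) i - l i)\<^sup>2)" by (rule summ)
  then have "summable (\<lambda>i. (- (ell2_nth (X m) i - l i) + ell2_nth (X m) i)\<^sup>2)"
    by (intro summable_add_ell2 summable_ell2_nth) (simp add: power2_commute)
  then have sl: "summable (\<lambda>i. (l i)\<^sup>2)" by simp
  define L where "L = Abs_ell2 l"
  have L: "ell2_nth L = l"
    using sl by (simp add: L_def ell2_nth.rep_eq Abs_ell2_inverse)
  have "X \<longlonglongrightarrow> L"
  proof (rule metric_LIMSEQ_I)
    fix e :: real assume "0 < e"
    then obtain M where M: "\<forall>m\<ge>M. \<forall>k. (\<Sum>i<k. (ell2_nth (X m) i - l i)\<^sup>2) \<le> (e/2)\<^sup>2"
      using part[of "e/2"] by auto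
    have "dist (X m) L < e" if "M \<le> m" for m
    proof -
      have "(norm (X m - L))\<^sup>2 \<le> (e/2)\<^sup>2"
        unfolding norm_ell2_sq ell2_nth_diff L
        using M that summ by (intro suminf_le_const) auto
      then have "norm (X m - L) \<le> e/2"
        by (rule power2_le_imp_le) (use \<open>0 < e\<close> in simp)
      then show ?thesis using \<open>0 < e\<close> by (simp add: dist_norm)
    qed
    then show "\<exists>M. \<forall>m\<ge>M. dist (X m) L < e" by blast
  qed
  then show "convergent X" by (rule convergentI)
qed

definition dictionary :: "'a::{real_inner, complete_space} set \<Rightarrow> bool" where
  "dictionary D \<longleftrightarrow> (\<forall>d\<in>D. norm d = 1) \<and> (\<forall>d\<in>D. - d \<in> D)"

text \<open>The value is \<open>\<infinity>\<close> when no dilate of the closed convex hull contains \<open>f\<close>.\<close>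

definition variation_norm :: "'a::{real_inner, complete_space} set \<Rightarrow> 'a \<Rightarrow> ereal" where
  "variation_norm D f =
     (INF t\<in>{t. 0 < t \<and> f \<in> (\<lambda>x. t *\<^sub>R x) ` closure (convex hull D)}. ereal t)"

definition variation_space :: "'a::{real_inner, complete_space} set \<Rightarrow> 'a set" where
  "variation_space D = {f. variation_norm D f < \<infinity>}"

text \<open>
  The maximizing dictionary element need not be unique: \<open>pga_iterate D f n g\<close> says that \<open>g\<close> is the
  \<open>n\<close>-th iterate \<open>f\<^sub>n\<close> for some admissible choice of \<open>d\<^sub>1, \<dots>, d\<^sub>n\<close>.
\<close>

inductive pga_iterate :: "'a::{real_inner, complete_space} set \<Rightarrow> 'a \<Rightarrow> nat \<Rightarrow> 'a \<Rightarrow> bool"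
  for D :: "'a set" and f :: 'a where
  zero: "pga_iterate D f 0 0"
| step: "pga_iterate D f n g \<Longrightarrow> is_arg_max (\<lambda>d. (f - g) \<bullet> d) (\<lambda>d. d \<in> D) d \<Longrightarrow>
     pga_iterate D f (Suc n) (g + ((f - g) \<bullet> d) *\<^sub>R d)"

definition pga_well_defined :: "'a::{real_inner, complete_space} set \<Rightarrow> 'a \<Rightarrow> bool" where
  "pga_well_defined D f \<longleftrightarrow>
     (\<forall>n g. pga_iterate D f n g \<longrightarrow> (\<exists>d. is_arg_max (\<lambda>d. (f - g) \<bullet> d) (\<lambda>d. d \<in> D) d))"

end

(*
With v = 1 + gamma and p slightly below 1 / (2 + gamma), put q = 1 - p and b_k = (k+1)^p - k^p ~ p k^(-q).
The target is f = sum_k b_k d_k, where the unit vectors d_k are chosen so that the k-th greedy step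
picks d_k with coefficient b_k; then |r_n|^2 - |r_2n|^2 = sum b_k^2 over n <= k < 2n, which gives
|r_n| >= c n^(p - 1/2).

For i < k the inner product <d_i, d_k> is about q/i if k < v i and about -q/k if k > v i. The near
values are as large as the condition <r_n, d_k> < b_n (k > n) allows; the far values keep -<r_n, d_i>
just below b_n and make sum_{k>i} b_k <d_i, d_k> = 0. Membership of f in K_1 comes from two extra dictionary elements
with midpoint f / s; they are never selected provided <r_n, f> = O(b_n), and this forces a
consistency relation among the parameters. It is solvable, with strict inequalities elsewhere,
exactly because gamma solves the given equation and p < 1 / (2 + gamma).

The vectors exist because their Gram matrix is positive definite. After a small perturbation it is the
identity plus a kernel homogeneous of degree -1; on geometric blocks this is a Toeplitz form, whose
symbol is explicit and positive for 2 < v < 2.3.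
*)
theory Submission
  imports Defs "HOL-Real_Asymp.Real_Asymp"
begin

section \<open>Vectors with a prescribed Gram matrix\<close>

text \<open>The partial sums of \<open>b\<close> are the powers n^p, hence unbounded, so the
  expansion of f alone says nothing about its variation norm; the extra pair of dictionary elements
  gets round this. The inner products are not sampled from the ideal kernel but built from
  \<open>b\<close> itself: constant in k while k is near i, and proportional to (b_k - b_(k+1)) /
  b_k when k is far. Each series for <r_n, d_i> then telescopes, so that the cancellation is exact
  and only scalar factors carry errors. Write p = 1 / (1 + w). At w = v both limiting factors a and
  h equal 1, which leaves no room for strict selection; for w > v they drop below 1. As w tends to
  v, the entries with large indices come as close as desired to the kernel at w = v. A fixed
  positivity margin for that kernel is therefore enough, and it is found before w is chosen. Since
  the estimates hold only for large indices, the construction starts at some index N and renumbers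
  from there.\<close>

lemma upper_triangular_solvable:
  fixes L :: "nat \<Rightarrow> nat \<Rightarrow> real" and g :: "nat \<Rightarrow> real"
  assumes "\<And>i. i < n \<Longrightarrow> L i i \<noteq> 0" "\<And>i m. i < m \<Longrightarrow> L i m = 0"
  shows "\<exists>c. \<forall>m<n. (\<Sum>i<n. c i * L i m) = g m"
  using assms(1)
proof (induction n arbitrary: g)
  case 0
  then show ?case by simp
next
  case (Suc n)
  define t where "t = g n / L n n"
  obtain c where c: "\<forall>m<n. (\<Sum>i<n. c i * L i m) = g m - t * L n m"
    using Suc.IH[of "\<lambda>m. g m - t * L n m"] Suc.prems by auto
  define c' where "c' = c(n := t)"
  have eq: "(\<Sum>i<n. c' i * L i m) = (\<Sum>i<n. c i * L i m)" for m
    by (rule sum.cong) (auto simp: c'_def)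
  have "(\<Sum>i<Suc n. c' i * L i m) = g m" if "m < Suc n" for m
  proof (cases "m = n")
    case True
    have "(\<Sum>i<n. c i * L i n) = 0"
      using assms(2) by (intro sum.neutral) auto
    then show ?thesis
      using True Suc.prems[of n] eq by (simp add: c'_def t_def)
  next
    case False
    then show ?thesis
      using that c eq by (simp add: c'_def)
  qed
  then show ?case by blast
qed

text \<open>Row-by-row computation of the lower triangular L with G = L L^T. It is total for every
  \<open>G\<close>: a zero pivot or a negative radicand only yields a meaningless value, which
  \<open>cholesky_diag\<close> excludes for positive forms.\<close>

function cholesky :: "(nat \<Rightarrow> nat \<Rightarrow> real) \<Rightarrow> nat \<Rightarrow> nat \<Rightarrow> real" where
  "cholesky G k j =
     (if j < k then (G k j - (\<Sum>m<j. cholesky G k m * cholesky G j m)) / cholesky G j j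
      else if j = k then sqrt (G k k - (\<Sum>m<k. (cholesky G k m)\<^sup>2)) else 0)"
  by pat_completeness auto
termination
  by (relation "inv_image (less_than <*lex*> less_than) (\<lambda>(G, k, j). (k, j))") auto

declare cholesky.simps [simp del]

lemma cholesky_above: "k < j \<Longrightarrow> cholesky G k j = 0"
  by (subst cholesky.simps) simp

text \<open>The pivot under the root is itself a value of the quadratic form: a vector c with c_k =
  1 that annihilates the first k columns of L turns the form into that pivot. Testing only vectors
  with nonzero last entry is therefore enough.\<close>

lemma cholesky_diag:
  assumes pos: "\<And>c n. c n \<noteq> (0::real) \<Longrightarrow> (\<Sum>i\<le>n. \<Sum>k\<le>n. c i * c k * G i k) > 0"
    and sym: "\<And>i k. G i k = G k i"
  shows "cholesky G k k > 0 \<and> (\<forall>i\<le>k. (\<Sum>m\<le>i. cholesky G i m * cholesky G k m) = G i k)"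
proof (induction k rule: less_induct)
  case (less k)
  let ?L = "cholesky G"
  define s where "s = G k k - (\<Sum>m<k. (?L k m)\<^sup>2)"
  have diag: "?L i i > 0" if "i < k" for i using less that by blast
  have row: "(\<Sum>m\<le>j. ?L j m * ?L k m) = G j k" if "j < k" for j
  proof -
    have "?L k j * ?L j j = G k j - (\<Sum>m<j. ?L k m * ?L j m)"
      using that diag[OF that] by (subst cholesky.simps) simp
    then show ?thesis
      using sym[of j k] by (simp add: lessThan_Suc_atMost[symmetric] mult.commute)
  qed
  have full: "G i l = (\<Sum>m<k. ?L i m * ?L l m)" if "i \<le> k" "l \<le> k" "i < k \<or> l < k" for i l
  proof -
    have main: "G i l = (\<Sum>m<k. ?L i m * ?L l m)" if "i \<le> l" "l \<le> k" "i < k" for i l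
    proof -
      have "G i l = (\<Sum>m\<le>i. ?L i m * ?L l m)"
        using that less.IH[of l] row[of i] by (cases "l = k") auto
      also have "\<dots> = (\<Sum>m<k. ?L i m * ?L l m)"
        using that by (intro sum.mono_neutral_left) (auto simp: cholesky_above)
      finally show ?thesis .
    qed
    show ?thesis
      using main[of i l] main[of l i] that sym[of i l] by (cases "i \<le> l") (auto simp: mult.commute)
  qed
  \<comment> \<open>\<open>c0\<close> expresses minus row k through the earlier rows, so that
    \<open>c\<close>, with last entry 1, is orthogonal to every earlier column.\<close>
  obtain c0 where c0: "\<forall>m<k. (\<Sum>i<k. c0 i * ?L i m) = - ?L k m"
    using upper_triangular_solvable[of k ?L "\<lambda>m. - ?L k m"] diag
    by (metis cholesky_above less_numeral_extra(3))
  define c where "c = c0(k := 1)"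
  have cz: "(\<Sum>i\<le>k. c i * ?L i m) = 0" if "m < k" for m
  proof -
    have "(\<Sum>i<k. c i * ?L i m) = (\<Sum>i<k. c0 i * ?L i m)"
      by (rule sum.cong) (auto simp: c_def)
    then show ?thesis
      using c0 that by (simp add: lessThan_Suc_atMost[symmetric] c_def)
  qed
  \<comment> \<open>Up to index k the matrix is the product L L^T taken over the earlier columns,
    plus the pivot \<open>s\<close> in the corner.\<close>
  have G: "G i l = (\<Sum>m<k. ?L i m * ?L l m) + (if i = k then if l = k then s else 0 else 0)"
    if "i \<le> k" "l \<le> k" for i l
    using full[OF that] that by (auto simp: s_def power2_eq_square)
  have "0 < (\<Sum>i\<le>k. \<Sum>l\<le>k. c i * c l * G i l)"
    by (rule pos) (simp add: c_def)
  also have "\<dots> = (\<Sum>i\<le>k. \<Sum>l\<le>k. (\<Sum>m<k. (c i * ?L i m) * (c l * ?L l m))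
      + (if i = k then if l = k then c i * c l * s else 0 else 0))"
    by (intro sum.cong refl) (simp add: G distrib_left sum_distrib_left mult_ac)
  also have "\<dots> = (\<Sum>i\<le>k. \<Sum>l\<le>k. \<Sum>m<k. (c i * ?L i m) * (c l * ?L l m)) + s"
  proof -
    have "(\<Sum>l\<le>k. (if i = k then if l = k then c i * c l * s else 0 else 0)) = (if i = k then s else 0)" for i
      by (auto simp: c_def)
    then show ?thesis
      by (simp add: sum.distrib del: atMost_Suc)
  qed
  also have "(\<Sum>i\<le>k. \<Sum>l\<le>k. \<Sum>m<k. (c i * ?L i m) * (c l * ?L l m))
      = (\<Sum>i\<le>k. \<Sum>m<k. \<Sum>l\<le>k. (c i * ?L i m) * (c l * ?L l m))"
    by (intro sum.cong refl sum.swap)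
  also have "\<dots> = (\<Sum>i\<le>k. \<Sum>m<k. (c i * ?L i m) * (\<Sum>l\<le>k. c l * ?L l m))"
    by (simp add: sum_distrib_left)
  also have "\<dots> = 0"
    by (intro sum.neutral ballI) (use cz in simp)
  finally have s: "s > 0" by simp
  have dk: "?L k k = sqrt s"
    by (subst cholesky.simps) (simp add: s_def)
  have "(\<Sum>m\<le>k. ?L k m * ?L k m) = G k k"
    using s by (simp add: lessThan_Suc_atMost[symmetric] dk) (simp add: s_def power2_eq_square)
  then show ?case
    using s dk row by (metis real_sqrt_gt_zero le_neq_implies_less)
qed

text \<open>Row k of the Cholesky factor vanishes beyond column k, so it is a finitely supported,
  hence square summable, sequence. Rows do not depend on a cutoff, which gives infinitely many
  vectors at once.\<close>

theorem gram_vectors: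
  fixes G :: "nat \<Rightarrow> nat \<Rightarrow> real"
  assumes pos: "\<And>c n. c n \<noteq> 0 \<Longrightarrow> (\<Sum>i\<le>n. \<Sum>k\<le>n. c i * c k * G i k) > 0"
    and sym: "\<And>i k. G i k = G k i"
  shows "\<exists>d :: nat \<Rightarrow> ell2. \<forall>i k. d i \<bullet> d k = G i k"
proof -
  let ?L = "cholesky G"
  have summ: "summable (\<lambda>m. (?L k m)\<^sup>2)" for k
    by (rule summable_finite[of "{..k}"]) (auto simp: cholesky_above)
  define d where "d k = Abs_ell2 (?L k)" for k
  have d: "ell2_nth (d k) = ?L k" for k
    using summ[of k] by (simp add: d_def ell2_nth.rep_eq Abs_ell2_inverse)
  have main: "d i \<bullet> d k = G i k" if "i \<le> k" for i k
  proof -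
    have "d i \<bullet> d k = (\<Sum>m. ?L i m * ?L k m)"
      by (metis d ell2_nth.rep_eq inner_ell2.rep_eq)
    also have "\<dots> = (\<Sum>m\<le>i. ?L i m * ?L k m)"
      by (rule suminf_finite) (auto simp: cholesky_above)
    also have "\<dots> = G i k"
      using cholesky_diag[OF pos sym, of k] that by blast
    finally show ?thesis .
  qed
  have "d i \<bullet> d k = G i k" for i k
    using main[of i k] main[of k i] sym[of i k] by (cases "i \<le> k") (auto simp: inner_commute)
  then show ?thesis by blast
qed

section \<open>The Schur test for the kernel 1 / max(i, k)\<close>

lemma schur_row:
  fixes i n :: nat
  assumes i: "i \<ge> 1"
  shows "(\<Sum>k=1..n. sqrt (real i / real k) / max (real i) (real k)) \<le> 4"
proof -
  have step: "1 / sqrt (real (Suc n)) \<le> 2 * (sqrt (real (Suc n)) - sqrt (real n))" for n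
  proof -
    have "(sqrt (real (Suc n)) - sqrt (real n)) * (sqrt (real (Suc n)) + sqrt (real n)) = 1"
      by (simp add: algebra_simps)
    moreover have "sqrt (real (Suc n)) + sqrt (real n) \<le> 2 * sqrt (real (Suc n))" by simp
    ultimately have "1 \<le> (sqrt (real (Suc n)) - sqrt (real n)) * (2 * sqrt (real (Suc n)))"
      by (metis diff_ge_0_iff_ge mult_left_mono of_nat_le_iff lessI less_imp_le real_sqrt_le_iff)
    then show ?thesis by (simp add: field_simps)
  qed
  \<comment> \<open>The weighted row splits at k = i. Up to i the terms are 1 / sqrt(i k) and
    telescope against 2 sqrt(k); beyond i they are sqrt(i) k^(-3/2) and telescope against -2 /
    sqrt(k). Each half contributes at most 2.\<close>
  have low: "(\<Sum>k=1..n. sqrt (real i / real k) / max (real i) (real k)) \<le> 2 * sqrt n / sqrt i" if "n \<le> i" for n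
    using that
  proof (induction n)
    case 0 show ?case by simp
  next
    case (Suc n)
    have "sqrt (real i / real (Suc n)) / max (real i) (real (Suc n)) = (1 / sqrt (real (Suc n))) / sqrt i"
      using Suc.prems i by (simp add: real_sqrt_divide max_def field_simps)
    also have "\<dots> \<le> 2 * (sqrt (real (Suc n)) - sqrt (real n)) / sqrt i"
      by (intro divide_right_mono step) simp
    finally have "sqrt (real i / real (Suc n)) / max (real i) (real (Suc n)) \<le> 2 * (sqrt (real (Suc n)) - sqrt (real n)) / sqrt i" .
    moreover have "2 * sqrt n / sqrt i + 2 * (sqrt (real (Suc n)) - sqrt (real n)) / sqrt i = 2 * sqrt (real (Suc n)) / sqrt i"
      by (simp add: add_divide_distrib[symmetric])
    ultimately show ?case
      using Suc by simp
  qed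
  have high: "(\<Sum>k=1..n. sqrt (real i / real k) / max (real i) (real k)) \<le> 4 - 2 * sqrt i / sqrt n" if "n \<ge> i" for n
    using that
  proof (induction n rule: dec_induct)
    case base
    then show ?case using low[of i] i by simp
  next
    case (step n)
    define x y where "x = sqrt (real n)" and "y = sqrt (real (Suc n))"
    have xy: "x > 0" "y \<ge> x" "y\<^sup>2 = x\<^sup>2 + 1" "y > 0" using step i by (auto simp: x_def y_def)
    have "(y - x) * (y + x) = 1" using xy by (simp add: power2_eq_square algebra_simps)
    moreover have "(y - x) * (y + x) \<le> (y - x) * (2 * y)"
      using xy by (intro mult_left_mono) auto
    ultimately have "1 \<le> 2 * y * (y - x)" by (simp add: mult.commute)
    then have "x \<le> x * (2 * y * (y - x))" using xy by simp
    also have "\<dots> \<le> y * (2 * y * (y - x))"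
      using xy by (intro mult_right_mono) auto
    finally have "x \<le> 2 * y * y * (y - x)" by (simp add: mult_ac)
    then have "1 / (y * y * y) \<le> 2 / x - 2 / y"
      using xy by (simp add: field_simps)
    then have "sqrt i * (1 / (y * y * y)) \<le> sqrt i * (2 / x - 2 / y)"
      by (intro mult_left_mono) auto
    moreover have "sqrt (real i / real (Suc n)) / max (real i) (real (Suc n)) = sqrt i * (1 / (y * y * y))"
    proof -
      have "y * y = real (Suc n)" by (simp add: y_def)
      then have e: "sqrt i * (1 / (y * y * y)) = sqrt i / (real (Suc n) * y)" by simp
      have "max (real i) (real (Suc n)) = real (Suc n)" using step by simp
      then show ?thesis unfolding e by (simp add: real_sqrt_divide y_def)
    qed
    ultimately show ?case
      using step by (simp add: x_def y_def algebra_simps)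
  qed
  show ?thesis
  proof (cases "n \<le> i")
    case True
    have "2 * sqrt n / sqrt i \<le> 2" using True i by (simp add: field_simps)
    then show ?thesis using low[OF True] by linarith
  next
    case False
    then show ?thesis using high[of n] by (smt (verit, best) divide_nonneg_nonneg nat_le_linear of_nat_0_le_iff real_sqrt_ge_zero)
  qed
qed

text \<open>Schur test with weights 1 / sqrt(k): AM-GM with the factor sqrt(i / k) separates c_i
  from c_k, and \<open>schur_row\<close> bounds the rows. Off-diagonal errors in the Gram matrix are
  later compared with this kernel.\<close>

lemma hardy_schur:
  fixes c :: "nat \<Rightarrow> real"
  shows "(\<Sum>i=1..n. \<Sum>k=1..n. \<bar>c i\<bar> * \<bar>c k\<bar> / max (real i) (real k)) \<le> 4 * (\<Sum>i=1..n. (c i)\<^sup>2)"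
proof -
  let ?w = "\<lambda>i k. sqrt (real i / real k) / max (real i) (real k)"
  have pt: "\<bar>c i\<bar> * \<bar>c k\<bar> / max (real i) (real k) \<le> ((c i)\<^sup>2 * ?w i k + (c k)\<^sup>2 * ?w k i) / 2"
    if "i \<ge> 1" "k \<ge> 1" for i k
  proof -
    define s where "s = sqrt (real i / real k)"
    have s: "s > 0" using that by (simp add: s_def)
    have s': "sqrt (real k / real i) = 1 / s" using that by (simp add: s_def real_sqrt_divide)
    have "0 \<le> (\<bar>c i\<bar> * s - \<bar>c k\<bar>)\<^sup>2 / s" using s by simp
    also have "\<dots> = (c i)\<^sup>2 * s + (c k)\<^sup>2 * (1 / s) - 2 * (\<bar>c i\<bar> * \<bar>c k\<bar>)"
      using s by (simp add: power2_diff power_mult_distrib field_simps power2_eq_square)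
    finally have "\<bar>c i\<bar> * \<bar>c k\<bar> \<le> ((c i)\<^sup>2 * s + (c k)\<^sup>2 * (1 / s)) / 2" by simp
    then have "\<bar>c i\<bar> * \<bar>c k\<bar> / max (real i) (real k) \<le> ((c i)\<^sup>2 * s + (c k)\<^sup>2 * (1 / s)) / 2 / max (real i) (real k)"
      by (intro divide_right_mono) auto
    then show ?thesis
      using s' by (simp add: s_def add_divide_distrib max.commute)
  qed
  have "(\<Sum>i=1..n. \<Sum>k=1..n. \<bar>c i\<bar> * \<bar>c k\<bar> / max (real i) (real k))
      \<le> (\<Sum>i=1..n. \<Sum>k=1..n. ((c i)\<^sup>2 * ?w i k + (c k)\<^sup>2 * ?w k i) / 2)"
    by (intro sum_mono pt) auto
  also have "\<dots> = ((\<Sum>i=1..n. \<Sum>k=1..n. (c i)\<^sup>2 * ?w i k) + (\<Sum>i=1..n. \<Sum>k=1..n. (c k)\<^sup>2 * ?w k i)) / 2"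
    by (simp add: sum.distrib sum_divide_distrib[symmetric])
  also have "(\<Sum>i=1..n. \<Sum>k=1..n. (c k)\<^sup>2 * ?w k i) = (\<Sum>i=1..n. \<Sum>k=1..n. (c i)\<^sup>2 * ?w i k)"
    by (rule sum.swap)
  also have "(\<Sum>i=1..n. \<Sum>k=1..n. (c i)\<^sup>2 * ?w i k) = (\<Sum>i=1..n. (c i)\<^sup>2 * (\<Sum>k=1..n. ?w i k))"
    by (simp only: sum_distrib_left)
  also have "\<dots> \<le> (\<Sum>i=1..n. (c i)\<^sup>2 * 4)"
    by (intro sum_mono mult_left_mono schur_row) auto
  finally show ?thesis by (simp add: sum_distrib_right[symmetric])
qed

lemma hardy_schur_tail:
  fixes c :: "nat \<Rightarrow> real"
  assumes "N \<ge> 1"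
  shows "(\<Sum>i=N..n. \<Sum>k=N..n. \<bar>c i\<bar> * \<bar>c k\<bar> / max (real i) (real k)) \<le> 4 * (\<Sum>i=N..n. (c i)\<^sup>2)"
proof -
  define c' where "c' i = (if i \<in> {N..n} then c i else 0)" for i
  have sub: "{N..n} \<subseteq> {1..n}" using assms by auto
  have "(\<Sum>i=N..n. \<Sum>k=N..n. \<bar>c i\<bar> * \<bar>c k\<bar> / max (real i) (real k)) = (\<Sum>i=N..n. \<Sum>k=N..n. \<bar>c' i\<bar> * \<bar>c' k\<bar> / max (real i) (real k))"
    by (intro sum.cong refl) (auto simp: c'_def)
  also have "\<dots> = (\<Sum>i=N..n. \<Sum>k=1..n. \<bar>c' i\<bar> * \<bar>c' k\<bar> / max (real i) (real k))"
    by (intro sum.cong refl sum.mono_neutral_left) (use sub in \<open>auto simp: c'_def\<close>)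
  also have "\<dots> = (\<Sum>i=1..n. \<Sum>k=1..n. \<bar>c' i\<bar> * \<bar>c' k\<bar> / max (real i) (real k))"
    by (intro sum.mono_neutral_left) (use sub in \<open>auto simp: c'_def\<close>)
  also have "\<dots> \<le> 4 * (\<Sum>i=1..n. (c' i)\<^sup>2)" by (rule hardy_schur)
  also have "(\<Sum>i=1..n. (c' i)\<^sup>2) = (\<Sum>i=N..n. (c' i)\<^sup>2)"
    by (intro sum.mono_neutral_right) (use sub in \<open>auto simp: c'_def\<close>)
  also have "\<dots> = (\<Sum>i=N..n. (c i)\<^sup>2)" by (intro sum.cong) (auto simp: c'_def)
  finally show ?thesis .
qed

section \<open>A positive Toeplitz symbol\<close>

text \<open>The factor is |1 - r e^(ix)|^2 and the sum is the real part of a geometric sum. The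
  division-free form also covers points where the factor vanishes, and it serves r > 1, 1 / r and r
  = 1 alike.\<close>

lemma geom_cos_sum:
  fixes r x :: real
  assumes "j \<le> n"
  shows "(1 + r\<^sup>2 - 2 * r * cos x) * (\<Sum>m=j..<n. r ^ m * cos (real m * x))
    = (r ^ (n + 1) * cos ((real n - 1) * x) - r ^ n * cos (real n * x))
      - (r ^ (j + 1) * cos ((real j - 1) * x) - r ^ j * cos (real j * x))"
  using assms
proof (induction n rule: dec_induct)
  case base
  then show ?case by simp
next
  case (step n)
  have a: "cos ((real n - 1) * x) = cos (real n * x) * cos x + sin (real n * x) * sin x"
    using cos_diff[of "real n * x" x] by (simp add: algebra_simps)
  have b: "cos (real (Suc n) * x) = cos (real n * x) * cos x - sin (real n * x) * sin x"
    using cos_add[of "real n * x" x] by (simp add: algebra_simps)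
  have c: "real (Suc n) - 1 = real n" by simp
  have "(1 + r\<^sup>2 - 2 * r * cos x) * (r ^ n * cos (real n * x))
      = (r ^ (Suc n + 1) * cos ((real (Suc n) - 1) * x) - r ^ Suc n * cos (real (Suc n) * x))
        - (r ^ (n + 1) * cos ((real n - 1) * x) - r ^ n * cos (real n * x))"
    unfolding a b c by (simp add: power2_eq_square algebra_simps)
  then show ?case
    using step by (simp only: sum.atLeastLessThan_Suc distrib_left)
qed

text \<open>Orthogonality of the characters of the cyclic group of order N; the bound on e excludes
  nonzero multiples of N.\<close>

lemma sum_cos_roots:
  fixes e :: int
  assumes N: "\<bar>e\<bar> < int N"
  shows "(\<Sum>r<N. cos (of_int e * (2 * pi * real r / real N))) = (if e = 0 then real N else 0)"
proof (cases "e = 0")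
  case True
  then show ?thesis by simp
next
  case False
  have N0: "N > 0" using N by linarith
  define x where "x = of_int e * (2 * pi / real N)"
  have Nx: "real N * x = 2 * pi * of_int e" using N0 by (simp add: x_def)
  have "(2 - 2 * cos x) * (\<Sum>m=0..<N. cos (real m * x))
      = cos ((real N - 1) * x) - cos (real N * x) - (cos (- x) - 1)"
    using geom_cos_sum[of 0 N 1 x] by simp
  moreover have "cos (real N * x) = 1"
    unfolding Nx by (intro cos_integer_2pi) auto
  moreover have "cos ((real N - 1) * x) = cos x"
  proof -
    have "cos ((real N - 1) * x) = cos (real N * x - x)" by (simp add: algebra_simps)
    then show ?thesis
      unfolding cos_diff Nx by (simp add: cos_integer_2pi sin_integer_2pi)
  qed
  ultimately have *: "(2 - 2 * cos x) * (\<Sum>m=0..<N. cos (real m * x)) = 0" by simp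
  have "cos x \<noteq> 1"
  proof
    assume "cos x = 1"
    then obtain k :: int where "x = of_int k * 2 * pi" using cos_one_2pi_int[of x] by auto
    then have "real_of_int e = of_int k * real N"
      using N0 by (simp add: x_def field_simps)
    then have "e = k * int N" by (metis of_int_eq_iff of_int_mult of_int_of_nat_eq)
    then have "int N dvd e" by simp
    then show False using N False zdvd_imp_le[of "int N" "\<bar>e\<bar>"] by simp
  qed
  then have "(\<Sum>m=0..<N. cos (real m * x)) = 0" using * by simp
  moreover have "(\<Sum>r<N. cos (of_int e * (2 * pi * real r / real N))) = (\<Sum>m=0..<N. cos (real m * x))"
    unfolding atLeast0LessThan by (rule sum.cong) (auto simp: x_def mult_ac)
  ultimately show ?thesis using False by simp
qed

text \<open>A finite Toeplitz form is an average of the values of its symbol over roots of unity.\<close>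

lemma toeplitz_nonneg:
  fixes t z :: "nat \<Rightarrow> real"
  assumes symbol: "\<And>x. t 0 + 2 * (\<Sum>m=1..<M. t m * cos (real m * x)) \<ge> 0"
  shows "(\<Sum>j<M. \<Sum>l<M. t (if j \<le> l then l - j else j - l) * z j * z l) \<ge> 0"
proof (cases "M = 0")
  case True
  then show ?thesis by simp
next
  case False
  \<comment> \<open>The products of cosines below have frequencies m + d and m - d of modulus less
    than 2 M, so 2 M nodes avoid aliasing.\<close>
  define N where "N = 2 * M"
  have N0: "N > 0" using False by (simp add: N_def)
  define x where "x r = 2 * pi * real r / real N" for r
  define T where "T y = t 0 + 2 * (\<Sum>m=1..<M. t m * cos (real m * y))" for y
  have sq: "(\<Sum>j<M. z j * cos (real j * y))\<^sup>2 + (\<Sum>j<M. z j * sin (real j * y))\<^sup>2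
      = (\<Sum>j<M. \<Sum>l<M. z j * z l * cos ((real j - real l) * y))" for y
  proof -
    have "cos ((real j - real l) * y) = cos (real j * y) * cos (real l * y) + sin (real j * y) * sin (real l * y)" for j l
      using cos_diff[of "real j * y" "real l * y"] by (simp add: algebra_simps)
    then show ?thesis
      by (simp add: power2_eq_square sum_product sum.distrib[symmetric] algebra_simps)
  qed
  have coeff: "(\<Sum>r<N. T (x r) * cos ((real j - real l) * x r)) = real N * t (if j \<le> l then l - j else j - l)"
    if "j < M" "l < M" for j l
  proof -
    define C where "C e = (\<Sum>r<N. cos (of_int e * x r))" for e :: int
    have C: "C e = (if e = 0 then real N else 0)" if "\<bar>e\<bar> < int N" for e
      using sum_cos_roots[OF that] by (simp add: C_def x_def)
    define d where "d = int j - int l"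
    have d: "\<bar>d\<bar> < int M" using that by (auto simp: d_def)
    have dr: "real j - real l = of_int d" by (simp add: d_def)
    have prodc: "2 * cos (real m * y) * cos (of_int d * y) = cos (of_int (int m + d) * y) + cos (of_int (int m - d) * y)" for m y
      using cos_add[of "real m * y" "of_int d * y"] cos_diff[of "real m * y" "of_int d * y"]
      by (simp add: algebra_simps)
    have "(\<Sum>r<N. T (x r) * cos (of_int d * x r))
        = (\<Sum>r<N. t 0 * cos (of_int d * x r) + (\<Sum>m=1..<M. t m * (2 * cos (real m * x r) * cos (of_int d * x r))))"
      by (intro sum.cong refl) (simp add: T_def distrib_right distrib_left sum_distrib_left sum_distrib_right mult_ac)
    also have "\<dots> = t 0 * C d + (\<Sum>r<N. \<Sum>m=1..<M. t m * (cos (of_int (int m + d) * x r) + cos (of_int (int m - d) * x r)))"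
      by (simp only: prodc sum.distrib C_def sum_distrib_left)
    also have "(\<Sum>r<N. \<Sum>m=1..<M. t m * (cos (of_int (int m + d) * x r) + cos (of_int (int m - d) * x r)))
        = (\<Sum>m=1..<M. \<Sum>r<N. t m * (cos (of_int (int m + d) * x r) + cos (of_int (int m - d) * x r)))"
      by (rule sum.swap)
    also have "\<dots> = (\<Sum>m=1..<M. t m * (C (int m + d) + C (int m - d)))"
      by (simp only: C_def sum_distrib_left[symmetric] sum.distrib)
    also have "\<dots> = (\<Sum>m=1..<M. if m = nat \<bar>d\<bar> then t m * real N else 0)"
    proof (intro sum.cong refl)
      fix m assume m: "m \<in> {1..<M}"
      have "C (int m + d) = (if int m + d = 0 then real N else 0)"
        using m d by (intro C) (auto simp: N_def)
      moreover have "C (int m - d) = (if int m - d = 0 then real N else 0)"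
        using m d by (intro C) (auto simp: N_def)
      ultimately show "t m * (C (int m + d) + C (int m - d)) = (if m = nat \<bar>d\<bar> then t m * real N else 0)"
        using m by (auto split: if_splits simp: abs_if)
    qed
    also have "\<dots> = (if d = 0 then 0 else t (nat \<bar>d\<bar>) * real N)"
      using d by (auto simp: sum.delta)
    also have "t 0 * C d = (if d = 0 then t 0 * real N else 0)"
      using C[of d] d by (auto simp: N_def)
    finally have "(\<Sum>r<N. T (x r) * cos (of_int d * x r)) = t (nat \<bar>d\<bar>) * real N"
      by (auto split: if_splits)
    moreover have "nat \<bar>d\<bar> = (if j \<le> l then l - j else j - l)" by (auto simp: d_def)
    ultimately show ?thesis unfolding dr by (simp add: mult.commute)
  qed
  have "0 \<le> (\<Sum>r<N. T (x r) * ((\<Sum>j<M. z j * cos (real j * x r))\<^sup>2 + (\<Sum>j<M. z j * sin (real j * x r))\<^sup>2))"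
    by (intro sum_nonneg mult_nonneg_nonneg) (use symbol in \<open>auto simp: T_def\<close>)
  also have "\<dots> = (\<Sum>r<N. \<Sum>j<M. \<Sum>l<M. z j * z l * (T (x r) * cos ((real j - real l) * x r)))"
    unfolding sq by (simp add: sum_distrib_left mult_ac)
  also have "\<dots> = (\<Sum>j<M. \<Sum>r<N. \<Sum>l<M. z j * z l * (T (x r) * cos ((real j - real l) * x r)))"
    by (rule sum.swap)
  also have "\<dots> = (\<Sum>j<M. \<Sum>l<M. \<Sum>r<N. z j * z l * (T (x r) * cos ((real j - real l) * x r)))"
    by (intro sum.cong refl sum.swap)
  also have "\<dots> = (\<Sum>j<M. \<Sum>l<M. z j * z l * (real N * t (if j \<le> l then l - j else j - l)))"
    by (intro sum.cong refl) (simp add: sum_distrib_left[symmetric] coeff)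
  also have "\<dots> = real N * (\<Sum>j<M. \<Sum>l<M. t (if j \<le> l then l - j else j - l) * z j * z l)"
    by (simp add: sum_distrib_left mult_ac)
  finally show ?thesis using N0 by (simp add: zero_le_mult_iff)
qed

text \<open>cos (n x) is a Chebyshev polynomial in cos x. This confines the symbol estimate to 0
  \<le> x \<le> pi.\<close>

lemma cos_multiple_cong:
  fixes x y :: real
  assumes "cos x = cos y"
  shows "cos (real n * x) = cos (real n * y)"
proof (induction n rule: induct_nat_012)
  case (ge2 n)
  have "cos (real (Suc (Suc n)) * u) = 2 * cos u * cos (real (Suc n) * u) - cos (real n * u)" for u
    using cos_add[of "real (Suc n) * u" u] cos_diff[of "real (Suc n) * u" u]
    by (simp add: algebra_simps)
  then show ?case using ge2 assms by presburger
qed (use assms in auto)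

section \<open>Lower bounds for the symbol at low and high frequencies\<close>

text \<open>
  With \<open>r = 1 + a\<close>, \<open>y = r ^ J\<close>, \<open>s = (1 - cos x) / a\<^sup>2\<close>, \<open>C = cos (J x)\<close> and \<open>P = sin (J x) * sin x / a\<close>, this is the symbol
  of \<open>symbol_nonneg\<close> times \<open>(1 + r\<^sup>2 - 2 r cos x) / a\<close>, up to a nonnegative term and the truncation at \<open>M\<close>.
\<close>

definition symbol_bound :: "real \<Rightarrow> real \<Rightarrow> real \<Rightarrow> real \<Rightarrow> real \<Rightarrow> real" where
  "symbol_bound y a s C P =
     (99/100) / (2 + a) * (1 + 2 * (1 + a) * s)
     + 2 * (y\<^sup>2 / (1 + y\<^sup>2)) * (C * (y - (1 + a) / y - a * (1 + a) * s * (y + 1 / y))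
         + (1 + a) * P * (y + 1 / y) - (1 + a) - (1 + a) * a * s)"

text \<open>\<open>y\<close> is sqrt v, so 2 < v < 2.3 gives its range, and y^2 / (1 + y^2) is q.
  The bound 0.4 is decisive: at frequency zero, in the limit of small a, it has to stay below the
  diagonal term 99/200.\<close>

lemma symbol_bound_facts:
  fixes y :: real
  assumes y: "1.414 \<le> y" "y \<le> 1.52"
  shows "0.66 \<le> y\<^sup>2 / (1 + y\<^sup>2)" "y\<^sup>2 / (1 + y\<^sup>2) \<le> 0.7" "0.657 \<le> 1 / y" "1 / y \<le> 0.7073"
    "2 * (y\<^sup>2 / (1 + y\<^sup>2)) * (1 + 1 / y - y) \<le> 0.4" "(y\<^sup>2 / (1 + y\<^sup>2)) * (y + 1 / y) = y"
proof -
  have sq: "1.414 * 1.414 \<le> y * y" "y * y \<le> 1.52 * 1.52"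
    using y by (intro mult_mono; simp)+
  have p: "1 + y\<^sup>2 > 0" by (simp add: add_pos_nonneg)
  show "0.66 \<le> y\<^sup>2 / (1 + y\<^sup>2)" "y\<^sup>2 / (1 + y\<^sup>2) \<le> 0.7"
    using p sq by (simp_all add: field_simps power2_eq_square)
  show "0.657 \<le> 1 / y" "1 / y \<le> 0.7073" using y by (simp_all add: field_simps)
  \<comment> \<open>Division of a cubic by y - 1.414: the polynomial 0.4 (1 + y^2) - 2 (y + y^2 -
    y^3) exceeds this product by 0.000392 y + 0.026704.\<close>
  have "0 \<le> (y - 1.414) * (2 * (y * y) + 1.228 * y - 0.264)"
    using y sq by (intro mult_nonneg_nonneg) auto
  then have "2 * (y + y * y - y * y * y) \<le> 0.4 * (1 + y * y)"
    using y sq by (simp add: algebra_simps)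
  then show "2 * (y\<^sup>2 / (1 + y\<^sup>2)) * (1 + 1 / y - y) \<le> 0.4"
  proof -
    assume le: "2 * (y + y * y - y * y * y) \<le> 0.4 * (1 + y * y)"
    have "2 * (y\<^sup>2 / (1 + y\<^sup>2)) * (1 + 1 / y - y) = 2 * (y\<^sup>2 * (1 + 1 / y - y)) / (1 + y\<^sup>2)" by simp
    also have "y\<^sup>2 * (1 + 1 / y - y) = y + y * y - y * y * y"
      using y by (simp add: power2_eq_square field_simps)
    also have "2 * (y + y * y - y * y * y) / (1 + y\<^sup>2) \<le> 0.4"
      unfolding pos_divide_le_eq[OF p] using le by (simp add: power2_eq_square)
    finally show ?thesis .
  qed
  show "(y\<^sup>2 / (1 + y\<^sup>2)) * (y + 1 / y) = y"
  proof -
    have "y + 1 / y = (1 + y\<^sup>2) / y" using y by (simp add: field_simps power2_eq_square)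
    then show ?thesis using p y by (simp add: power2_eq_square)
  qed
qed

text \<open>At low frequency C is close to 1 and P only helps. The first term is at least 0.4949 +
  0.9898 s, while the rest loses at most 0.401 + 0.618 s.\<close>

lemma symbol_bound_low:
  fixes y a s \<kappa> C P :: real
  assumes y: "1.414 \<le> y" "y \<le> 1.52" and a: "0 < a" "a \<le> 1/10000" and s: "0 \<le> s"
    and k: "0 \<le> \<kappa>" "\<kappa> \<le> 0.51" "1 - \<kappa> * s \<le> C" "C \<le> 1" and P: "0 \<le> P"
  shows "1/100 \<le> symbol_bound y a s C P"
proof -
  define q u where "q = y\<^sup>2 / (1 + y\<^sup>2)" and "u = 1 / y"
  note f = symbol_bound_facts[OF y, folded q_def u_def]
  have ua: "(1 + a) / y = (1 + a) * u" by (simp add: u_def)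
  have au: "a * u \<le> (1/10000) * 0.7073" using a f by (intro mult_mono) auto
  have p: "0 \<le> y - (1 + a) * u" using y au f by (simp add: algebra_simps)
  have 1: "0.4949 * (1 + 2 * s) \<le> (99/100) / (2 + a) * (1 + 2 * (1 + a) * s)"
  proof (intro mult_mono)
    show "0.4949 \<le> (99/100) / (2 + a)" using a by (simp add: field_simps)
    show "1 + 2 * s \<le> 1 + 2 * (1 + a) * s" using a s by (simp add: algebra_simps)
  qed (use a s in auto)
  have 2: "(1 - \<kappa> * s) * (y - (1 + a) * u) \<le> C * (y - (1 + a) * u)"
    using k p by (intro mult_right_mono) auto
  have 3: "C * (a * (1 + a) * s * (y + u)) \<le> 1 * (a * (1 + a) * s * (y + u))"
    using k a s y f by (intro mult_right_mono) auto
  have aa: "a * (1 + a) \<le> (1/10000) * 1.1" using a by (intro mult_mono) auto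
  have 4: "a * (1 + a) * s * (y + u + 1) \<le> (1/10000) * 1.1 * s * 3.3"
    using aa a s y f by (intro mult_mono) auto
  have 5: "\<kappa> * s * (y - (1 + a) * u) \<le> 0.51 * s * 0.863"
  proof (intro mult_mono)
    have "0 \<le> a * u" using a f by simp
    then show "y - (1 + a) * u \<le> 0.863" using y f by (simp add: algebra_simps)
  qed (use k s p in auto)
  have 6: "0 \<le> (1 + a) * P * (y + u)" using a P y f by auto
  define B where "B = C * (y - (1 + a) * u - a * (1 + a) * s * (y + u)) + (1 + a) * P * (y + u) - (1 + a) - (1 + a) * a * s"
  have "B \<ge> (1 - \<kappa> * s) * (y - (1 + a) * u) - a * (1 + a) * s * (y + u) - (1 + a) - (1 + a) * a * s"
    unfolding B_def using 2 3 6 by (simp add: right_diff_distrib)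
  also have "(1 - \<kappa> * s) * (y - (1 + a) * u) - a * (1 + a) * s * (y + u) - (1 + a) - (1 + a) * a * s
      = (y - u - 1) - a * u - a - \<kappa> * s * (y - (1 + a) * u) - a * (1 + a) * s * (y + u + 1)"
    by (simp add: algebra_simps)
  finally have B: "B \<ge> (y - u - 1) - a * u - a - \<kappa> * s * (y - (1 + a) * u) - a * (1 + a) * s * (y + u + 1)" .
  define X1 X2 X3 where "X1 = \<kappa> * s * (y - (1 + a) * u)" and "X2 = a * (1 + a) * s * (y + u + 1)" and "X3 = a * u"
  have X: "X1 \<le> 0.44014 * s" "X2 \<le> 0.0004 * s" "X3 \<le> 0.0001"
    using 4 5 au s unfolding X1_def[symmetric] X2_def[symmetric] X3_def[symmetric] by simp_all
  have B: "B \<ge> (y - u - 1) - 0.0002 - 0.441 * s"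
    using B[folded X1_def X2_def X3_def] X a s by simp
  define Y1 Y2 Y3 where "Y1 = 2 * q * (1 + u - y)" and "Y2 = q * s" and "Y3 = 2 * q * B"
  have "Y3 \<ge> 2 * q * ((y - u - 1) - 0.0002 - 0.441 * s)"
    unfolding Y3_def using B f by (intro mult_left_mono) auto
  moreover have "2 * q * ((y - u - 1) - 0.0002 - 0.441 * s) = - Y1 - 0.0004 * q - 0.882 * Y2"
    by (simp add: Y1_def Y2_def algebra_simps)
  moreover have "Y2 \<le> 0.7 * s"
    unfolding Y2_def using f s by (intro mult_right_mono) auto
  moreover have "Y1 \<le> 0.4" using f by (simp add: Y1_def)
  ultimately have Y3: "Y3 \<ge> - 0.401 - 0.618 * s" using f(2) s by simp
  define Z where "Z = (99/100) / (2 + a) * (1 + 2 * (1 + a) * s)"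
  have "1/100 \<le> Z + Y3"
    using Y3 1[folded Z_def] s by simp
  then have "1/100 \<le> (99/100) / (2 + a) * (1 + 2 * (1 + a) * s) + 2 * q * B"
    by (simp only: Z_def Y3_def)
  then show ?thesis
    unfolding symbol_bound_def ua q_def[symmetric] u_def[symmetric] B_def[symmetric] by simp
qed

text \<open>At high frequency nothing is assumed about the phase: C may be -1 and P may be -S. The
  losses are then essentially 2.61 + 3.041 S, linear in S, and S \<ge> 7 makes the quadratic term s
  = S^2 / 2 outweigh them.\<close>

lemma symbol_bound_high:
  fixes y a S C P :: real
  assumes y: "1.414 \<le> y" "y \<le> 1.52" and a: "0 < a" "a \<le> 1/10000" and S: "7 \<le> S"
    and C: "-1 \<le> C" "C \<le> 1" and P: "- S \<le> P"
  shows "1/100 \<le> symbol_bound y a (S\<^sup>2 / 2) C P"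
proof -
  define q u where "q = y\<^sup>2 / (1 + y\<^sup>2)" and "u = 1 / y"
  define s where "s = S\<^sup>2 / 2"
  have s: "s \<ge> 0" "s \<ge> 3.5 * S" using S by (auto simp: s_def power2_eq_square)
  note f = symbol_bound_facts[OF y, folded q_def u_def]
  have ua: "(1 + a) / y = (1 + a) * u" by (simp add: u_def)
  have au: "a * u \<le> (1/10000) * 0.7073" using a f by (intro mult_mono) auto
  have p: "0 \<le> y - (1 + a) * u" using y au f by (simp add: algebra_simps)
  have 1: "0.4949 * (1 + 2 * s) \<le> (99/100) / (2 + a) * (1 + 2 * (1 + a) * s)"
  proof (intro mult_mono)
    show "0.4949 \<le> (99/100) / (2 + a)" using a by (simp add: field_simps)
    show "1 + 2 * s \<le> 1 + 2 * (1 + a) * s" using a s by (simp add: algebra_simps)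
  qed (use a s in auto)
  have 2: "(-1) * (y - (1 + a) * u) \<le> C * (y - (1 + a) * u)"
    using C p by (intro mult_right_mono) auto
  have 3: "C * (a * (1 + a) * s * (y + u)) \<le> 1 * (a * (1 + a) * s * (y + u))"
    using C a s y f by (intro mult_right_mono) auto
  have aa: "a * (1 + a) \<le> (1/10000) * 1.1" using a by (intro mult_mono) auto
  have 4: "a * (1 + a) * s * (y + u + 1) \<le> (1/10000) * 1.1 * s * 3.3"
    using aa a s y f by (intro mult_mono) auto
  have 5: "y - (1 + a) * u \<le> 0.863"
  proof -
    have "0 \<le> a * u" using a f by simp
    then show ?thesis using y f by (simp add: algebra_simps)
  qed
  have 6: "(1 + a) * (- S) * (y + u) \<le> (1 + a) * P * (y + u)"
    using a P y f by (intro mult_right_mono mult_left_mono) auto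
  define B where "B = C * (y - (1 + a) * u - a * (1 + a) * s * (y + u)) + (1 + a) * P * (y + u) - (1 + a) - (1 + a) * a * s"
  have "B \<ge> - (y - (1 + a) * u) - a * (1 + a) * s * (y + u) - (1 + a) * S * (y + u) - (1 + a) - (1 + a) * a * s"
    unfolding B_def using 2 3 6 by (simp add: right_diff_distrib)
  also have "- (y - (1 + a) * u) - a * (1 + a) * s * (y + u) - (1 + a) * S * (y + u) - (1 + a) - (1 + a) * a * s
      = - (y - (1 + a) * u) - (1 + a) - (1 + a) * S * (y + u) - a * (1 + a) * s * (y + u + 1)"
    by (simp add: algebra_simps)
  finally have B: "B \<ge> - (y - (1 + a) * u) - (1 + a) - (1 + a) * S * (y + u) - a * (1 + a) * s * (y + u + 1)" .
  define X1 X2 X3 where "X1 = (1 + a) * S * (y + u)" and "X2 = a * (1 + a) * s * (y + u + 1)" and "X3 = y - (1 + a) * u"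
  have X: "X2 \<le> 0.0004 * s" "X3 \<le> 0.863"
    using 4 5 s unfolding X2_def[symmetric] X3_def[symmetric] by simp_all
  have B: "B \<ge> - 1.864 - (1 + a) * S * (y + u) - 0.0004 * s"
    unfolding X1_def[symmetric] using B[folded X1_def X2_def X3_def] X a s by simp
  define Y1 Y2 Y3 where "Y1 = (1 + a) * S * y" and "Y2 = q * s" and "Y3 = 2 * q * B"
  have "Y3 \<ge> 2 * q * (- 1.864 - (1 + a) * S * (y + u) - 0.0004 * s)"
    unfolding Y3_def using B f by (intro mult_left_mono) auto
  moreover have "2 * q * (- 1.864 - (1 + a) * S * (y + u) - 0.0004 * s)
      = - (q * 3.728) - 2 * ((1 + a) * S * (q * (y + u))) - 0.0008 * Y2"
    by (simp add: Y2_def algebra_simps)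
  moreover have "(1 + a) * S * (q * (y + u)) = Y1" using f by (simp add: Y1_def)
  moreover have "Y2 \<le> 0.7 * s"
    unfolding Y2_def using f s by (intro mult_right_mono) auto
  moreover have "Y1 \<le> 1.0001 * S * 1.52"
    unfolding Y1_def using a S y by (intro mult_mono) auto
  ultimately have Y3: "Y3 \<ge> - 2.61 - 3.041 * S - 0.001 * s" using f(2) s S by simp
  define Z where "Z = (99/100) / (2 + a) * (1 + 2 * (1 + a) * s)"
  have "1/100 \<le> Z + Y3"
    using Y3 1[folded Z_def] s S by simp
  then have "1/100 \<le> (99/100) / (2 + a) * (1 + 2 * (1 + a) * s) + 2 * q * B"
    by (simp only: Z_def Y3_def)
  then show ?thesis
    unfolding symbol_bound_def ua q_def[symmetric] u_def[symmetric] s_def[symmetric] B_def[symmetric] by simp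
qed


section \<open>Choice of the block ratio and positivity of the symbol\<close>

lemma eventually_scale:
  fixes v :: real
  assumes v: "2 < v" "v < 2.3"
  defines "r \<equiv> \<lambda>J::nat. v powr (1 / (2 * real J))"
  shows "\<forall>\<^sub>F J in sequentially. J \<ge> 1 \<and> 0 < r J - 1 \<and> r J - 1 \<le> 1/10000 \<and> real J * (r J - 1) \<le> 0.45
    \<and> 7 \<le> 2 * sin (pi / (2 * real J)) / (r J - 1) \<and> pi / (2 * real J) \<le> 0.4 \<and> r J ^ J = sqrt v"
proof -
  have ln: "ln v < 0.845"
  proof -
    have "ln v < ln (2 * 1.15)" using v by (subst ln_less_cancel_iff) auto
    also have "ln (2 * 1.15) = ln 2 + ln (1.15::real)" by (subst ln_mult) auto
    also have "ln (1.15::real) \<le> 0.15" using ln_le_minus_one[of "1.15::real"] by simp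
    also have "ln (2::real) \<le> 25/36" by (rule ln2_le_25_over_36)
    finally show ?thesis by simp
  qed
  have ln0: "ln v > 0" using v by simp
  have "pi \<ge> 3"
  proof -
    have "1/2 = sin (pi/6)" by (simp add: sin_30)
    also have "\<dots> \<le> pi/6" by (rule sin_x_le_x) simp
    finally show ?thesis by simp
  qed
  \<comment> \<open>With ln v < 0.845 the limit 2 pi / ln v exceeds 7, the threshold for S in
    \<open>symbol_bound_high\<close>.\<close>
  then have 7: "7 < 2 * pi / ln v" using ln ln0 by (simp add: field_simps)
  have v0: "v > 0" using v by simp
  have l1: "(\<lambda>J. r J - 1) \<longlonglongrightarrow> 0" unfolding r_def using v0 by real_asymp
  have l2: "(\<lambda>J. real J * (r J - 1)) \<longlonglongrightarrow> ln v / 2" unfolding r_def using v0 by real_asymp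
  have l3: "(\<lambda>J. 2 * sin (pi / (2 * real J)) / (r J - 1)) \<longlonglongrightarrow> 2 * pi / ln v"
  proof -
    have "(\<lambda>J. real J * sin (pi / (2 * real J))) \<longlonglongrightarrow> pi / 2" by real_asymp
    then have "(\<lambda>J. 2 * (real J * sin (pi / (2 * real J))) / (real J * (r J - 1))) \<longlonglongrightarrow> 2 * (pi / 2) / (ln v / 2)"
      by (intro tendsto_intros l2) (use ln0 in auto)
    moreover have "\<forall>\<^sub>F J in sequentially. 2 * (real J * sin (pi / (2 * real J))) / (real J * (r J - 1)) = 2 * sin (pi / (2 * real J)) / (r J - 1)"
      using eventually_gt_at_top[of 0] by eventually_elim auto
    ultimately have "(\<lambda>J. 2 * sin (pi / (2 * real J)) / (r J - 1)) \<longlonglongrightarrow> 2 * (pi / 2) / (ln v / 2)"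
      by (rule Lim_transform_eventually)
    then show ?thesis by (simp add: mult.commute)
  qed
  have l4: "(\<lambda>J. pi / (2 * real J)) \<longlonglongrightarrow> 0" by real_asymp
  have e: "\<forall>\<^sub>F J in sequentially. r J - 1 < 1/10000" "\<forall>\<^sub>F J in sequentially. real J * (r J - 1) < 0.45"
    "\<forall>\<^sub>F J in sequentially. 7 < 2 * sin (pi / (2 * real J)) / (r J - 1)"
    "\<forall>\<^sub>F J in sequentially. pi / (2 * real J) < 0.4"
    by (rule order_tendstoD[OF l1] order_tendstoD[OF l2] order_tendstoD[OF l3] order_tendstoD[OF l4];
        use ln 7 in simp)+
  show ?thesis
    using e eventually_ge_at_top[of 1]
  proof eventually_elim
    case (elim J)
    have "r J > 1" using elim v by (auto simp: r_def)
    moreover have "r J ^ J = sqrt v"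
      using elim v0 by (simp add: r_def powr_half_sqrt[symmetric] powr_realpow[symmetric] powr_powr)
    ultimately show ?case using elim by auto
  qed
qed

text \<open>From tan t \<ge> t one gets sin t \<ge> t cos t, and the cosine exceeds 0.9 on this
  range.\<close>

lemma sin_ge_09:
  fixes t :: real
  assumes "0 \<le> t" "t \<le> 0.4"
  shows "0.9 * t \<le> sin t"
proof -
  have "sin (t/2) \<le> t / 2" by (rule sin_x_le_x) (use assms in simp)
  moreover have "0 \<le> sin (t/2)" by (rule sin_ge_zero) (use assms pi_ge_two in auto)
  ultimately have "(sin (t/2))\<^sup>2 \<le> (0.2)\<^sup>2" using assms by (intro power_mono) auto
  then have c: "0.92 \<le> cos t" using cos_double_sin[of "t/2"] by (simp add: power2_eq_square)
  have "\<bar>t\<bar> \<le> \<bar>tan t\<bar>" using assms pi_ge_two by (intro abs_tan_ge) auto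
  moreover have "sin t \<ge> 0" using assms pi_ge_two by (intro sin_ge_zero) auto
  ultimately have "t \<le> sin t / cos t" using assms c by (simp add: tan_def)
  then have "t * cos t \<le> sin t" using c by (simp add: pos_le_divide_eq)
  moreover have "t * 0.9 \<le> t * cos t" using assms c by (intro mult_left_mono) auto
  ultimately show ?thesis by simp
qed

text \<open>Multiplying by |1 - r e^(ix)|^2 sums both geometric pieces exactly and leaves a times
  \<open>symbol_bound\<close>, a nonnegative term and a truncation term. The diagonal (99/100) /
  (r^2 - 1) is 99 percent of what the unit diagonal of the Gram matrix yields on blocks of relative
  length r^2 - 1. The cutoff M comes after J because the truncation error has to be small against a
  = r - 1.\<close>

lemma symbol_nonneg:
  fixes v :: real
  assumes v: "2 < v" "v < 2.3"
  defines "q \<equiv> v / (1 + v)"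
  shows "\<forall>\<^sub>F J in sequentially. let r = v powr (1 / (2 * real J)) in
    \<forall>\<^sub>F M in sequentially. \<forall>x. (99/100) / (r\<^sup>2 - 1) + q
       + 2 * (\<Sum>m=1..<M. (if m < J then q * r ^ m else - q / r ^ m) * cos (real m * x)) \<ge> 0"
  using eventually_scale[OF v]
proof eventually_elim
  case (elim J)
  define r a y where "r = v powr (1 / (2 * real J))" and "a = r - 1" and "y = sqrt v"
  have J: "J \<ge> 1" and a: "0 < a" "a \<le> 1/10000" and Ja: "real J * a \<le> 0.45"
    and S7: "7 \<le> 2 * sin (pi / (2 * real J)) / a" and Jpi: "pi / (2 * real J) \<le> 0.4" and rJ: "r ^ J = y"
    using elim by (auto simp: r_def[symmetric] a_def[symmetric] y_def)
  have ra: "r = 1 + a" and r1: "r > 1" using a by (auto simp: a_def)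
  have yy: "y\<^sup>2 = v" "y > 0" using v by (auto simp: y_def)
  have q: "q = y\<^sup>2 / (1 + y\<^sup>2)" and q0: "q > 0" using yy v by (auto simp: q_def)
  have y: "1.414 \<le> y" "y \<le> 1.52"
  proof -
    show "1.414 \<le> y" unfolding y_def by (rule real_le_rsqrt) (use v in \<open>simp add: power2_eq_square\<close>)
    show "y \<le> 1.52" unfolding y_def by (rule real_le_lsqrt) (use v in \<open>auto simp: power2_eq_square\<close>)
  qed
  have lim: "(\<lambda>M. 4 * q * r\<^sup>2 * (1/r) ^ M) \<longlonglongrightarrow> 4 * q * r\<^sup>2 * 0"
    using r1 by (intro tendsto_intros LIMSEQ_realpow_zero) auto
  \<comment> \<open>The geometric tail beyond M has to fit into the margin a / 100 that
    \<open>main\<close> provides.\<close>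
  have ev: "\<forall>\<^sub>F M in sequentially. 4 * q * r\<^sup>2 * (1/r) ^ M < a / 100"
    using order_tendstoD(2)[OF lim, of "a/100"] a by simp
  have main: "a / 100 \<le> a * symbol_bound y a ((1 - cos x) / a\<^sup>2) (cos (real J * x)) (sin (real J * x) * sin x / a)"
    if x: "0 \<le> x" "x \<le> pi" for x
  proof -
    define S where "S = 2 * sin (x / 2) / a"
    have sn: "sin (x/2) \<ge> 0" using x by (intro sin_ge_zero) auto
    have S0: "S \<ge> 0" using sn a by (simp add: S_def)
    have s: "(1 - cos x) / a\<^sup>2 = S\<^sup>2 / 2"
      using cos_double_sin[of "x/2"] a by (simp add: S_def power_divide power_mult_distrib field_simps)
    have "1/100 \<le> symbol_bound y a (S\<^sup>2 / 2) (cos (real J * x)) (sin (real J * x) * sin x / a)"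
    \<comment> \<open>Low frequencies are those with J x \<le> pi: there sin (J x) and sin x are
      both nonnegative, and J x \<le> S / 2 keeps cos (J x) above 1 - s / 4, where s = S^2 / 2.
      Beyond, S is at least its value at x = pi / J, which is at least 7.\<close>
    proof (cases "x \<le> pi / real J")
      case True
      have Jx: "real J * x \<le> pi" using True J by (simp add: field_simps)
      have "0.9 * (x / 2) \<le> sin (x / 2)"
        using True Jpi x by (intro sin_ge_09) (auto simp: field_simps)
      then have "0.9 * x \<le> a * S" using a by (simp add: S_def)
      then have "0.9 * (real J * x) \<le> (real J * a) * S"
        using mult_left_mono[of "0.9 * x" "a * S" "real J"] by (simp add: mult_ac)
      also have "\<dots> \<le> 0.45 * S" using Ja S0 by (rule mult_right_mono)
      finally have "real J * x \<le> 0.5 * S" by (simp add: mult_ac)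
      then have "(real J * x)\<^sup>2 \<le> (0.5 * S)\<^sup>2" using x by (intro power_mono) auto
      moreover have "1 - (real J * x)\<^sup>2 / 2 \<le> cos (real J * x)"
      proof -
        have "(sin (real J * x / 2))\<^sup>2 \<le> (real J * x / 2)\<^sup>2"
          using abs_sin_x_le_abs_x[of "real J * x / 2"] by (simp only: abs_le_square_iff)
        then show ?thesis using cos_double_sin[of "real J * x / 2"] by (simp add: power_divide)
      qed
      ultimately have c: "1 - 0.25 * (S\<^sup>2 / 2) \<le> cos (real J * x)" by (simp add: power_mult_distrib power2_eq_square)
      have "0 \<le> sin (real J * x) * sin x / a"
        using x Jx a by (intro divide_nonneg_pos mult_nonneg_nonneg sin_ge_zero) auto
      then show ?thesis
        using c by (intro symbol_bound_low[OF y a, where \<kappa> = "0.25"]) auto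
    next
      case False
      have "sin (pi / (2 * real J)) \<le> sin (x / 2)"
      proof (rule sin_monotone_2pi_le)
        have "0 \<le> pi / (2 * real J)" by simp
        then show "- (pi / 2) \<le> pi / (2 * real J)" using pi_gt_zero by linarith
        show "pi / (2 * real J) \<le> x / 2" using False J by (simp add: field_simps)
        show "x / 2 \<le> pi / 2" using x by simp
      qed
      then have "2 * sin (pi / (2 * real J)) / a \<le> S"
        unfolding S_def using a by (intro divide_right_mono) auto
      then have "7 \<le> S" using S7 by linarith
      have "\<bar>sin (real J * x) * sin x\<bar> \<le> 1 * \<bar>sin x\<bar>"
        unfolding abs_mult by (intro mult_right_mono) auto
      also have "\<bar>sin x\<bar> = 2 * sin (x/2) * \<bar>cos (x/2)\<bar>"
        using sin_double[of "x/2"] sn by (simp add: abs_mult)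
      also have "\<dots> \<le> 2 * sin (x/2) * 1" using sn by (intro mult_left_mono) auto
      finally have "- (2 * sin (x/2)) \<le> sin (real J * x) * sin x" by linarith
      then have "- (2 * sin (x/2)) / a \<le> sin (real J * x) * sin x / a"
        using a by (intro divide_right_mono) auto
      then have "- S \<le> sin (real J * x) * sin x / a" by (simp add: S_def)
      then show ?thesis using \<open>7 \<le> S\<close> by (intro symbol_bound_high[OF y a]) auto
    qed
    then show ?thesis using a by (simp add: s)
  qed
  have "\<forall>\<^sub>F M in sequentially. \<forall>x. (99/100) / (r\<^sup>2 - 1) + q
       + 2 * (\<Sum>m=1..<M. (if m < J then q * r ^ m else - q / r ^ m) * cos (real m * x)) \<ge> 0"
    using ev eventually_ge_at_top[of J]
  proof eventually_elim
    case (elim M)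
    let ?T = "\<lambda>x. (99/100) / (r\<^sup>2 - 1) + q
       + 2 * (\<Sum>m=1..<M. (if m < J then q * r ^ m else - q / r ^ m) * cos (real m * x))"
    have T0: "?T x \<ge> 0" if x: "0 \<le> x" "x \<le> pi" for x
    proof -
      define D where "D = 1 + r\<^sup>2 - 2 * r * cos x"
      define \<sigma> where "\<sigma> = 1 - cos x"
      define ct st where "ct = cos (real J * x)" and "st = sin (real J * x)"
      have D: "D = a\<^sup>2 + 2 * r * \<sigma>" by (simp add: D_def \<sigma>_def a_def power2_eq_square algebra_simps)
      have \<sigma>: "\<sigma> \<ge> 0" by (simp add: \<sigma>_def)
      have D0: "D > 0" using D a r1 \<sigma> by (simp add: add_pos_nonneg)
      have cJ: "cos ((real J - 1) * x) = ct * cos x + st * sin x"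
        using cos_diff[of "real J * x" x] by (simp add: ct_def st_def algebra_simps)
      have s1: "D * (\<Sum>m=1..<J. r ^ m * cos (real m * x)) = r * y * (ct * cos x + st * sin x) - y * ct - r\<^sup>2 + r * cos x"
        using geom_cos_sum[of 1 J r x] J rJ by (simp add: D_def cJ ct_def[symmetric] power2_eq_square)
      define A where "A = (1/r) ^ (M + 1) * cos ((real M - 1) * x) - (1/r) ^ M * cos (real M * x)"
      have s2: "D * (\<Sum>m=J..<M. (1/r) ^ m * cos (real m * x)) = r\<^sup>2 * A - (r * (ct * cos x + st * sin x) / y - r\<^sup>2 * ct / y)"
      proof -
        have Dr: "D = r\<^sup>2 * (1 + (1/r)\<^sup>2 - 2 * (1/r) * cos x)"
          using r1 by (simp add: D_def power2_eq_square field_simps)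
        have rJ': "(1/r) ^ J = 1 / y" using rJ by (simp add: power_divide)
        have "D * (\<Sum>m=J..<M. (1/r) ^ m * cos (real m * x))
          = r\<^sup>2 * (A - ((1/r) ^ (J + 1) * cos ((real J - 1) * x) - (1/r) ^ J * cos (real J * x)))"
          unfolding Dr A_def using geom_cos_sum[of J M "1/r" x] elim by simp
        also have "(1/r) ^ (J + 1) = 1 / (r * y)" using rJ' by simp
        finally have "D * (\<Sum>m=J..<M. (1/r) ^ m * cos (real m * x))
            = r\<^sup>2 * (A - (1 / (r * y) * (ct * cos x + st * sin x) - 1 / y * ct))"
          unfolding rJ' cJ ct_def[symmetric] .
        also have "r\<^sup>2 * (A - (1 / (r * y) * c - 1 / y * ct)) = r\<^sup>2 * A - (r * c / y - r\<^sup>2 * ct / y)" for c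
        proof -
          have "r\<^sup>2 * (1 / (r * y) * c) = r * c / y" using r1 by (simp add: power2_eq_square)
          then show ?thesis by (simp add: right_diff_distrib)
        qed
        finally show ?thesis .
      qed
      have split: "(\<Sum>m=1..<M. (if m < J then q * r ^ m else - q / r ^ m) * cos (real m * x))
          = q * (\<Sum>m=1..<J. r ^ m * cos (real m * x)) - q * (\<Sum>m=J..<M. (1/r) ^ m * cos (real m * x))"
      proof -
        have "{1..<M} = {1..<J} \<union> {J..<M}" using J elim by auto
        then have "(\<Sum>m=1..<M. (if m < J then q * r ^ m else - q / r ^ m) * cos (real m * x))
          = (\<Sum>m=1..<J. (if m < J then q * r ^ m else - q / r ^ m) * cos (real m * x))
          + (\<Sum>m=J..<M. (if m < J then q * r ^ m else - q / r ^ m) * cos (real m * x))"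
          by (simp add: sum.union_disjoint)
        also have "(\<Sum>m=1..<J. (if m < J then q * r ^ m else - q / r ^ m) * cos (real m * x))
           = (\<Sum>m=1..<J. q * (r ^ m * cos (real m * x)))" by (intro sum.cong) auto
        also have "(\<Sum>m=J..<M. (if m < J then q * r ^ m else - q / r ^ m) * cos (real m * x))
           = (\<Sum>m=J..<M. - q * ((1/r) ^ m * cos (real m * x)))"
          by (intro sum.cong) (auto simp: power_divide)
        finally show ?thesis by (simp add: sum_distrib_left sum_negf)
      qed
      have "\<bar>A\<bar> \<le> \<bar>(1/r) ^ (M + 1) * cos ((real M - 1) * x)\<bar> + \<bar>(1/r) ^ M * cos (real M * x)\<bar>"
        unfolding A_def by (rule abs_triangle_ineq4)
      also have "\<dots> \<le> (1/r) ^ (M + 1) * 1 + (1/r) ^ M * 1"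
        unfolding abs_mult using r1 by (intro add_mono mult_mono) auto
      also have "(1/r) ^ (M + 1) \<le> (1/r) ^ M" using r1 by (intro power_decreasing) auto
      finally have "\<bar>A\<bar> \<le> 2 * (1/r) ^ M" by simp
      then have "2 * q * r\<^sup>2 * A \<le> 2 * q * r\<^sup>2 * (2 * (1/r) ^ M)"
        using q0 by (intro mult_left_mono) auto
      also have "\<dots> = 4 * q * r\<^sup>2 * (1/r) ^ M" by simp
      finally have Ab: "2 * q * r\<^sup>2 * A < a / 100" using elim by linarith
      have sb: "a * symbol_bound y a (\<sigma> / a\<^sup>2) ct (st * sin x / a)
         = (99/100) / (r\<^sup>2 - 1) * D + 2 * q * (r * y * (ct * cos x + st * sin x) - y * ct - r\<^sup>2 + r * cos x
             + (r * (ct * cos x + st * sin x) / y - r\<^sup>2 * ct / y))"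
      proof -
        have r2: "r\<^sup>2 - 1 = a * (2 + a)" by (simp add: ra power2_eq_square algebra_simps)
        have "a * ((99/100) / (2 + a) * (1 + 2 * r * (\<sigma> / a\<^sup>2))) = (99/100) / (r\<^sup>2 - 1) * D"
          unfolding r2 D using a by (simp add: power2_eq_square divide_simps) 
        moreover have "a * (ct * (y - r / y - a * r * (\<sigma> / a\<^sup>2) * (y + 1 / y))
             + r * (st * sin x / a) * (y + 1 / y) - r - r * a * (\<sigma> / a\<^sup>2))
           = r * y * (ct * cos x + st * sin x) - y * ct - r\<^sup>2 + r * cos x
             + (r * (ct * cos x + st * sin x) / y - r\<^sup>2 * ct / y)"
        proof -
          have e1: "a * (a * r * (\<sigma> / a\<^sup>2) * (y + 1 / y)) = r * \<sigma> * (y + 1/y)"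
            using a by (simp add: power2_eq_square)
          have e2: "a * (r * (st * sin x / a) * (y + 1 / y)) = r * st * sin x * (y + 1/y)" using a by simp
          have e3: "a * (r * a * (\<sigma> / a\<^sup>2)) = r * \<sigma>" using a by (simp add: power2_eq_square)
          have "a * (ct * (y - r / y - a * r * (\<sigma> / a\<^sup>2) * (y + 1 / y))
             + r * (st * sin x / a) * (y + 1 / y) - r - r * a * (\<sigma> / a\<^sup>2))
             = ct * (a * (y - r / y)) - ct * (a * (a * r * (\<sigma> / a\<^sup>2) * (y + 1 / y)))
               + a * (r * (st * sin x / a) * (y + 1 / y)) - a * r - a * (r * a * (\<sigma> / a\<^sup>2))"
            by (simp only: right_diff_distrib distrib_left mult_ac)
          also have "\<dots> = ct * (a * (y - r / y)) - ct * (r * \<sigma> * (y + 1/y)) + r * st * sin x * (y + 1/y) - a * r - r * \<sigma>"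
            unfolding e1 e2 e3 ..
          also have "\<dots> = r * y * (ct * cos x + st * sin x) - y * ct - r\<^sup>2 + r * cos x
             + (r * (ct * cos x + st * sin x) * (1/y) - r\<^sup>2 * ct * (1/y))"
            unfolding a_def \<sigma>_def by (simp add: algebra_simps power2_eq_square add_divide_distrib diff_divide_distrib)
          finally show ?thesis by simp
        qed
        ultimately show ?thesis
          unfolding symbol_bound_def ra[symmetric] q[symmetric]
          by (simp only: distrib_left mult.left_commute[of a "2 * q"])
      qed
      have "D * ?T x = (99/100) / (r\<^sup>2 - 1) * D + q * D + 2 * q * (D * (\<Sum>m=1..<J. r ^ m * cos (real m * x)))
          - 2 * q * (D * (\<Sum>m=J..<M. (1/r) ^ m * cos (real m * x)))"
        unfolding split by (simp only: algebra_simps)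
      also have "\<dots> = a * symbol_bound y a (\<sigma> / a\<^sup>2) ct (st * sin x / a) + q * D - 2 * q * r\<^sup>2 * A"
        unfolding s1 s2 sb by (simp add: right_diff_distrib distrib_left)
      also have "\<dots> \<ge> 0"
        using main[OF x, folded \<sigma>_def ct_def st_def] Ab D0 q0 mult_pos_pos[OF q0 D0] by linarith
      finally show ?thesis using D0 by (simp add: zero_le_mult_iff)
    qed
    show ?case
    proof
      fix x :: real
      define x' where "x' = arccos (cos x)"
      have x': "0 \<le> x'" "x' \<le> pi" "cos x = cos x'"
        by (auto simp: x'_def arccos_lbound arccos_ubound cos_arccos)
      have "?T x = ?T x'" using cos_multiple_cong[OF x'(3)] by simp
      then show "?T x \<ge> 0" using T0[OF x'(1,2)] by simp
    qed
  qed
  then show ?case unfolding Let_def r_def .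
qed

section \<open>Positivity of the Gram form\<close>

lemma card_real_interval:
  fixes A :: "nat set" and x L :: real
  assumes A: "\<And>i. i \<in> A \<Longrightarrow> x \<le> real i \<and> real i < x + L" and L: "0 \<le> L"
  shows "finite A" "real (card A) \<le> L + 1"
proof -
  have sub: "A \<subseteq> {nat \<lceil>x\<rceil>..<nat \<lceil>x + L\<rceil>}"
  proof
    fix i assume "i \<in> A"
    with A have i: "x \<le> real i" "real i < x + L" by auto
    have "nat \<lceil>x\<rceil> \<le> i" using i(1) by linarith
    moreover have "i < nat \<lceil>x + L\<rceil>" using i(2) by linarith
    ultimately show "i \<in> {nat \<lceil>x\<rceil>..<nat \<lceil>x + L\<rceil>}" by simp
  qed
  then show "finite A" using finite_subset by blast
  have "card A \<le> nat \<lceil>x + L\<rceil> - nat \<lceil>x\<rceil>"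
    using card_mono[OF _ sub] by simp
  also have "\<dots> \<le> nat (\<lceil>x + L\<rceil> - \<lceil>x\<rceil>)" by linarith
  finally have "real (card A) \<le> real (nat (\<lceil>x + L\<rceil> - \<lceil>x\<rceil>))" by simp
  also have "\<dots> \<le> L + 1"
  proof (cases "\<lceil>x + L\<rceil> - \<lceil>x\<rceil> \<ge> 0")
    case True
    then have "real (nat (\<lceil>x + L\<rceil> - \<lceil>x\<rceil>)) = of_int \<lceil>x + L\<rceil> - of_int \<lceil>x\<rceil>" by simp
    then show ?thesis by linarith
  qed (use L in simp)
  finally show "real (card A) \<le> L + 1" .
qed

lemma sum_fibre_product:
  fixes c :: "nat \<Rightarrow> real" and b :: "nat \<Rightarrow> nat"
  assumes "finite S" "\<And>i. i \<in> S \<Longrightarrow> b i < M"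
  shows "(\<Sum>i\<in>S. \<Sum>k\<in>S. c i * c k * F (b i) (b k))
    = (\<Sum>j<M. \<Sum>l<M. F j l * (\<Sum>i | i \<in> S \<and> b i = j. c i) * (\<Sum>i | i \<in> S \<and> b i = l. c i))"
proof -
  define P where "P j = (\<Sum>i | i \<in> S \<and> b i = j. c i)" for j
  have *: "(\<Sum>i\<in>S. c i * g (b i)) = (\<Sum>j<M. P j * g j)" for g :: "nat \<Rightarrow> real"
  proof -
    have "(\<Sum>i\<in>S. c i * g (b i)) = (\<Sum>j<M. \<Sum>i | i \<in> S \<and> b i = j. c i * g (b i))"
      using assms by (intro sum.group[symmetric]) auto
    also have "\<dots> = (\<Sum>j<M. \<Sum>i | i \<in> S \<and> b i = j. c i * g j)"
      by (intro sum.cong refl) auto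
    finally show ?thesis by (simp add: P_def sum_distrib_right)
  qed
  have "(\<Sum>i\<in>S. \<Sum>k\<in>S. c i * c k * F (b i) (b k)) = (\<Sum>i\<in>S. c i * (\<Sum>k\<in>S. c k * F (b i) (b k)))"
    by (simp add: sum_distrib_left mult_ac)
  also have "\<dots> = (\<Sum>i\<in>S. c i * (\<Sum>l<M. P l * F (b i) l))"
    by (simp only: *)
  also have "\<dots> = (\<Sum>j<M. P j * (\<Sum>l<M. P l * F j l))"
    by (rule *[of "\<lambda>j. \<Sum>l<M. P l * F j l"])
  finally show ?thesis by (simp add: P_def[symmetric] sum_distrib_left mult_ac)
qed

text \<open>
  The form is compared with one that is constant on the blocks \<open>\<rho>\<^sup>j \<le> i < \<rho>\<^bsup>j+1\<^esup>\<close>; since the kernel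
  \<open>q/i\<close> (\<open>k < v i\<close>), \<open>-q/k\<close> (\<open>k \<ge> v i\<close>) is homogeneous, the latter is a Toeplitz form in the normalized block sums.
\<close>

lemma block_form_bound:
  fixes v q \<delta> r :: real and N J n :: nat and G :: "nat \<Rightarrow> nat \<Rightarrow> real" and c :: "nat \<Rightarrow> real"
  assumes v: "1 < v" and q: "q = v / (1 + v)" and r: "1 < r" "r ^ (2 * J) = v" and J: "J \<ge> 1" and N: "N \<ge> 1"
    and sym: "\<And>i k. G i k = G k i" and diag: "\<And>i. N \<le> i \<Longrightarrow> G i i = 1"
    and approx: "\<And>i k. N \<le> i \<Longrightarrow> i < k \<Longrightarrow>
      \<bar>G i k - (if real k < v * real i then q / real i else - q / real k)\<bar> \<le> \<delta> / real k"
    and d0: "\<delta> \<ge> 0"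
    and symbol: "\<forall>\<^sub>F M in sequentially. \<forall>x. (99/100) / (r\<^sup>2 - 1) + q
       + 2 * (\<Sum>m=1..<M. (if m < J then q * r ^ m else - q / r ^ m) * cos (real m * x)) \<ge> 0"
  shows "(\<Sum>i=N..n. \<Sum>k=N..n. c i * c k * G i k)
    \<ge> (1 - q * r\<^sup>2 / real N - 4 * (\<delta> + q * v * (r\<^sup>2 - 1))
        - (2 * v + (99/100) / (r\<^sup>2 - 1)) * (r\<^sup>2 - 1 + r\<^sup>2 / real N)) * (\<Sum>i=N..n. (c i)\<^sup>2)"
proof -
  define \<rho> where "\<rho> = r\<^sup>2"
  have \<rho>: "\<rho> > 1" using r by (simp add: \<rho>_def)
  have \<rho>J: "\<rho> ^ J = v" using r by (simp add: \<rho>_def power_mult)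
  have q0: "q > 0" and qv: "q * v + q = v"
  proof -
    show "q > 0" using v unfolding q by simp
    have "q * (1 + v) = v" using v unfolding q by simp
    then show "q * v + q = v" by (simp add: algebra_simps)
  qed
  define b where "b i = nat \<lfloor>log \<rho> (real i)\<rfloor>" for i :: nat
  have b: "\<rho> ^ b i \<le> real i" "real i < \<rho> ^ Suc (b i)" if "i \<ge> 1" for i
  proof -
    have l0: "log \<rho> (real i) \<ge> 0" using that \<rho> by simp
    have "real (b i) \<le> log \<rho> (real i)" using l0 by (simp add: b_def)
    moreover have "log \<rho> (real i) < real (Suc (b i))" using l0 unfolding b_def by linarith
    ultimately show "\<rho> ^ b i \<le> real i" "real i < \<rho> ^ Suc (b i)"
      using that \<rho> by (auto simp: le_log_iff log_less_iff powr_realpow[symmetric] simp del: power_Suc of_nat_Suc)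
  qed
  have pmono: "j \<le> l" if "\<rho> ^ j < \<rho> ^ Suc l" for j l
    using that \<rho> power_less_imp_less_exp[of \<rho> j "Suc l"] by simp
  \<comment> \<open>On blocks j \<le> l the homogeneous kernel is replaced by its value at i =
    \<rho>^j, k = \<rho>^l. Dividing the block sums by r^j and r^l turns it into a function of l - j
    alone: q / \<rho>^j = q r^(l-j) / (r^j r^l), and similarly for -q / \<rho>^l.\<close>
  define \<kappa> where "\<kappa> m = (if m < J then q * r ^ m else - q / r ^ m)" for m
  define dst where "dst j l = (if j \<le> l then l - j else j - l)" for j l :: nat
  define S where "S = {N..n}"
  obtain M0 where M0: "\<And>M. M \<ge> M0 \<Longrightarrow> \<forall>x. (99/100) / (r\<^sup>2 - 1) + q
       + 2 * (\<Sum>m=1..<M. (if m < J then q * r ^ m else - q / r ^ m) * cos (real m * x)) \<ge> 0"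
    using symbol unfolding eventually_sequentially by blast
  define M where "M = max M0 (Suc (Max (b ` S)))"
  have bM: "b i < M" if "i \<in> S" for i
  proof -
    have "b i \<le> Max (b ` S)" using that by (intro Max_ge) (auto simp: S_def)
    then show ?thesis by (simp add: M_def)
  qed
  define A where "A j = {i. i \<in> S \<and> b i = j}" for j
  define z y where "z j = (\<Sum>i\<in>A j. c i) / r ^ j" and "y j = (\<Sum>i\<in>A j. \<bar>c i\<bar>) / r ^ j" for j
  have r2: "r ^ j * r ^ j = \<rho> ^ j" for j by (simp add: \<rho>_def power2_eq_square power_mult_distrib)
  \<comment> \<open>Cauchy-Schwarz against the size of the block, at most \<rho>^j (\<rho> - 1) + 1.
    A nonempty block has N \<le> \<rho>^(j+1), which absorbs the extra 1 into the term \<rho> /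
    N.\<close>
  have ysq: "(y j)\<^sup>2 \<le> (\<rho> - 1 + \<rho> / real N) * (\<Sum>i\<in>A j. (c i)\<^sup>2)" for j
  proof (cases "A j = {}")
    case True
    then show ?thesis by (simp add: y_def)
  next
    case False
    have Ai: "\<rho> ^ j \<le> real i \<and> real i < \<rho> ^ j + \<rho> ^ j * (\<rho> - 1)" if "i \<in> A j" for i
      using b[of i] that N by (auto simp: A_def S_def algebra_simps)
    have "real (card (A j)) \<le> \<rho> ^ j * (\<rho> - 1) + 1"
      using \<rho> by (intro card_real_interval(2)[OF Ai]) auto
    moreover obtain i where "i \<in> A j" using False by blast
    then have "real N \<le> \<rho> ^ j * \<rho>" using Ai[of i] by (auto simp: A_def S_def algebra_simps)
    then have "1 \<le> \<rho> ^ j * (\<rho> / real N)" using N by (simp add: field_simps)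
    ultimately have cd: "real (card (A j)) \<le> \<rho> ^ j * (\<rho> - 1 + \<rho> / real N)"
      by (simp only: distrib_left) 
    have "(\<Sum>i\<in>A j. \<bar>c i\<bar>)\<^sup>2 \<le> real (card (A j)) * (\<Sum>i\<in>A j. (c i)\<^sup>2)"
      using sum_squared_le_sum_of_squares[of "\<lambda>i. \<bar>c i\<bar>" "A j"] by (simp add: mult.commute)
    also have "\<dots> \<le> \<rho> ^ j * (\<rho> - 1 + \<rho> / real N) * (\<Sum>i\<in>A j. (c i)\<^sup>2)"
      using cd by (intro mult_right_mono sum_nonneg) auto
    finally have "(y j)\<^sup>2 \<le> \<rho> ^ j * (\<rho> - 1 + \<rho> / real N) * (\<Sum>i\<in>A j. (c i)\<^sup>2) / \<rho> ^ j"
      unfolding y_def power_divide power2_eq_square[of "r ^ j"] r2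
      using \<rho> by (intro divide_right_mono) auto
    then show ?thesis using \<rho> by simp
  qed
  have zy: "(z j)\<^sup>2 \<le> (y j)\<^sup>2" for j
  proof -
    have "\<bar>z j\<bar> \<le> y j"
      unfolding z_def y_def using r by (simp add: abs_divide divide_right_mono sum_abs)
    then show ?thesis by (simp add: abs_le_square_iff[symmetric])
  qed
  have Ysum: "(\<Sum>j<M. (y j)\<^sup>2) \<le> (\<rho> - 1 + \<rho> / real N) * (\<Sum>i\<in>S. (c i)\<^sup>2)"
  proof -
    have "(\<Sum>j<M. (y j)\<^sup>2) \<le> (\<rho> - 1 + \<rho> / real N) * (\<Sum>j<M. \<Sum>i\<in>A j. (c i)\<^sup>2)"
      unfolding sum_distrib_left by (intro sum_mono) (use ysq in \<open>simp add: sum_distrib_left\<close>)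
    also have "(\<Sum>j<M. \<Sum>i\<in>A j. (c i)\<^sup>2) = (\<Sum>i\<in>S. (c i)\<^sup>2)"
      unfolding A_def by (rule sum.group) (use bM in \<open>auto simp: S_def\<close>)
    finally show ?thesis .
  qed
  define C where "C = (99/100) / (r\<^sup>2 - 1)"
  have C0: "C > 0" using \<rho> by (simp add: C_def \<rho>_def)
  \<comment> \<open>The symbol is nonnegative only after C is added to the diagonal. Undoing this
    costs C times the sum of z_j^2, which by \<open>ysq\<close> amounts to about 99/100 of the
    identity.\<close>
  have toep: "(\<Sum>i\<in>S. \<Sum>k\<in>S. c i * c k * (\<kappa> (dst (b i) (b k)) / (r ^ b i * r ^ b k))) \<ge> - (C * (\<Sum>j<M. (y j)\<^sup>2))"
  proof -
    have \<kappa>0: "\<kappa> 0 = q" using J by (simp add: \<kappa>_def)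
    define t where "t m = (if m = 0 then C + q else \<kappa> m)" for m
    have "0 \<le> (\<Sum>j<M. \<Sum>l<M. t (if j \<le> l then l - j else j - l) * z j * z l)"
    proof (rule toeplitz_nonneg)
      fix x
      have "(\<Sum>m=1..<M. t m * cos (real m * x)) = (\<Sum>m=1..<M. (if m < J then q * r ^ m else - q / r ^ m) * cos (real m * x))"
        by (intro sum.cong) (auto simp: t_def \<kappa>_def)
      then show "0 \<le> t 0 + 2 * (\<Sum>m=1..<M. t m * cos (real m * x))"
        using M0[of M] by (auto simp: t_def C_def M_def)
    qed
    also have "\<dots> = (\<Sum>j<M. \<Sum>l<M. \<kappa> (dst j l) * z j * z l + (if j = l then C * z j * z l else 0))"
      by (intro sum.cong refl) (auto simp: t_def dst_def \<kappa>0 algebra_simps)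
    also have "\<dots> = (\<Sum>j<M. \<Sum>l<M. \<kappa> (dst j l) * z j * z l) + C * (\<Sum>j<M. (z j)\<^sup>2)"
      by (simp add: sum.distrib sum_distrib_left power2_eq_square mult_ac)
    also have "(\<Sum>j<M. (z j)\<^sup>2) \<le> (\<Sum>j<M. (y j)\<^sup>2)" by (intro sum_mono zy)
    finally have "0 \<le> (\<Sum>j<M. \<Sum>l<M. \<kappa> (dst j l) * z j * z l) + C * (\<Sum>j<M. (y j)\<^sup>2)"
      using C0 by simp
    moreover have "(\<Sum>i\<in>S. \<Sum>k\<in>S. c i * c k * (\<kappa> (dst (b i) (b k)) / (r ^ b i * r ^ b k)))
       = (\<Sum>j<M. \<Sum>l<M. \<kappa> (dst j l) / (r ^ j * r ^ l) * (\<Sum>i\<in>A j. c i) * (\<Sum>i\<in>A l. c i))"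
      unfolding A_def by (rule sum_fibre_product) (use bM in \<open>auto simp: S_def\<close>)
    ultimately show ?thesis by (simp add: z_def)
  qed
  \<comment> \<open>For blocks at distance exactly J the jump at k = v i may run through the pair of
    blocks, so the true kernel and the block kernel may pick different branches. Each block has at
    most two such partners.\<close>
  have mism: "(\<Sum>i\<in>S. \<Sum>k\<in>S. \<bar>c i\<bar> * \<bar>c k\<bar> * ((if dst (b i) (b k) = J then v else 0) / (r ^ b i * r ^ b k)))
      \<le> 2 * v * (\<Sum>j<M. (y j)\<^sup>2)"
  proof -
    define e where "e j l = (if dst j l = J then 1 else 0 :: real)" for j l
    have e_sym: "e j l = e l j" for j l by (auto simp: e_def dst_def)
    have e_sum: "(\<Sum>l<M. e j l) \<le> 2" for j
    proof -
      have "(\<Sum>l<M. e j l) \<le> (\<Sum>l<M. (if l = j + J then 1 else 0) + (if l = j - J then 1 else 0))"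
        by (intro sum_mono) (auto simp: e_def dst_def)
      also have "\<dots> \<le> 1 + 1"
        unfolding sum.distrib by (intro add_mono) (auto simp: sum.delta')
      finally show ?thesis by simp
    qed
    have "(\<Sum>i\<in>S. \<Sum>k\<in>S. \<bar>c i\<bar> * \<bar>c k\<bar> * ((if dst (b i) (b k) = J then v else 0) / (r ^ b i * r ^ b k)))
       = (\<Sum>j<M. \<Sum>l<M. (if dst j l = J then v else 0) / (r ^ j * r ^ l) * (\<Sum>i\<in>A j. \<bar>c i\<bar>) * (\<Sum>i\<in>A l. \<bar>c i\<bar>))"
      unfolding A_def by (rule sum_fibre_product) (use bM in \<open>auto simp: S_def\<close>)
    also have "\<dots> = (\<Sum>j<M. \<Sum>l<M. v * (e j l * (y j * y l)))"
      by (intro sum.cong refl) (simp add: y_def e_def)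
    also have "\<dots> \<le> (\<Sum>j<M. \<Sum>l<M. v * (e j l * (((y j)\<^sup>2 + (y l)\<^sup>2) / 2)))"
    proof (intro sum_mono mult_left_mono)
      show "y j * y l \<le> ((y j)\<^sup>2 + (y l)\<^sup>2) / 2" for j l
        using sum_squares_bound[of "y j" "y l"] by simp
    qed (use v in \<open>auto simp: e_def\<close>)
    also have "\<dots> = v / 2 * ((\<Sum>j<M. \<Sum>l<M. e j l * (y j)\<^sup>2) + (\<Sum>j<M. \<Sum>l<M. e j l * (y l)\<^sup>2))"
      by (simp add: sum.distrib[symmetric] sum_distrib_left algebra_simps add_divide_distrib)
    also have "(\<Sum>j<M. \<Sum>l<M. e j l * (y l)\<^sup>2) = (\<Sum>j<M. \<Sum>l<M. e j l * (y j)\<^sup>2)"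
      by (subst sum.swap) (simp add: e_sym)
    also have "(\<Sum>j<M. \<Sum>l<M. e j l * (y j)\<^sup>2) = (\<Sum>j<M. (\<Sum>l<M. e j l) * (y j)\<^sup>2)"
      by (simp add: sum_distrib_right)
    also have "v / 2 * ((\<Sum>j<M. (\<Sum>l<M. e j l) * (y j)\<^sup>2) + (\<Sum>j<M. (\<Sum>l<M. e j l) * (y j)\<^sup>2))
        \<le> v / 2 * ((\<Sum>j<M. 2 * (y j)\<^sup>2) + (\<Sum>j<M. 2 * (y j)\<^sup>2))"
      using v by (intro mult_left_mono add_mono sum_mono mult_right_mono e_sum) auto
    finally show ?thesis by (simp add: sum_distrib_left[symmetric])
  qed
  have off: "\<bar>G i k - \<kappa> (dst (b i) (b k)) / (r ^ b i * r ^ b k)\<bar>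
      \<le> (\<delta> + q * v * (\<rho> - 1)) / max (real i) (real k) + (if dst (b i) (b k) = J then v else 0) / (r ^ b i * r ^ b k)"
    if ik: "i \<in> S" "k \<in> S" "i < k" for i k
  proof -
    define j l where "j = b i" and "l = b k"
    have i: "i \<ge> 1" "N \<le> i" and k: "k \<ge> 1" using ik N by (auto simp: S_def)
    have j: "\<rho> ^ j \<le> real i" "real i < \<rho> ^ j * \<rho>" and l: "\<rho> ^ l \<le> real k" "real k < \<rho> ^ l * \<rho>"
      using b[OF i(1)] b[OF k] by (auto simp: j_def l_def mult.commute)
    have jl: "j \<le> l" using ik j l by (intro pmono) (simp add: mult.commute)
    have dst: "dst j l = l - j" using jl by (simp add: dst_def)
    have pj: "\<rho> ^ j > 0" "\<rho> ^ l > 0" using \<rho> by auto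
    have ij: "0 \<le> 1 / \<rho> ^ j - 1 / real i" "1 / \<rho> ^ j - 1 / real i \<le> (\<rho> - 1) / real i"
      using j i pj by (auto simp: field_simps)
    have kl: "0 \<le> 1 / \<rho> ^ l - 1 / real k" "1 / \<rho> ^ l - 1 / real k \<le> (\<rho> - 1) / real k"
      using l k pj by (auto simp: field_simps)
    have rjl: "r ^ l = r ^ (l - j) * r ^ j" using jl by (simp add: power_add[symmetric])
    have mx: "max (real i) (real k) = real k" using ik by simp
    define K0 where "K0 = (if real k < v * real i then q / real i else - q / real k)"
    have "\<bar>K0 - \<kappa> (l - j) / (r ^ j * r ^ l)\<bar> \<le> q * v * (\<rho> - 1) / real k + (if l - j = J then v else 0) / (r ^ j * r ^ l)"
    proof (cases "real k < v * real i")
      case near: True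
      have "\<rho> ^ l < \<rho> ^ Suc (j + J)"
      proof -
        have "\<rho> ^ l \<le> real k" by (rule l)
        also have "\<dots> < v * real i" by (rule near)
        also have "\<dots> < v * (\<rho> ^ j * \<rho>)" using j v by simp
        finally show ?thesis by (simp add: \<rho>J[symmetric] power_add mult_ac)
      qed
      then have lJ: "l \<le> j + J" by (rule pmono)
      show ?thesis
      proof (cases "l - j = J")
        case True
        have "\<kappa> (l - j) / (r ^ j * r ^ l) = - q / (r ^ (l - j) * r ^ j * r ^ l)"
          using True by (simp add: \<kappa>_def)
        also have "\<dots> = - q / \<rho> ^ l" unfolding rjl[symmetric] r2 ..
        finally have e: "\<kappa> (l - j) / (r ^ j * r ^ l) = - q / \<rho> ^ l" .
        \<comment> \<open>Here the true kernel is q / i but the block kernel is -q / \<rho>^l, with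
          opposite signs. Since 1 / i < v / k, the discrepancy is at most (q v + q) / \<rho>^l, and
          q v + q = v.\<close>
        have "q / real i \<le> q * v / real k"
          using near i k q0 by (simp add: field_simps)
        also have "q * v / real k = q * v * (1 / real k)" by simp
        also have "\<dots> \<le> q * v * (1 / \<rho> ^ l)" using kl q0 v by (intro mult_left_mono) auto
        finally have "q / real i + q / \<rho> ^ l \<le> q * v * (1 / \<rho> ^ l) + q * (1 / \<rho> ^ l)" by simp
        also have "\<dots> = (q * v + q) * (1 / \<rho> ^ l)" by (simp only: distrib_right)
        also have "\<dots> = v / \<rho> ^ l" by (simp add: qv)
        also have "\<dots> \<le> v / (r ^ j * r ^ l)"
        proof (rule divide_left_mono)
          have "r ^ j \<le> r ^ l" using jl r by (intro power_increasing) auto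
          then show "r ^ j * r ^ l \<le> \<rho> ^ l" unfolding r2[symmetric] using r by (intro mult_right_mono) auto
        qed (use v r pj in auto)
        finally have "\<bar>q / real i - (- q / \<rho> ^ l)\<bar> \<le> v / (r ^ j * r ^ l)"
          using q0 i pj by simp
        moreover have "0 \<le> q * v * (\<rho> - 1) / real k" using q0 v \<rho> by simp
        ultimately show ?thesis unfolding e K0_def using near True by simp
      next
        case False
        then have lJ: "l - j < J" using lJ by linarith
        have "\<kappa> (l - j) / (r ^ j * r ^ l) = q * r ^ (l - j) / (r ^ j * (r ^ (l - j) * r ^ j))"
          using lJ rjl by (simp add: \<kappa>_def)
        also have "\<dots> = q / (r ^ j * r ^ j)" using r by simp
        finally have e: "\<kappa> (l - j) / (r ^ j * r ^ l) = q / \<rho> ^ j" unfolding r2 .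
        have "\<bar>q / real i - q / \<rho> ^ j\<bar> = q * (1 / \<rho> ^ j - 1 / real i)"
        proof -
          have "q / real i - q / \<rho> ^ j = - (q * (1 / \<rho> ^ j - 1 / real i))" by (simp add: right_diff_distrib)
          moreover have "q * (1 / \<rho> ^ j - 1 / real i) \<ge> 0" using q0 ij by simp
          ultimately show ?thesis by linarith
        qed
        also have "\<dots> \<le> q * ((\<rho> - 1) / real i)" using ij q0 by (intro mult_left_mono) auto
        also have "\<dots> \<le> q * (v * (\<rho> - 1) / real k)"
        proof (rule mult_left_mono)
          have "(\<rho> - 1) * real k \<le> (\<rho> - 1) * (v * real i)"
            using near \<rho> by (intro mult_left_mono) auto
          then show "(\<rho> - 1) / real i \<le> v * (\<rho> - 1) / real k"
            using i k by (simp add: field_simps)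
        qed (use q0 in simp)
        finally show ?thesis unfolding e K0_def using near False by (simp add: mult_ac)
      qed
    next
      case far: False
      have "\<rho> ^ (j + J) < \<rho> ^ Suc l"
      proof -
        have "\<rho> ^ (j + J) = v * \<rho> ^ j" by (simp add: \<rho>J[symmetric] power_add)
        also have "\<dots> \<le> v * real i" using j v by simp
        also have "\<dots> \<le> real k" using far by simp
        also have "\<dots> < \<rho> ^ l * \<rho>" by (rule l)
        finally show ?thesis by (simp add: mult.commute)
      qed
      then have lJ: "j + J \<le> l" by (rule pmono)
      have "\<kappa> (l - j) / (r ^ j * r ^ l) = - q / (r ^ (l - j) * r ^ j * r ^ l)"
        using lJ by (simp add: \<kappa>_def)
      also have "\<dots> = - q / \<rho> ^ l" unfolding rjl[symmetric] r2 ..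
      finally have e: "\<kappa> (l - j) / (r ^ j * r ^ l) = - q / \<rho> ^ l" .
      have "\<bar>- q / real k - (- q / \<rho> ^ l)\<bar> = q * (1 / \<rho> ^ l - 1 / real k)"
      proof -
        have "- q / real k - (- q / \<rho> ^ l) = q * (1 / \<rho> ^ l - 1 / real k)" by (simp add: right_diff_distrib)
        moreover have "q * (1 / \<rho> ^ l - 1 / real k) \<ge> 0" using q0 kl by simp
        ultimately show ?thesis by linarith
      qed
      also have "\<dots> \<le> q * ((\<rho> - 1) / real k)" using kl q0 by (intro mult_left_mono) auto
      also have "\<dots> \<le> q * (v * (\<rho> - 1) / real k)"
        using q0 v \<rho> by (intro mult_left_mono divide_right_mono) auto
      also have "q * (v * (\<rho> - 1) / real k) = q * v * (\<rho> - 1) / real k" by (simp add: mult.assoc)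
      also have "\<dots> \<le> q * v * (\<rho> - 1) / real k + (if l - j = J then v else 0) / (r ^ j * r ^ l)"
      proof -
        have "0 \<le> (if l - j = J then v else 0) / (r ^ j * r ^ l)"
          using v r(1) by (intro divide_nonneg_pos) auto
        then show ?thesis by linarith
      qed
      finally show ?thesis unfolding e K0_def using far by simp
    qed
    moreover have "\<bar>G i k - K0\<bar> \<le> \<delta> / real k"
      using approx[OF i(2) ik(3)] unfolding K0_def .
    ultimately show ?thesis
      unfolding j_def[symmetric] l_def[symmetric] dst mx by (simp add: add_divide_distrib)
  qed
  define \<delta>' where "\<delta>' = \<delta> + q * v * (\<rho> - 1)"
  have \<delta>': "\<delta>' \<ge> 0" using d0 q0 v \<rho> by (simp add: \<delta>'_def)
  \<comment> \<open>On the diagonal the entry 1 replaces the block value q / \<rho>^(b i), which is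
    at most q \<rho> / N; off the diagonal this is \<open>off\<close>.\<close>
  have pt: "c i * c k * G i k \<ge> c i * c k * (\<kappa> (dst (b i) (b k)) / (r ^ b i * r ^ b k))
      + (if i = k then (1 - q * \<rho> / real N) * (c i)\<^sup>2 else 0)
      - \<delta>' * (\<bar>c i\<bar> * \<bar>c k\<bar> / max (real i) (real k))
      - \<bar>c i\<bar> * \<bar>c k\<bar> * ((if dst (b i) (b k) = J then v else 0) / (r ^ b i * r ^ b k))"
    if ik: "i \<in> S" "k \<in> S" for i k
  proof (cases "i = k")
    case True
    have iN: "N \<le> i" "i \<ge> 1" using ik N by (auto simp: S_def)
    have "\<kappa> (dst (b i) (b k)) / (r ^ b i * r ^ b k) = q / \<rho> ^ b i"
      using True J by (simp add: dst_def \<kappa>_def r2)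
    also have "\<dots> \<le> q * \<rho> / real N"
    proof -
      have "real N \<le> \<rho> * \<rho> ^ b i" using b[OF iN(2)] iN by simp
      then have "q * real N \<le> q * (\<rho> * \<rho> ^ b i)" using q0 by (intro mult_left_mono) auto
      then show ?thesis using N \<rho> by (simp add: field_simps)
    qed
    finally have "(c i)\<^sup>2 * (\<kappa> (dst (b i) (b k)) / (r ^ b i * r ^ b k)) \<le> (c i)\<^sup>2 * (q * \<rho> / real N)"
      by (intro mult_left_mono) auto
    moreover have "0 \<le> \<delta>' * (\<bar>c i\<bar> * \<bar>c k\<bar> / max (real i) (real k))" using \<delta>' by simp
    moreover have "0 \<le> \<bar>c i\<bar> * \<bar>c k\<bar> * ((if dst (b i) (b k) = J then v else 0) / (r ^ b i * r ^ b k))"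
      using v r by simp
    ultimately show ?thesis
      using True diag[OF iN(1)] by (simp add: power2_eq_square algebra_simps)
  next
    case False
    have "\<bar>G i k - \<kappa> (dst (b i) (b k)) / (r ^ b i * r ^ b k)\<bar>
      \<le> \<delta>' / max (real i) (real k) + (if dst (b i) (b k) = J then v else 0) / (r ^ b i * r ^ b k)"
    proof (cases "i < k")
      case True
      then show ?thesis using off[OF ik] by (simp add: \<delta>'_def)
    next
      case False
      with \<open>i \<noteq> k\<close> have "k < i" by simp
      have ds: "dst (b i) (b k) = dst (b k) (b i)" by (auto simp: dst_def)
      show ?thesis
        using off[OF ik(2,1) \<open>k < i\<close>] unfolding ds sym[of i k]
        by (simp add: \<delta>'_def max.commute mult.commute)
    qed
    then have "\<bar>c i * c k\<bar> * \<bar>G i k - \<kappa> (dst (b i) (b k)) / (r ^ b i * r ^ b k)\<bar>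
      \<le> \<bar>c i * c k\<bar> * (\<delta>' / max (real i) (real k) + (if dst (b i) (b k) = J then v else 0) / (r ^ b i * r ^ b k))"
      by (intro mult_left_mono) auto
    then have "\<bar>c i * c k * (G i k - \<kappa> (dst (b i) (b k)) / (r ^ b i * r ^ b k))\<bar>
      \<le> \<delta>' * (\<bar>c i\<bar> * \<bar>c k\<bar> / max (real i) (real k))
        + \<bar>c i\<bar> * \<bar>c k\<bar> * ((if dst (b i) (b k) = J then v else 0) / (r ^ b i * r ^ b k))"
      by (simp add: abs_mult[symmetric] distrib_left mult_ac)
    moreover have "c i * c k * (G i k - \<kappa> (dst (b i) (b k)) / (r ^ b i * r ^ b k))
       = c i * c k * G i k - c i * c k * (\<kappa> (dst (b i) (b k)) / (r ^ b i * r ^ b k))"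
      by (rule right_diff_distrib)
    moreover have "(if i = k then (1 - q * \<rho> / real N) * (c i)\<^sup>2 else 0) = 0" using False by simp
    moreover have "p + z - x - y \<le> a" if "\<bar>e\<bar> \<le> x + y" "e = a - p" "z = 0" for p z x y a e :: real
      using that by linarith
    ultimately show ?thesis by blast
  qed
  have hs: "(\<Sum>i\<in>S. \<Sum>k\<in>S. \<bar>c i\<bar> * \<bar>c k\<bar> / max (real i) (real k)) \<le> 4 * (\<Sum>i\<in>S. (c i)\<^sup>2)"
    unfolding S_def by (rule hardy_schur_tail[OF N])
  define Q Y where "Q = (\<Sum>i\<in>S. (c i)\<^sup>2)" and "Y = (\<Sum>j<M. (y j)\<^sup>2)"
  have "(\<Sum>i\<in>S. \<Sum>k\<in>S. c i * c k * G i k) \<ge>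
     (\<Sum>i\<in>S. \<Sum>k\<in>S. c i * c k * (\<kappa> (dst (b i) (b k)) / (r ^ b i * r ^ b k))
      + (if i = k then (1 - q * \<rho> / real N) * (c i)\<^sup>2 else 0)
      - \<delta>' * (\<bar>c i\<bar> * \<bar>c k\<bar> / max (real i) (real k))
      - \<bar>c i\<bar> * \<bar>c k\<bar> * ((if dst (b i) (b k) = J then v else 0) / (r ^ b i * r ^ b k)))"
    by (intro sum_mono pt)
  also have "(\<Sum>i\<in>S. \<Sum>k\<in>S. c i * c k * (\<kappa> (dst (b i) (b k)) / (r ^ b i * r ^ b k))
      + (if i = k then (1 - q * \<rho> / real N) * (c i)\<^sup>2 else 0)
      - \<delta>' * (\<bar>c i\<bar> * \<bar>c k\<bar> / max (real i) (real k))
      - \<bar>c i\<bar> * \<bar>c k\<bar> * ((if dst (b i) (b k) = J then v else 0) / (r ^ b i * r ^ b k)))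
    = (\<Sum>i\<in>S. \<Sum>k\<in>S. c i * c k * (\<kappa> (dst (b i) (b k)) / (r ^ b i * r ^ b k)))
      + (1 - q * \<rho> / real N) * Q
      - \<delta>' * (\<Sum>i\<in>S. \<Sum>k\<in>S. \<bar>c i\<bar> * \<bar>c k\<bar> / max (real i) (real k))
      - (\<Sum>i\<in>S. \<Sum>k\<in>S. \<bar>c i\<bar> * \<bar>c k\<bar> * ((if dst (b i) (b k) = J then v else 0) / (r ^ b i * r ^ b k)))"
  proof -
    have "(\<Sum>i\<in>S. \<Sum>k\<in>S. (if i = k then (1 - q * \<rho> / real N) * (c i)\<^sup>2 else 0)) = (1 - q * \<rho> / real N) * Q"
      by (simp add: Q_def sum_distrib_left S_def)
    then show ?thesis by (simp only: sum.distrib sum_subtractf sum_distrib_left[symmetric])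
  qed
  also have "\<dots> \<ge> - (C * Y) + (1 - q * \<rho> / real N) * Q - \<delta>' * (4 * Q) - 2 * v * Y"
    using toep mism mult_left_mono[OF hs \<delta>'] by (simp only: Y_def[symmetric] Q_def[symmetric])
  finally have 1: "(\<Sum>i\<in>S. \<Sum>k\<in>S. c i * c k * G i k) \<ge> - ((C + 2 * v) * Y) + (1 - q * \<rho> / real N) * Q - \<delta>' * (4 * Q)"
    by (simp add: algebra_simps)
  have "(C + 2 * v) * Y \<le> (C + 2 * v) * ((\<rho> - 1 + \<rho> / real N) * Q)"
    using Ysum C0 v by (intro mult_left_mono) (auto simp: Y_def Q_def)
  with 1 have "(\<Sum>i\<in>S. \<Sum>k\<in>S. c i * c k * G i k)
     \<ge> - ((C + 2 * v) * ((\<rho> - 1 + \<rho> / real N) * Q)) + (1 - q * \<rho> / real N) * Q - \<delta>' * (4 * Q)" by linarith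
  also have "- ((C + 2 * v) * ((\<rho> - 1 + \<rho> / real N) * Q)) + (1 - q * \<rho> / real N) * Q - \<delta>' * (4 * Q)
     = (1 - q * \<rho> / real N - 4 * \<delta>' - (2 * v + C) * (\<rho> - 1 + \<rho> / real N)) * Q"
    by (simp add: algebra_simps)
  finally show ?thesis
    unfolding Q_def S_def C_def \<delta>'_def \<rho>_def .
qed

text \<open>The unit diagonal contributes 1, the symbol consumes 99/100, and beyond a small multiple
  of \<delta> the losses are of order r^2 - 1 or 1 / N. Hence J is fixed before N0. The constants
  depend on v alone and serve every G, so the parameters that define the Gram matrix may be chosen
  afterwards.\<close>

theorem form_positive:
  fixes v :: real
  assumes v: "2 < v" "v < 2.3"
  defines "q \<equiv> v / (1 + v)"
  obtains \<delta> :: real and N0 :: nat where "\<delta> > 0" "N0 \<ge> 1"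
    "\<And>N G c n. N \<ge> N0 \<Longrightarrow> (\<And>i k. G i k = G k i) \<Longrightarrow> (\<And>i. N \<le> i \<Longrightarrow> G i i = 1) \<Longrightarrow>
      (\<And>i k. N \<le> i \<Longrightarrow> i < k \<Longrightarrow>
        \<bar>G i k - (if real k < v * real i then q / real i else - q / real k)\<bar> \<le> \<delta> / real k) \<Longrightarrow>
      (\<Sum>i=N..n. \<Sum>k=N..n. c i * c k * G i k) \<ge> 1/1000 * (\<Sum>i=N..n. (c i)\<^sup>2)"
proof -
  have "\<forall>\<^sub>F J in sequentially. J \<ge> 1 \<and> (let r = v powr (1 / (2 * real J)) in 1 < r \<and> r ^ J = sqrt v \<and> r - 1 \<le> 1/10000 \<and>
    (\<forall>\<^sub>F M in sequentially. \<forall>x. (99/100) / (r\<^sup>2 - 1) + q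
       + 2 * (\<Sum>m=1..<M. (if m < J then q * r ^ m else - q / r ^ m) * cos (real m * x)) \<ge> 0))"
    using eventually_scale[OF v] symbol_nonneg[OF v] unfolding q_def
    by eventually_elim (auto simp: Let_def)
  then obtain J r where J: "J \<ge> 1" and r: "1 < r" "r ^ J = sqrt v" "r - 1 \<le> 1/10000"
    and symbol: "\<forall>\<^sub>F M in sequentially. \<forall>x. (99/100) / (r\<^sup>2 - 1) + q
       + 2 * (\<Sum>m=1..<M. (if m < J then q * r ^ m else - q / r ^ m) * cos (real m * x)) \<ge> 0"
    unfolding eventually_sequentially Let_def by blast
  have rv: "r ^ (2 * J) = v" using r v by (simp add: power_mult[symmetric] mult.commute[of 2] power_mult)
  define \<epsilon> where "\<epsilon> = r\<^sup>2 - 1"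
  have \<epsilon>: "\<epsilon> > 0" using r by (simp add: \<epsilon>_def)
  have "\<epsilon> = (r - 1) * (r + 1)" by (simp add: \<epsilon>_def power2_eq_square algebra_simps)
  also have "\<dots> \<le> (1/10000) * 2.0001" using r by (intro mult_mono) auto
  finally have \<epsilon>2: "\<epsilon> \<le> 0.00021" by simp
  have q: "0 < q" "q \<le> 1" using v by (auto simp: q_def)
  define B where "B = (99/100) / \<epsilon> * (1 + \<epsilon>) + 6 * (1 + \<epsilon>)"
  have B: "B > 0" using \<epsilon> by (simp add: B_def add_pos_pos)
  obtain N0 :: nat where N0: "real N0 \<ge> max 1 (1000 * B)" using real_arch_simple by blast
  show thesis
  proof (rule that[of "1/10000" N0])
    show "N0 \<ge> 1" using N0 by linarith
    fix N G c n
    assume N: "N \<ge> N0" and G: "\<And>i k. G i k = (G k i :: real)" "\<And>i. N \<le> i \<Longrightarrow> G i i = 1"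
      "\<And>i k. N \<le> i \<Longrightarrow> i < k \<Longrightarrow>
        \<bar>G i k - (if real k < v * real i then q / real i else - q / real k)\<bar> \<le> (1/10000) / real k"
    have N1: "real N \<ge> 1" "real N \<ge> 1000 * B" using N N0 by linarith+
    have BN: "B / real N \<le> 1/1000" using N1 by (simp add: field_simps)
    let ?L = "1 - q * r\<^sup>2 / real N - 4 * (1/10000 + q * v * (r\<^sup>2 - 1))
        - (2 * v + (99/100) / (r\<^sup>2 - 1)) * (r\<^sup>2 - 1 + r\<^sup>2 / real N)"
    have bnd: "(\<Sum>i=N..n. \<Sum>k=N..n. c i * c k * G i k) \<ge> ?L * (\<Sum>i=N..n. (c i)\<^sup>2)"
      by (rule block_form_bound[OF _ _ r(1) rv J _ G _ symbol]) (use v N1 q_def in auto)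
    have "1/1000 \<le> ?L"
    proof -
      have r2: "r\<^sup>2 = 1 + \<epsilon>" by (simp add: \<epsilon>_def)
      define w C where "w = (1 + \<epsilon>) / real N" and "C = (99/100) / \<epsilon>"
      have w: "w \<ge> 0" using \<epsilon> by (simp add: w_def)
      have "(q + 2 * v) * w \<le> 6 * w"
        using q v w by (intro mult_right_mono) auto
      moreover have "6 * w + C * w = B / real N"
        unfolding w_def C_def
        by (simp only: times_divide_eq_right) (simp only: B_def add_divide_distrib add.commute)
      moreover have "q * v * \<epsilon> \<le> 1 * (23/10) * (21/100000)" using q v \<epsilon> \<epsilon>2 by (intro mult_mono) auto
      moreover have "2 * v * \<epsilon> \<le> 2 * (23/10) * (21/100000)" using v \<epsilon> \<epsilon>2 by (intro mult_mono) auto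
      moreover have "?L = 1 - 4/10000 - 4 * (q * v * \<epsilon>) - 2 * v * \<epsilon> - 99/100 - ((q + 2 * v) * w + C * w)"
      proof -
        have 1: "q * (1 + \<epsilon>) / real N = q * w" by (simp add: w_def)
        have 2: "C * \<epsilon> = 99/100" using \<epsilon> by (simp add: C_def)
        have 3: "1 + \<epsilon> - 1 = \<epsilon>" by simp
        have 4: "(2 * v + C) * (\<epsilon> + w) = 2 * v * \<epsilon> + C * \<epsilon> + 2 * v * w + C * w"
          by (simp add: algebra_simps)
        show ?thesis
          unfolding r2 1 3 C_def[symmetric] w_def[symmetric] 4 2 by (simp add: algebra_simps)
      qed
      ultimately show ?thesis using BN by linarith
    qed
    then have "1/1000 * (\<Sum>i=N..n. (c i)\<^sup>2) \<le> ?L * (\<Sum>i=N..n. (c i)\<^sup>2)"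
      by (intro mult_right_mono sum_nonneg) auto
    then show "(\<Sum>i=N..n. \<Sum>k=N..n. c i * c k * G i k) \<ge> 1/1000 * (\<Sum>i=N..n. (c i)\<^sup>2)"
      using bnd by linarith
  qed simp
qed

section \<open>Prescribed greedy runs\<close>

instance ell2 :: banach ..

text \<open>Strict maximality leaves a single admissible run, so every statement about all iterates
  \<open>g\<close> concerns one explicit sequence.\<close>

lemma pga_unique_maximizer:
  fixes e :: "nat \<Rightarrow> 'a::{real_inner, complete_space}"
  assumes mem: "\<And>n. e n \<in> D"
    and coeff: "\<And>n. (f - (\<Sum>k<n. \<beta> k *\<^sub>R e k)) \<bullet> e n = \<beta> n"
    and strict: "\<And>n x. x \<in> D \<Longrightarrow> x \<noteq> e n \<Longrightarrow> (f - (\<Sum>k<n. \<beta> k *\<^sub>R e k)) \<bullet> x < \<beta> n"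
  shows "pga_iterate D f n g \<Longrightarrow> g = (\<Sum>k<n. \<beta> k *\<^sub>R e k)" and "pga_well_defined D f"
proof -
  have max: "is_arg_max (\<lambda>d. (f - (\<Sum>k<n. \<beta> k *\<^sub>R e k)) \<bullet> d) (\<lambda>d. d \<in> D) x \<longleftrightarrow> x = e n" for n x
  proof
    assume m: "is_arg_max (\<lambda>d. (f - (\<Sum>k<n. \<beta> k *\<^sub>R e k)) \<bullet> d) (\<lambda>d. d \<in> D) x"
    show "x = e n"
    proof (rule ccontr)
      assume "x \<noteq> e n"
      then show False
        using m strict[of x n] mem[of n] coeff[of n] unfolding is_arg_max_def by auto
    qed
  next
    assume "x = e n"
    then show "is_arg_max (\<lambda>d. (f - (\<Sum>k<n. \<beta> k *\<^sub>R e k)) \<bullet> d) (\<lambda>d. d \<in> D) x"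
      using mem[of n] coeff[of n] strict[of _ n] unfolding is_arg_max_def
      by (metis less_asym order_less_irrefl)
  qed
  show it: "g = (\<Sum>k<n. \<beta> k *\<^sub>R e k)" if "pga_iterate D f n g" for n g
    using that
  proof induction
    case zero
    then show ?case by simp
  next
    case (step n g d)
    then have "d = e n" using max by simp
    then show ?case using step coeff by simp
  qed
  show "pga_well_defined D f"
    unfolding pga_well_defined_def using it max by blast
qed

text \<open>\<open>R i n\<close> is the correlation of the n-th residual with e_i.
  \<open>lower\<close> makes the vectors exist, \<open>upper\<close> makes the series for f
  converge. Each of the two extra elements adds to f / s a multiple of a unit vector orthogonal to
  all e_k, which raises the norm to 1 without changing any correlation with a residual.\<close>

lemma prescribed_greedy:
  fixes G :: "nat \<Rightarrow> nat \<Rightarrow> real" and \<beta> :: "nat \<Rightarrow> real" and \<mu> \<Lambda> C :: real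
  assumes sym: "\<And>i k. G i k = G k i" and diag: "\<And>i. G i i = 1"
    and lower: "\<And>c n. \<mu> * (\<Sum>i\<le>n. (c i)\<^sup>2) \<le> (\<Sum>i\<le>n. \<Sum>k\<le>n. c i * c k * G i k)" and \<mu>: "\<mu> > 0"
    and upper: "\<And>c n. (\<Sum>i\<le>n. \<Sum>k\<le>n. c i * c k * G i k) \<le> \<Lambda> * (\<Sum>i\<le>n. (c i)\<^sup>2)"
    and \<beta>: "\<And>k. \<beta> k > 0" "summable (\<lambda>k. (\<beta> k)\<^sup>2)" "\<beta> \<longlonglongrightarrow> 0"
    and res: "\<And>i n. (\<lambda>k. \<beta> (k + n) * G i (k + n)) sums R i n"
    and R: "\<And>n. R n n = \<beta> n" "\<And>i n. i \<noteq> n \<Longrightarrow> \<bar>R i n\<bar> < \<beta> n"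
    and var: "\<And>k. \<beta> k * \<bar>R k 0\<bar> \<le> C * (\<beta> k - \<beta> (Suc k))" and C: "C \<ge> 0"
  obtains D :: "ell2 set" and f :: ell2 and s :: real where
    "dictionary D" "f \<noteq> 0" "pga_well_defined D f" "s > 0" "variation_norm D f \<le> ereal s"
    "\<And>n g m. pga_iterate D f n g \<Longrightarrow> (\<Sum>k=n..<n+m. (\<beta> k)\<^sup>2) \<le> (norm (f - g))\<^sup>2"
proof -
  \<comment> \<open>Index 0 is reserved for the auxiliary unit vector \<open>e'\<close>, orthogonal
    to all the others.\<close>
  define G' where "G' i k = (if i = 0 \<or> k = 0 then (if i = k then 1 else 0) else G (i - 1) (k - 1))" for i k
  have "\<exists>d :: nat \<Rightarrow> ell2. \<forall>i k. d i \<bullet> d k = G' i k"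
  proof (rule gram_vectors)
    fix c :: "nat \<Rightarrow> real" and n assume c: "c n \<noteq> 0"
    show "0 < (\<Sum>i\<le>n. \<Sum>k\<le>n. c i * c k * G' i k)"
    proof (cases n)
      case 0
      then show ?thesis using c by (simp add: G'_def power2_eq_square[symmetric])
    next
      case (Suc m)
      have "(\<Sum>i\<le>n. \<Sum>k\<le>n. c i * c k * G' i k) = (c 0)\<^sup>2 + (\<Sum>i\<le>m. \<Sum>k\<le>m. c (Suc i) * c (Suc k) * G i k)"
        unfolding Suc sum.atMost_Suc_shift by (simp add: G'_def power2_eq_square)
      moreover have "0 < \<mu> * (\<Sum>i\<le>m. (c (Suc i))\<^sup>2)"
      proof (rule mult_pos_pos[OF \<mu>])
        have "0 < (c (Suc m))\<^sup>2" using c Suc by simp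
        also have "\<dots> \<le> (\<Sum>i\<le>m. (c (Suc i))\<^sup>2)" by (rule member_le_sum) auto
        finally show "0 < (\<Sum>i\<le>m. (c (Suc i))\<^sup>2)" .
      qed
      ultimately show ?thesis using lower[where n = m and c = "\<lambda>i. c (Suc i)"]
        by (smt (verit) zero_le_power2)
    qed
  qed (auto simp: G'_def sym)
  then obtain d :: "nat \<Rightarrow> ell2" where d: "\<And>i k. d i \<bullet> d k = G' i k" by blast
  define e e' where "e k = d (Suc k)" and "e' = d 0" for k
  have ee: "e i \<bullet> e k = G i k" for i k by (simp add: e_def d G'_def)
  have e'e: "e' \<bullet> e k = 0" "e' \<bullet> e' = 1" for k by (simp_all add: e_def e'_def d G'_def)
  have ne: "norm (e k) = 1" for k by (simp add: norm_eq_sqrt_inner ee diag)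
  have summ: "summable (\<lambda>k. \<beta> k *\<^sub>R e k)"
    unfolding summable_Cauchy
  proof (intro allI impI)
    fix \<epsilon> :: real assume \<epsilon>: "\<epsilon> > 0"
    define L where "L = max \<Lambda> 1"
    have L: "L > 0" "\<Lambda> \<le> L" by (auto simp: L_def)
    have "\<epsilon>\<^sup>2 / L > 0" using \<epsilon> L by simp
    then obtain N where N: "\<And>m n. m \<ge> N \<Longrightarrow> norm (\<Sum>k=m..<n. (\<beta> k)\<^sup>2) < \<epsilon>\<^sup>2 / L"
      using \<beta>(2) unfolding summable_Cauchy by blast
    have "norm (\<Sum>k=m..<n. \<beta> k *\<^sub>R e k) < \<epsilon>" if "m \<ge> N" for m n
    proof (cases "m < n")
      case True
      define c where "c k = (if k \<in> {m..<n} then \<beta> k else 0)" for k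
      have sub: "{m..<n} \<subseteq> {..n}" by auto
      have "(norm (\<Sum>k=m..<n. \<beta> k *\<^sub>R e k))\<^sup>2 = (norm (\<Sum>k\<le>n. c k *\<^sub>R e k))\<^sup>2"
        by (intro arg_cong[where f = "\<lambda>x. (norm x)\<^sup>2"] sum.mono_neutral_cong_left) (auto simp: c_def)
      also have "\<dots> = (\<Sum>i\<le>n. \<Sum>k\<le>n. c i * c k * G i k)"
        unfolding power2_norm_eq_inner by (simp add: inner_sum_left inner_sum_right ee sum_distrib_left mult_ac sym)
      also have "\<dots> \<le> \<Lambda> * (\<Sum>i\<le>n. (c i)\<^sup>2)" by (rule upper)
      also have "\<dots> \<le> L * (\<Sum>i\<le>n. (c i)\<^sup>2)" using L by (intro mult_right_mono sum_nonneg) auto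
      also have "(\<Sum>i\<le>n. (c i)\<^sup>2) = (\<Sum>k=m..<n. (\<beta> k)\<^sup>2)"
        by (intro sum.mono_neutral_cong_right) (auto simp: c_def)
      also have "\<dots> < \<epsilon>\<^sup>2 / L" using N[OF that, of n] by simp
      finally have "(norm (\<Sum>k=m..<n. \<beta> k *\<^sub>R e k))\<^sup>2 < \<epsilon>\<^sup>2" using L by simp
      then show ?thesis using \<epsilon> by (simp add: power_less_imp_less_base)
    next
      case False
      then show ?thesis using \<epsilon> by simp
    qed
    then show "\<exists>N. \<forall>m\<ge>N. \<forall>n. norm (\<Sum>k=m..<n. \<beta> k *\<^sub>R e k) < \<epsilon>" by blast
  qed
  define f where "f = (\<Sum>k. \<beta> k *\<^sub>R e k)"
  define r where "r n = f - (\<Sum>k<n. \<beta> k *\<^sub>R e k)" for n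
  have rs: "(\<lambda>k. \<beta> (k + n) *\<^sub>R e (k + n)) sums r n" for n
    using summable_sums[OF summ] sums_iff_shift[of "\<lambda>k. \<beta> k *\<^sub>R e k" n "r n"] by (simp add: r_def f_def)
  have rx: "(\<lambda>k. \<beta> (k + n) * (x \<bullet> e (k + n))) sums (x \<bullet> r n)" for x n
    using bounded_linear.sums[OF bounded_linear_inner_right[of x] rs[of n]] by simp
  have re: "r n \<bullet> e i = R i n" for i n
    using sums_unique2[OF rx[where x = "e i" and n = n]] res[of n i] by (simp add: ee inner_commute)
  have r0: "r 0 = f" by (simp add: r_def)
  have re': "r n \<bullet> e' = 0" for n
    using sums_unique2[OF rx[where x = e' and n = n], of 0] by (simp add: e'e inner_commute)
  \<comment> \<open>\<open>var\<close> bounds the terms of the series for <r_n, f> by C (\<beta>_k -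
    \<beta>_(k+1)), so its partial sums telescope to at most C \<beta>_n.\<close>
  have rf: "\<bar>r n \<bullet> f\<bar> \<le> C * \<beta> n" for n
  proof -
    have lim: "(\<lambda>m. \<Sum>k<m. \<beta> (k + n) * (f \<bullet> e (k + n))) \<longlonglongrightarrow> f \<bullet> r n"
      using rx[of n f] by (simp add: sums_def)
    have fe: "f \<bullet> e k = R k 0" for k using re[of 0 k] by (simp add: r0)
    have "\<bar>\<Sum>k<m. \<beta> (k + n) * (f \<bullet> e (k + n))\<bar> \<le> C * \<beta> n" for m
    proof -
      have "\<bar>\<Sum>k<m. \<beta> (k + n) * (f \<bullet> e (k + n))\<bar> \<le> (\<Sum>k<m. \<bar>\<beta> (k + n) * (f \<bullet> e (k + n))\<bar>)" by (rule sum_abs)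
      also have "\<dots> \<le> (\<Sum>k<m. C * (\<beta> (k + n) - \<beta> (Suc k + n)))"
        by (intro sum_mono) (use var \<beta>(1) in \<open>simp add: fe abs_mult less_imp_le\<close>)
      also have "\<dots> = C * (\<beta> (0 + n) - \<beta> (m + n))"
        unfolding sum_distrib_left[symmetric] using sum_lessThan_telescope'[of "\<lambda>k. \<beta> (k + n)" m] by simp
      also have "\<dots> \<le> C * \<beta> n" using C \<beta>(1)[of "m + n"] by (intro mult_left_mono) auto
      finally show ?thesis .
    qed
    then have "\<bar>f \<bullet> r n\<bar> \<le> C * \<beta> n"
      by (intro LIMSEQ_le_const2[OF tendsto_rabs[OF lim]]) auto
    then show ?thesis by (simp add: inner_commute)
  qed
  \<comment> \<open>s > C makes both extra elements lose against e_n, and s > norm f leaves room for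
    the orthogonal component.\<close>
  define s where "s = max (C + 1) (norm f + 1)"
  have s: "s > C" "s > norm f" "s > 0" using C by (auto simp: s_def)
  define t where "t = sqrt (1 - (norm f / s)\<^sup>2)"
  have "(norm f / s)\<^sup>2 \<le> 1" using s by (intro power_le_one) auto
  then have t: "t\<^sup>2 = 1 - (norm f / s)\<^sup>2" by (simp add: t_def)
  define u where "u \<sigma> = (1 / s) *\<^sub>R f + (\<sigma> * t) *\<^sub>R e'" for \<sigma> :: real
  have fe': "f \<bullet> e' = 0" using re'[of 0] by (simp add: r0)
  have nu: "norm (u \<sigma>) = 1" if "\<sigma>\<^sup>2 = 1" for \<sigma>
  proof -
    have "u \<sigma> \<bullet> u \<sigma> = (f \<bullet> f) / s\<^sup>2 + \<sigma>\<^sup>2 * t\<^sup>2"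
      by (simp add: u_def inner_add_left inner_add_right fe' inner_commute[of e' f] e'e power2_eq_square)
    then have "(norm (u \<sigma>))\<^sup>2 = (norm f / s)\<^sup>2 + \<sigma>\<^sup>2 * t\<^sup>2"
      by (simp add: dot_square_norm power_divide)
    then have "(norm (u \<sigma>))\<^sup>2 = 1" by (simp add: that t)
    then show ?thesis by (simp add: power2_eq_1_iff) (metis norm_ge_zero not_one_le_zero neg_0_le_iff_le)
  qed
  define E where "E = range e \<union> {u 1, u (-1)}"
  define D where "D = E \<union> uminus ` E"
  have dict: "dictionary D"
    unfolding dictionary_def D_def E_def using ne nu by auto
  \<comment> \<open>The bound is two-sided because \<open>D\<close> also contains the
    negatives.\<close>
  have small: "\<bar>r n \<bullet> x\<bar> < \<beta> n" if "x \<in> E" "x \<noteq> e n" for x n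
  proof -
    have "\<bar>r n \<bullet> u \<sigma>\<bar> < \<beta> n" for \<sigma>
    proof -
      have "r n \<bullet> u \<sigma> = (r n \<bullet> f) / s" by (simp add: u_def inner_add_right re')
      then have "\<bar>r n \<bullet> u \<sigma>\<bar> \<le> C * \<beta> n / s" using rf[of n] s by (simp add: divide_right_mono)
      also have "\<dots> < \<beta> n" using s \<beta>(1)[of n] by (simp add: field_simps)
      finally show ?thesis .
    qed
    then show ?thesis using that re by (auto simp: E_def intro!: R(2))
  qed
  have strict: "r n \<bullet> x < \<beta> n" if x: "x \<in> D" "x \<noteq> e n" for x n
  proof (cases "x \<in> E")
    case True
    then show ?thesis using small[OF True x(2)] by simp
  next
    case False
    then obtain x' where x': "x' \<in> E" "x = - x'" using x by (auto simp: D_def)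
    show ?thesis
    proof (cases "x' = e n")
      case True
      then show ?thesis using x' re[of n n] R(1)[of n] \<beta>(1)[of n] by simp
    next
      case False
      then show ?thesis using small[OF x'(1) False] x' by simp
    qed
  qed
  have pga: "pga_iterate D f n g \<Longrightarrow> g = (\<Sum>k<n. \<beta> k *\<^sub>R e k)" "pga_well_defined D f" for n g
    using pga_unique_maximizer[of e D f \<beta>] strict re R(1)
    by (auto simp: r_def[symmetric] D_def E_def)
  have decay: "(\<Sum>k=n..<n+m. (\<beta> k)\<^sup>2) \<le> (norm (r n))\<^sup>2" for n m
  proof -
    have st: "(norm (r (Suc n)))\<^sup>2 = (norm (r n))\<^sup>2 - (\<beta> n)\<^sup>2" for n
    proof -
      have "r (Suc n) = r n - \<beta> n *\<^sub>R e n" by (simp add: r_def algebra_simps)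
      then show ?thesis
        unfolding power2_norm_eq_inner
        by (simp add: inner_diff_left inner_diff_right re R(1) ee diag inner_commute[of "e n"] power2_eq_square)
    qed
    have "(\<Sum>k=n..<n+m. (\<beta> k)\<^sup>2) = (norm (r n))\<^sup>2 - (norm (r (n + m)))\<^sup>2"
      by (induction m) (auto simp: st)
    then show ?thesis by simp
  qed
  have "f = s *\<^sub>R ((1/2) *\<^sub>R u 1 + (1/2) *\<^sub>R u (-1))"
    using s by (simp add: u_def algebra_simps) (simp add: scaleR_add_left[symmetric])
  moreover have "(1/2) *\<^sub>R u 1 + (1/2) *\<^sub>R u (-1) \<in> convex hull D"
    by (intro convexD[OF convex_convex_hull]) (auto simp: D_def E_def intro: hull_inc)
  ultimately have "f \<in> (\<lambda>x. s *\<^sub>R x) ` closure (convex hull D)"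
    using closure_subset by blast
  then have "variation_norm D f \<le> ereal s"
    unfolding variation_norm_def using s by (intro INF_lower2[of s]) auto
  moreover have "f \<noteq> 0" using re[of 0 0] R(1)[of 0] \<beta>(1)[of 0] r0 by auto
  moreover have "(\<Sum>k=n..<n+m. (\<beta> k)\<^sup>2) \<le> (norm (f - g))\<^sup>2" if "pga_iterate D f n g" for n g m
    using decay[of n m] pga(1)[OF that] by (simp add: r_def)
  ultimately show thesis
    using that[OF dict _ pga(2) s(3)] by blast
qed

section \<open>Coefficients and Gram matrix\<close>

text \<open>A forward difference instead of the derivative p x^(p-1): partial sums are then exact
  powers. Since 0 powr p = 0, such a sum may start at 0.\<close>

definition pdiff :: "real \<Rightarrow> real \<Rightarrow> real" where
  "pdiff p x = (x + 1) powr p - x powr p"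

lemma pdiff_bounds:
  assumes "0 < p" "p < 1" "0 \<le> x"
  shows "p * (x + 1) powr (p - 1) \<le> pdiff p x"
proof (cases "x = 0")
  case True
  then show ?thesis using assms by (simp add: pdiff_def)
next
  case False
  then have x: "x > 0" using assms by simp
  have "\<exists>z>x. z < x + 1 \<and> (x + 1) powr p - x powr p = (x + 1 - x) * (p * z powr (p - 1))"
    using x by (intro MVT2) (auto intro!: derivative_eq_intros)
  then obtain z where z: "x < z" "z < x + 1" "pdiff p x = p * z powr (p - 1)" by (auto simp: pdiff_def)
  have "(x + 1) powr (p - 1) \<le> z powr (p - 1)"
    using z x assms by (intro powr_mono2') auto
  then show ?thesis using z assms by simp
qed

lemma pdiff_pos: "0 < p \<Longrightarrow> 0 \<le> x \<Longrightarrow> 0 < pdiff p x"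
  by (simp add: pdiff_def powr_less_mono2)

lemma pdiff_less:
  assumes p: "0 < p" "p < 1" and xy: "0 < x" "x < y"
  shows "pdiff p y < pdiff p x"
proof (rule DERIV_neg_imp_decreasing[OF xy(2)])
  fix t assume t: "x \<le> t" "t \<le> y"
  have "(pdiff p has_real_derivative p * (t + 1) powr (p - 1) - p * t powr (p - 1)) (at t)"
    unfolding pdiff_def using t xy by (auto intro!: derivative_eq_intros)
  moreover have "(t + 1) powr (p - 1) < t powr (p - 1)"
    using t xy p by (intro powr_less_mono2_neg) auto
  then have "p * (t + 1) powr (p - 1) - p * t powr (p - 1) < 0"
    using p by simp
  ultimately show "\<exists>d. (pdiff p has_real_derivative d) (at t) \<and> d < 0" by blast
qed

lemma powr_increment:
  fixes p x y :: real
  assumes p: "0 < p" "p < 1" and xy: "0 < x" "x \<le> y" "y \<le> x + 1"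
  shows "0 \<le> y powr p - x powr p" "y powr p - x powr p \<le> x powr (p - 1)"
proof -
  show "0 \<le> y powr p - x powr p" using powr_mono2[of p x y] p xy by linarith
  show "y powr p - x powr p \<le> x powr (p - 1)"
  proof (cases "x = y")
    case False
    then have "\<exists>z>x. z < y \<and> y powr p - x powr p = (y - x) * (p * z powr (p - 1))"
      using xy by (intro MVT2) (auto intro!: derivative_eq_intros)
    then obtain z where z: "x < z" "z < y" "y powr p - x powr p = (y - x) * (p * z powr (p - 1))" by blast
    have "(y - x) * (p * z powr (p - 1)) \<le> 1 * (1 * x powr (p - 1))"
      using z xy p by (intro mult_mono powr_mono2') auto
    then show ?thesis using z by simp
  qed simp
qed

lemma pdiff_approx:
  assumes p: "0 < p" "p < 1" and xy: "0 < x" "x \<le> y" "y \<le> x + 1"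
  shows "\<bar>pdiff p y - p * x powr (p - 1)\<bar> \<le> 2 * x powr (p - 2)"
proof -
  have "\<exists>z>y. z < y + 1 \<and> (y + 1) powr p - y powr p = (y + 1 - y) * (p * z powr (p - 1))"
    using xy by (intro MVT2) (auto intro!: derivative_eq_intros)
  then obtain z where z: "y < z" "z < y + 1" "pdiff p y = p * z powr (p - 1)" by (auto simp: pdiff_def)
  have "\<exists>t>x. t < z \<and> z powr (p - 1) - x powr (p - 1) = (z - x) * ((p - 1) * t powr (p - 1 - 1))"
    using xy z by (intro MVT2) (auto intro!: derivative_eq_intros)
  then obtain t where t: "x < t" "t < z" "z powr (p - 1) - x powr (p - 1) = (z - x) * ((p - 1) * t powr (p - 2))"
    by auto
  have "pdiff p y - p * x powr (p - 1) = - ((p * (1 - p)) * ((z - x) * t powr (p - 2)))"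
  proof -
    have "pdiff p y - p * x powr (p - 1) = p * (z powr (p - 1) - x powr (p - 1))"
      unfolding z(3) by (rule right_diff_distrib[symmetric])
    also have "\<dots> = p * ((z - x) * ((p - 1) * t powr (p - 2)))" by (simp only: t(3))
    finally show ?thesis by (simp add: algebra_simps)
  qed
  then have "\<bar>pdiff p y - p * x powr (p - 1)\<bar> = (p * (1 - p)) * ((z - x) * t powr (p - 2))"
    using p t z xy by simp
  also have "\<dots> \<le> (1 * 1) * (2 * x powr (p - 2))"
    using p t z xy by (intro mult_mono powr_mono2') auto
  finally show ?thesis by simp
qed

text \<open>Mean values for \<open>pdiff\<close> and for its derivative turn the first term into (1
  - p) R with R = x t^(p-2) s^(1-p) and s, t in [x, x + 2]. Then R lies between (x / (x + 2))^2 and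
  1 + 1 / x, hence within 4 / x of 1.\<close>

lemma pdiff_ratio:
  assumes p: "0 < p" "p < 1" and x: "0 < x"
  shows "\<bar>x * (1 - pdiff p (x + 1) / pdiff p x) - (1 - p)\<bar> \<le> 4 / x"
proof -
  have "\<exists>z>x. z < x + 1 \<and> (x + 1) powr p - x powr p = (x + 1 - x) * (p * z powr (p - 1))"
    using x by (intro MVT2) (auto intro!: derivative_eq_intros)
  then obtain s where s: "x < s" "s < x + 1" "pdiff p x = p * s powr (p - 1)" by (auto simp: pdiff_def)
  have "\<exists>z>x. z < x + 1 \<and> pdiff p (x + 1) - pdiff p x = (x + 1 - x) * (p * (z + 1) powr (p - 1) - p * z powr (p - 1))"
    unfolding pdiff_def using x by (intro MVT2) (auto intro!: derivative_eq_intros)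
  then obtain z where z: "x < z" "z < x + 1"
    "pdiff p (x + 1) - pdiff p x = p * ((z + 1) powr (p - 1) - z powr (p - 1))" by (auto simp: right_diff_distrib)
  have "\<exists>t>z. t < z + 1 \<and> (z + 1) powr (p - 1) - z powr (p - 1) = (z + 1 - z) * ((p - 1) * t powr (p - 1 - 1))"
    using x z by (intro MVT2) (auto intro!: derivative_eq_intros)
  then obtain t where t: "z < t" "t < z + 1" "(z + 1) powr (p - 1) - z powr (p - 1) = (p - 1) * t powr (p - 2)"
    by auto
  have tx: "x < t" "t < x + 2" using z t by auto
  define R where "R = x * (t powr (p - 2) * s powr (1 - p))"
  have "1 - pdiff p (x + 1) / pdiff p x = - (pdiff p (x + 1) - pdiff p x) / pdiff p x"
    using pdiff_pos[of p x] p x by (simp add: field_simps)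
  also have "\<dots> = p * ((1 - p) * t powr (p - 2)) / (p * s powr (p - 1))"
    unfolding z(3) t(3) unfolding s(3) by (simp add: algebra_simps)
  also have "\<dots> = (1 - p) * (t powr (p - 2) * (1 / s powr (p - 1)))" using p by simp
  also have "1 / s powr (p - 1) = s powr (1 - p)" using powr_minus_divide[of s "p - 1"] by simp
  finally have L: "x * (1 - pdiff p (x + 1) / pdiff p x) = (1 - p) * R" by (simp add: R_def)
  have "R \<le> x * (x powr (p - 2) * (x + 1) powr (1 - p))"
    unfolding R_def using x tx s p by (intro mult_left_mono mult_mono powr_mono2' powr_mono2) auto
  also have "\<dots> = ((x + 1) / x) powr (1 - p)"
  proof -
    have "x * x powr (p - 2) = x powr (p - 1)" using x powr_add[of x 1 "p - 2"] by simp
    also have "\<dots> = 1 / x powr (1 - p)" using powr_minus_divide[of x "1 - p"] by simp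
    finally show ?thesis using x by (simp add: powr_divide mult.assoc[symmetric])
  qed
  also have "\<dots> \<le> ((x + 1) / x) powr 1" using x p by (intro powr_mono) auto
  also have "\<dots> = 1 + 1 / x" using x by (simp add: field_simps)
  finally have R1: "R \<le> 1 + 1 / x" .
  have "1 - 4 / x \<le> (x / (x + 2))\<^sup>2"
  proof -
    define y where "y = 2 / (x + 2)"
    have "x / (x + 2) = 1 - y" using x by (simp add: y_def field_simps)
    then have "(x / (x + 2))\<^sup>2 = (1 - y)\<^sup>2" by (rule arg_cong)
    also have "\<dots> = 1 - 2 * y + y\<^sup>2" by (simp add: power2_diff)
    also have "2 * y = 4 / (x + 2)" by (simp add: y_def)
    finally have "(x / (x + 2))\<^sup>2 = 1 - 4 / (x + 2) + y\<^sup>2" .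
    moreover have "4 / (x + 2) \<le> 4 / x" using x by (intro divide_left_mono) auto
    moreover have "y\<^sup>2 \<ge> 0" by simp
    ultimately show ?thesis by linarith
  qed
  also have "\<dots> = (x / (x + 2)) powr 2" using x by simp
  also have "\<dots> \<le> (x / (x + 2)) powr (2 - p)" using x p by (intro powr_mono') auto
  also have "\<dots> = x * ((x + 2) powr (p - 2) * x powr (1 - p))"
  proof -
    have "x * x powr (1 - p) = x powr (2 - p)" using x powr_add[of x 1 "1 - p"] by simp
    moreover have "(x + 2) powr (p - 2) = 1 / (x + 2) powr (2 - p)" using powr_minus_divide[of "x + 2" "2 - p"] by simp
    ultimately show ?thesis using x by (simp add: powr_divide mult.left_commute)
  qed
  also have "\<dots> \<le> R"
    unfolding R_def using x tx s p by (intro mult_left_mono mult_mono powr_mono2' powr_mono2) auto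
  finally have R2: "1 - 4 / x \<le> R" .
  have "1 / x \<le> 4 / x" using x by (intro divide_right_mono) auto
  then have R: "\<bar>R - 1\<bar> \<le> 4 / x" using R1 R2 by linarith
  have "\<bar>(1 - p) * R - (1 - p)\<bar> = (1 - p) * \<bar>R - 1\<bar>"
  proof -
    have "(1 - p) * R - (1 - p) = (1 - p) * (R - 1)" by (simp add: algebra_simps)
    then show ?thesis using p by (simp add: abs_mult)
  qed
  also have "\<dots> \<le> 1 * (4 / x)" using R p by (intro mult_mono) auto
  finally show ?thesis unfolding L by simp
qed

section \<open>Telescoping sums and limits with rate 1 / k\<close>

lemma sum_pdiff: "i \<le> k \<Longrightarrow> (\<Sum>j=i..<k. pdiff p (real j)) = real k powr p - real i powr p"
  by (induction k rule: dec_induct) (auto simp: pdiff_def add.commute)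

lemma sums_add_prefix:
  fixes F :: "nat \<Rightarrow> real"
  assumes "(\<lambda>k. F (k + m)) sums S" "n \<le> m"
  shows "(\<lambda>k. F (k + n)) sums ((\<Sum>k=n..<m. F k) + S)"
proof -
  have "(\<lambda>k. F ((k + (m - n)) + n)) sums S" using assms by (simp add: add.assoc)
  then have "(\<lambda>k. F (k + n)) sums (S + (\<Sum>k<m - n. F (k + n)))"
    using sums_iff_shift'[of "\<lambda>k. F (k + n)" "m - n" S] sums_iff_shift[of "\<lambda>k. F (k + n)" "m - n" S] by blast
  moreover have "(\<Sum>k<m - n. F (k + n)) = (\<Sum>k=n..<m. F k)"
    using sum.shift_bounds_nat_ivl[of F 0 n "m - n"] assms by (simp add: atLeast0LessThan)
  ultimately show ?thesis by (simp add: add.commute)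
qed

lemma bigo_real_bound:
  fixes f :: "nat \<Rightarrow> real"
  assumes "f \<in> O(\<lambda>k. 1 / real k)"
  obtains C where "C > 0" "\<forall>\<^sub>F k in sequentially. \<bar>f k\<bar> \<le> C / real k"
proof -
  obtain C where "C > 0" "\<forall>\<^sub>F k in sequentially. norm (f k) \<le> C * norm (1 / real k)"
    using landau_o.bigE[OF assms] by metis
  then show thesis using that[of C] by simp
qed

text \<open>A rate is carried along with each limit because the errors \<open>hh i - h\<close> are
  later summed against \<open>b i\<close>: b_i / i is summable, b_i is not.\<close>

lemma bigo_mult_limit:
  fixes f g :: "nat \<Rightarrow> real"
  assumes f: "(\<lambda>k. f k - A) \<in> O(\<lambda>k. 1 / real k)" and g: "(\<lambda>k. g k - B) \<in> O(\<lambda>k. 1 / real k)"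
  shows "(\<lambda>k. f k * g k - A * B) \<in> O(\<lambda>k. 1 / real k)"
proof -
  have "(\<lambda>k. (f k - A) * (g k - B)) \<in> O(\<lambda>k. 1 / real k * (1 / real k))"
    using f g by (rule landau_o.big.mult)
  also have "(\<lambda>k. 1 / real k * (1 / real k)) \<in> O(\<lambda>k. 1 / real k)" by real_asymp
  finally have 1: "(\<lambda>k. (f k - A) * (g k - B)) \<in> O(\<lambda>k. 1 / real k)" .
  have "(\<lambda>k. (f k - A) * (g k - B) + (B * (f k - A) + A * (g k - B))) \<in> O(\<lambda>k. 1 / real k)"
    by (intro sum_in_bigo 1) (use f g in \<open>auto intro: landau_o.big.cmult_in_iff[THEN iffD2]\<close>)
  then show ?thesis by (simp add: algebra_simps)
qed

lemma bigo_inverse_limit: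
  fixes g :: "nat \<Rightarrow> real"
  assumes g: "(\<lambda>k. g k - B) \<in> O(\<lambda>k. 1 / real k)" and B: "B > 0"
  shows "(\<lambda>k. 1 / g k - 1 / B) \<in> O(\<lambda>k. 1 / real k)"
proof -
  obtain C where C: "C > 0" "\<forall>\<^sub>F k in sequentially. \<bar>g k - B\<bar> \<le> C / real k" by (rule bigo_real_bound[OF g])
  have "(\<lambda>k. C / real k) \<longlonglongrightarrow> 0" by real_asymp
  then have "\<forall>\<^sub>F k in sequentially. C / real k < B / 2" by (rule order_tendstoD(2)) (use B in simp)
  then have "\<forall>\<^sub>F k in sequentially. norm (1 / g k - 1 / B) \<le> 2 * C / B\<^sup>2 * norm (1 / real k)"
    using C(2)
  proof eventually_elim
    case (elim k)
    have gk: "g k \<ge> B / 2" using elim by linarith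
    have "1 / g k - 1 / B = (B - g k) / (g k * B)" using gk B by (simp add: field_simps)
    then have "\<bar>1 / g k - 1 / B\<bar> = \<bar>g k - B\<bar> / (g k * B)" using gk B by (simp add: abs_mult)
    also have "\<dots> \<le> (C / real k) / (B / 2 * B)"
      using gk B elim C by (intro frac_le mult_right_mono) auto
    finally show ?case by (simp add: power2_eq_square field_simps)
  qed
  then show ?thesis by (rule bigoI)
qed

section \<open>The Gram matrix and its asymptotics\<close>

text \<open>
  \<open>consistent\<close> cancels the leading terms of \<open>\<langle>f, d\<^sub>k\<rangle>\<close>, leaving \<open>O(1/k)\<close>; \<open>mass\<close> keeps
  \<open>\<langle>r\<^sub>n, d\<^sub>k\<rangle>\<close> above \<open>- b\<^sub>n\<close> for \<open>k > n\<close>.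
\<close>

locale greedy_parameters =
  fixes p v a h :: real
  assumes p: "0 < p" "p < 1/2" and v: "2 < v" and a: "0 < a" "a < 1"
    and h: "h = a * ((1 - p) / p) * (v - v powr (1 - p))" "h < 1"
    and consistent: "1 - a + a * v powr (1 - p) = (1 - p) / p * h * v powr (- p)"
    and mass: "(1 - p) / p * v powr (- p) < 2"
begin

definition b :: "nat \<Rightarrow> real" where "b k = pdiff p (real k)"
text \<open>The relative decrement of \<open>b\<close>, about (1 - p) / k. Against \<open>b\<close>
  it telescopes, by \<open>b_lam\<close>.\<close>

definition lam :: "nat \<Rightarrow> real" where "lam k = 1 - b (Suc k) / b k"
definition far :: "nat \<Rightarrow> nat" where "far i = nat \<lceil>v * real i\<rceil>"
text \<open>This choice of \<open>hh\<close> makes \<open>\<Sum>k>i. b k * K i k\<close> vanish.\<close>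

definition hh :: "nat \<Rightarrow> real" where
  "hh i = a * lam i * (real (far i) powr p - (real i + 1) powr p) / b (far i)"
text \<open>Near entries do not depend on k, so against \<open>b\<close> they sum to differences of
  powers; far entries are multiples of \<open>lam k\<close> and telescope. The leading terms are a
  (1 - p) / i and -h (1 - p) / k, which become q / i and -q / k when p = 1 / (1 + v) and a = h =
  1.\<close>

definition K :: "nat \<Rightarrow> nat \<Rightarrow> real" where
  "K i k = (if k < far i then a * lam i else - hh i * lam k)"
definition G :: "nat \<Rightarrow> nat \<Rightarrow> real" where
  "G i k = (if i = k then 1 else if i < k then K i k else K k i)"

lemma G_sym: "G i k = G k i" by (auto simp: G_def)

lemma b_pos: "b k > 0" using p by (simp add: b_def pdiff_pos)

lemma b_less: "k \<ge> 1 \<Longrightarrow> k < l \<Longrightarrow> b l < b k"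
  unfolding b_def using p by (intro pdiff_less) auto

lemma b_le: "k \<ge> 1 \<Longrightarrow> k \<le> l \<Longrightarrow> b l \<le> b k"
  using b_less[of k l] by (cases "k = l") auto

lemma b_lam: "b k * lam k = b k - b (Suc k)"
  using b_pos[of k] by (simp add: lam_def field_simps)

lemma lam_pos: "k \<ge> 1 \<Longrightarrow> lam k > 0"
  using b_less[of k "Suc k"] b_pos[of k] by (simp add: lam_def)

lemma less_far: "k < far i \<longleftrightarrow> real k < v * real i"
  unfolding far_def by (simp add: less_ceiling_iff zless_nat_eq_int_zless)

lemma far_bounds: "v * real i \<le> real (far i)" "real (far i) < v * real i + 1"
proof -
  have "v * real i \<ge> 0" using v by simp
  then show "v * real i \<le> real (far i)" "real (far i) < v * real i + 1"
    unfolding far_def by linarith+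
qed

lemma far_gt: "i \<ge> 1 \<Longrightarrow> Suc i \<le> far i"
  using less_far[of i i] v by simp

lemma b_tendsto_0: "b \<longlonglongrightarrow> 0"
  unfolding b_def pdiff_def using p by real_asymp

lemma b_sq_summable: "summable (\<lambda>k. (b k)\<^sup>2)"
proof (rule summable_comparison_test_bigo)
  show "summable (\<lambda>k. norm (real k powr (2 * p - 2)))"
    using p by (simp add: summable_real_powr_iff)
  show "(\<lambda>k. (b k)\<^sup>2) \<in> O(\<lambda>k. real k powr (2 * p - 2))"
    unfolding b_def pdiff_def using p by real_asymp
qed

lemma lam_asymp: "(\<lambda>k. real k * lam k - (1 - p)) \<in> O(\<lambda>k. 1 / real k)"
proof (rule bigoI)
  show "\<forall>\<^sub>F k in sequentially. norm (real k * lam k - (1 - p)) \<le> 4 * norm (1 / real k)"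
    using eventually_ge_at_top[of 1]
  proof eventually_elim
    case (elim k)
    then show ?case
      using pdiff_ratio[of p "real k"] p by (simp add: lam_def b_def add.commute)
  qed
qed

lemma lam_tendsto: "(\<lambda>k. real k * lam k) \<longlonglongrightarrow> 1 - p"
proof -
  obtain C where C: "C > 0" "\<forall>\<^sub>F k in sequentially. \<bar>real k * lam k - (1 - p)\<bar> \<le> C / real k"
    by (rule bigo_real_bound[OF lam_asymp])
  have "(\<lambda>k. real k * lam k - (1 - p)) \<longlonglongrightarrow> 0"
    by (rule Lim_null_comparison[of _ "\<lambda>i. C / real i"]) (use C in simp, real_asymp)
  then show ?thesis by (simp add: LIM_zero_iff)
qed

lemma lam_lower: "\<forall>\<^sub>F k in sequentially. 1 / real k \<le> 4 * lam k"
proof -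
  have "\<forall>\<^sub>F k in sequentially. 1/4 < real k * lam k"
    using order_tendstoD(1)[OF lam_tendsto, of "1/4"] p by simp
  then show ?thesis
    using eventually_gt_at_top[of 0] by eventually_elim (simp add: field_simps)
qed

text \<open>After scaling by powers of i, \<open>hh i\<close> is a times a product of three factors:
  i lam_i, the difference of the p-th powers of far(i) / i and (i + 1) / i, and the inverse of b(far
  i) / i^(p-1). Each converges at rate 1 / i, because far(i) differs from v i by less than
  1.\<close>

lemma hh_asymp: "(\<lambda>i. hh i - h) \<in> O(\<lambda>i. 1 / real i)"
proof -
  have T2: "(\<lambda>i. (real (far i) / real i) powr p - v powr p) \<in> O(\<lambda>i. 1 / real i)"
  proof (rule bigoI)
    show "\<forall>\<^sub>F i in sequentially. norm ((real (far i) / real i) powr p - v powr p) \<le> 1 * norm (1 / real i)"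
      using eventually_ge_at_top[of 1]
    proof eventually_elim
      case (elim i)
      define y where "y = real (far i) / real i"
      have y: "v \<le> y" "y - v \<le> 1 / real i"
      proof -
        have i: "real i > 0" using elim by simp
        show "v \<le> y" using far_bounds(1)[of i] i by (simp add: y_def pos_le_divide_eq)
        have "y \<le> (v * real i + 1) / real i"
          unfolding y_def using far_bounds(2)[of i] i by (intro divide_right_mono) auto
        also have "\<dots> = v + 1 / real i" using i by (simp add: add_divide_distrib)
        finally show "y - v \<le> 1 / real i" by simp
      qed
      have "y powr p - v powr p \<le> 1 / real i"
      proof (cases "v = y")
        case False
        then have "\<exists>z>v. z < y \<and> y powr p - v powr p = (y - v) * (p * z powr (p - 1))"
          using v y by (intro MVT2) (auto intro!: derivative_eq_intros)
        then obtain z where z: "v < z" "z < y" "y powr p - v powr p = (y - v) * (p * z powr (p - 1))" by blast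
        have "z powr (p - 1) \<le> 1 powr (p - 1)" using z v p by (intro powr_mono2') auto
        then have "(y - v) * (p * z powr (p - 1)) \<le> 1 / real i * (1 * 1)"
          using y p z by (intro mult_mono) auto
        then show ?thesis using z by simp
      qed simp
      moreover have "v powr p \<le> y powr p" using y v p by (intro powr_mono2) auto
      ultimately show ?case by (simp add: y_def[symmetric])
    qed
  qed
  have T2': "(\<lambda>i::nat. ((real i + 1) / real i) powr p - 1) \<in> O(\<lambda>i. 1 / real i)" using p by real_asymp
  have T2: "(\<lambda>i. ((real (far i) / real i) powr p - ((real i + 1) / real i) powr p) - (v powr p - 1)) \<in> O(\<lambda>i. 1 / real i)"
    using sum_in_bigo(2)[OF T2 T2'] by (simp add: algebra_simps)
  have T3: "(\<lambda>i. b (far i) / real i powr (p - 1) - p * v powr (p - 1)) \<in> O(\<lambda>i. 1 / real i)"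
  proof (rule bigoI)
    show "\<forall>\<^sub>F i in sequentially. norm (b (far i) / real i powr (p - 1) - p * v powr (p - 1)) \<le> 2 * v powr (p - 2) * norm (1 / real i)"
      using eventually_ge_at_top[of 1]
    proof eventually_elim
      case (elim i)
      have i: "real i > 0" using elim by simp
      define I where "I = real i powr (p - 1)"
      have I: "I > 0" using i by (simp add: I_def)
      have "\<bar>b (far i) - p * (v * real i) powr (p - 1)\<bar> \<le> 2 * (v * real i) powr (p - 2)"
        unfolding b_def using p v i far_bounds[of i] by (intro pdiff_approx) auto
      also have "(v * real i) powr (p - 1) = v powr (p - 1) * I" using v by (simp add: powr_mult I_def)
      also have "(v * real i) powr (p - 2) = v powr (p - 2) * (I / real i)"
      proof -
        have "real i powr (p - 2) = I / real i"
          using i powr_diff[of "real i" "p - 1" 1] by (simp add: I_def)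
        then show ?thesis using v by (simp add: powr_mult)
      qed
      finally have "\<bar>b (far i) - p * (v powr (p - 1) * I)\<bar> / I \<le> 2 * (v powr (p - 2) * (I / real i)) / I"
        using I by (intro divide_right_mono) auto
      moreover have "\<bar>b (far i) - p * (v powr (p - 1) * I)\<bar> / I = \<bar>b (far i) / I - p * v powr (p - 1)\<bar>"
      proof -
        have "b (far i) / I - p * v powr (p - 1) = (b (far i) - p * (v powr (p - 1) * I)) / I"
          using I by (simp add: field_simps)
        then show ?thesis using I by (simp add: abs_divide)
      qed
      ultimately show ?case using I by (simp add: I_def[symmetric])
    qed
  qed
  have T3': "(\<lambda>i. 1 / (b (far i) / real i powr (p - 1)) - 1 / (p * v powr (p - 1))) \<in> O(\<lambda>i. 1 / real i)"
    using p v by (intro bigo_inverse_limit[OF T3]) auto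
  have "(\<lambda>i. real i * lam i * ((real (far i) / real i) powr p - ((real i + 1) / real i) powr p)
      * (1 / (b (far i) / real i powr (p - 1))) - (1 - p) * (v powr p - 1) * (1 / (p * v powr (p - 1)))) \<in> O(\<lambda>i. 1 / real i)"
    by (intro bigo_mult_limit lam_asymp T2 T3')
  then have *: "(\<lambda>i. a * (real i * lam i * ((real (far i) / real i) powr p - ((real i + 1) / real i) powr p)
      * (1 / (b (far i) / real i powr (p - 1))) - (1 - p) * (v powr p - 1) * (1 / (p * v powr (p - 1))))) \<in> O(\<lambda>i. 1 / real i)"
    by simp
  have hv: "a * ((1 - p) * (v powr p - 1) * (1 / (p * v powr (p - 1)))) = h"
  proof -
    have "v powr p = v * v powr (p - 1)" using v powr_add[of v 1 "p - 1"] by simp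
    moreover have "v powr (1 - p) = 1 / v powr (p - 1)" using powr_minus_divide[of v "p - 1"] by simp
    ultimately have "(v powr p - 1) * (1 / (p * v powr (p - 1))) = (v - v powr (1 - p)) / p"
      using v p by (simp add: field_simps)
    then show ?thesis unfolding h(1) by (simp only: mult.assoc) simp
  qed
  have "\<forall>\<^sub>F i in sequentially. a * (real i * lam i * ((real (far i) / real i) powr p - ((real i + 1) / real i) powr p)
      * (1 / (b (far i) / real i powr (p - 1))) - (1 - p) * (v powr p - 1) * (1 / (p * v powr (p - 1)))) = hh i - h"
    using eventually_ge_at_top[of 1]
  proof eventually_elim
    case (elim i)
    have i: "real i > 0" using elim by simp
    have ip: "real i powr (p - 1) = real i powr p / real i" using i powr_diff[of "real i" p 1] by simp
    let ?E = "real i * lam i * ((real (far i) / real i) powr p - ((real i + 1) / real i) powr p) * (1 / (b (far i) / real i powr (p - 1)))"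
    have E: "?E = lam i * (real (far i) powr p - (real i + 1) powr p) / b (far i)"
      using i b_pos[of "far i"] unfolding ip by (simp add: powr_divide field_simps)
    have d: "a * (?E - c) = a * ?E - a * c" for c by (rule right_diff_distrib)
    show ?case
      unfolding d hv unfolding E by (simp add: hh_def mult.assoc)
  qed
  then show ?thesis using * by (subst (asm) landau_o.big.in_cong) auto
qed

lemma h_pos: "h > 0"
proof -
  have "v powr (1 - p) < v powr 1" using v p by (intro powr_less_mono) auto
  then show ?thesis unfolding h(1) using v p a by auto
qed

lemma hh_tendsto: "hh \<longlonglongrightarrow> h"
proof -
  obtain C where C: "C > 0" "\<forall>\<^sub>F i in sequentially. \<bar>hh i - h\<bar> \<le> C / real i" by (rule bigo_real_bound[OF hh_asymp])
  have "(\<lambda>i. hh i - h) \<longlonglongrightarrow> 0"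
    by (rule Lim_null_comparison[of _ "\<lambda>i. C / real i"]) (use C in simp, real_asymp)
  then show ?thesis by (simp add: LIM_zero_iff)
qed

text \<open>Inverse to \<open>far\<close>: by \<open>less_near_start\<close>, column k of
  \<open>K\<close> has its far entries in the rows below \<open>near_start k\<close> and its near
  entries from there up to the diagonal.\<close>

definition near_start :: "nat \<Rightarrow> nat" where "near_start k = Suc (nat \<lfloor>real k / v\<rfloor>)"

lemma near_start: "real k / v < real (near_start k)" "real (near_start k) \<le> real k / v + 1"
proof -
  have "real k / v \<ge> 0" using v by simp
  then show "real k / v < real (near_start k)" "real (near_start k) \<le> real k / v + 1"
    unfolding near_start_def by linarith+
qed

lemma less_near_start: "k < near_start i \<longleftrightarrow> far k \<le> i"
proof -
  have "far k \<le> i \<longleftrightarrow> \<not> real i < v * real k" using less_far[of i k] by auto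
  also have "\<dots> \<longleftrightarrow> real k \<le> real i / v" using v by (simp add: not_less pos_le_divide_eq mult.commute)
  also have "\<dots> \<longleftrightarrow> k < near_start i"
    unfolding near_start_def using v by (simp add: less_Suc_eq_le le_nat_floor le_nat_iff le_floor_iff)
  finally show ?thesis by simp
qed

text \<open>The power is the sum of b_j over j < near_start(k), so once hh_j < 1 the left side
  bounds what the far entries of column k can subtract from a residual. Divided by b_k it tends to
  at most (1 - p) / p v^(-p), whence \<open>mass\<close>.\<close>

lemma mass_bound: "\<forall>\<^sub>F k in sequentially. lam k * real (near_start k) powr p < 2 * b k"
proof -
  define u where "u = 1 / v"
  have u: "u > 0" using v by (simp add: u_def)
  have "(\<lambda>k::nat. (1 - ((real k + 1 + 1) powr p - (real k + 1) powr p) / ((real k + 1) powr p - real k powr p))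
      * (u * real k + 1) powr p / ((real k + 1) powr p - real k powr p)) \<longlonglongrightarrow> (1 - p) / p * u powr p"
    using p u by (real_asymp, simp add: field_simps)
  then have "(\<lambda>k. lam k * (u * real k + 1) powr p / b k) \<longlonglongrightarrow> (1 - p) / p * u powr p"
    by (simp add: lam_def b_def pdiff_def add.commute add.left_commute)
  moreover have "u powr p = v powr (- p)" using v by (simp add: u_def powr_minus_divide powr_divide)
  ultimately have "\<forall>\<^sub>F k in sequentially. lam k * (u * real k + 1) powr p / b k < 2"
    using order_tendstoD(2)[of "\<lambda>k. lam k * (u * real k + 1) powr p / b k" _ _ 2] mass by simp
  then show ?thesis
    using eventually_ge_at_top[of 1]
  proof eventually_elim
    case (elim k)
    have "lam k * real (near_start k) powr p \<le> lam k * (u * real k + 1) powr p"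
      using near_start[of k] lam_pos[of k] elim p by (intro mult_left_mono powr_mono2) (auto simp: u_def)
    then show ?case using elim b_pos[of k] by (simp add: field_simps)
  qed
qed

text \<open>All three terms are, to leading order, multiples of p k^(p-1), and
  \<open>consistent\<close> says that the multiples cancel. What remains must be O(1 / k), not
  merely o(k^(p-1)), since <f, d_k> has to be bounded by a multiple of \<open>lam k\<close>.\<close>

lemma consistency_asymp:
  obtains C where "C > 0"
    "\<forall>\<^sub>F k in sequentially. \<bar>(1 - a) * b k + a * b (near_start k) - lam k * h * real (near_start k) powr p\<bar> \<le> C / real k"
proof -
  define u where "u = 1 / v"
  have u: "u > 0" using v by (simp add: u_def)
  have up: "u powr p = v powr (- p)" using v by (simp add: u_def powr_minus_divide powr_divide)
  have up1: "u powr (p - 1) = v powr (1 - p)"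
    using v powr_minus[of v "p - 1"] by (simp add: u_def powr_divide field_simps)
  let ?f = "\<lambda>k::nat. p * real k powr (p - 1)"
  obtain C0 where C0: "C0 > 0" "\<forall>\<^sub>F k in sequentially. \<bar>real k * lam k - (1 - p)\<bar> \<le> C0 / real k"
    by (rule bigo_real_bound[OF lam_asymp])
  define C where "C = 2 + 2 * u powr (p - 2) + (C0 + u powr (p - 1))"
  have "\<forall>\<^sub>F k in sequentially. \<bar>(1 - a) * b k + a * b (near_start k) - lam k * h * real (near_start k) powr p\<bar> \<le> C / real k"
    using C0(2) eventually_ge_at_top[of 2]
  proof eventually_elim
    case (elim k)
    have k: "real k \<ge> 2" using elim by simp
    define B1 B2 where "B1 = 2 / real k" and "B2 = 2 * u powr (p - 2) / real k"
    define B3 where "B3 = (C0 + u powr (p - 1)) / real k"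
    have l0: "lam k \<ge> 0" using lam_pos[of k] elim by simp
    have uk: "u * real k > 0" using u elim by simp
    have ns: "u * real k \<le> real (near_start k)" "real (near_start k) \<le> u * real k + 1"
      using near_start[of k] by (auto simp: u_def)
    have kp: "real k powr (p - 2) \<le> 1 / real k"
    proof -
      have "real k powr (p - 2) \<le> real k powr (- 1)" using k p by (intro powr_mono) auto
      then show ?thesis using k by (simp add: powr_minus_divide)
    qed
    have 1: "\<bar>b k - ?f k\<bar> \<le> B1"
    proof -
      have "\<bar>b k - ?f k\<bar> \<le> 2 * real k powr (p - 2)"
        unfolding b_def using p k by (intro pdiff_approx) auto
      then show ?thesis using kp by (simp add: B1_def)
    qed
    have 2: "\<bar>b (near_start k) - ?f k * u powr (p - 1)\<bar> \<le> B2"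
    proof -
      have "\<bar>b (near_start k) - p * (u * real k) powr (p - 1)\<bar> \<le> 2 * (u * real k) powr (p - 2)"
        unfolding b_def using p uk ns by (intro pdiff_approx) auto
      also have "\<dots> = 2 * u powr (p - 2) * real k powr (p - 2)" using u by (simp add: powr_mult)
      also have "\<dots> \<le> 2 * u powr (p - 2) * (1 / real k)" using kp by (intro mult_left_mono) auto
      finally show ?thesis using u by (simp add: powr_mult B2_def mult_ac)
    qed
    have 3: "\<bar>lam k * real (near_start k) powr p - (1 - p) / p * ?f k * u powr p\<bar> \<le> B3"
    proof -
      define x where "x = (u * real k) powr p"
      define y where "y = real (near_start k) powr p"
      have y: "0 \<le> y - x" "y - x \<le> (u * real k) powr (p - 1)"
        unfolding x_def y_def using powr_increment[of p "u * real k" "real (near_start k)"] p uk ns by auto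
      have "(u * real k) powr (p - 1) \<le> u powr (p - 1) * 1"
      proof -
        have "real k powr (p - 1) \<le> 1 powr (p - 1)" using k p by (intro powr_mono2') auto
        then show ?thesis using u by (simp add: powr_mult)
      qed
      with y have yx: "\<bar>y - x\<bar> \<le> u powr (p - 1)" by simp
      have y1: "\<bar>y\<bar> \<le> real k"
      proof -
        have "u * real k + 1 \<le> real k"
        proof -
          have "u \<le> 1 / 2" using v by (simp add: u_def)
          then have "u * real k \<le> 1 / 2 * real k" by (intro mult_right_mono) auto
          then show ?thesis using k by linarith
        qed
        then have "y \<le> real k powr p" unfolding y_def using p ns by (intro powr_mono2) auto
        also have "\<dots> \<le> real k powr 1" using k p by (intro powr_mono) auto
        finally show ?thesis by (simp add: y_def)
      qed
      have kp1: "real k powr (p - 1) = real k powr p / real k" using k powr_diff[of "real k" p 1] by simp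
      have e: "(1 - p) / p * ?f k * u powr p = (1 - p) * x / real k"
        using p u unfolding kp1 x_def by (simp add: powr_mult)
      have "lam k * y - (1 - p) * x / real k = (real k * lam k - (1 - p)) * y / real k + (1 - p) * (y - x) / real k"
        using k by (simp add: field_simps)
      also have "\<bar>\<dots>\<bar> \<le> C0 / real k + u powr (p - 1) / real k"
      proof -
        have "\<bar>(real k * lam k - (1 - p)) * y\<bar> \<le> C0 / real k * real k"
          unfolding abs_mult using elim(1) y1 C0 k by (intro mult_mono) auto
        then have "\<bar>(real k * lam k - (1 - p)) * y / real k\<bar> \<le> C0 / real k"
          using k by (simp add: abs_divide divide_right_mono)
        moreover have "\<bar>(1 - p) * (y - x)\<bar> \<le> 1 * u powr (p - 1)"
          unfolding abs_mult using yx p by (intro mult_mono) auto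
        then have "\<bar>(1 - p) * (y - x) / real k\<bar> \<le> u powr (p - 1) / real k"
          using k by (simp add: abs_divide divide_right_mono)
        ultimately show ?thesis by linarith
      qed
      finally show ?thesis unfolding e y_def[symmetric] by (simp add: B3_def add_divide_distrib)
    qed
    have "(1 - a) * ?f k + a * (?f k * u powr (p - 1)) - h * ((1 - p) / p * ?f k * u powr p)
      = ?f k * ((1 - a + a * v powr (1 - p)) - (1 - p) / p * h * v powr (- p))"
      unfolding up up1 by (simp add: algebra_simps)
    then have z: "(1 - a) * ?f k + a * (?f k * u powr (p - 1)) - h * ((1 - p) / p * ?f k * u powr p) = 0"
      using consistent by simp
    have "(1 - a) * b k + a * b (near_start k) - lam k * h * real (near_start k) powr p
       = (1 - a) * (b k - ?f k) + a * (b (near_start k) - ?f k * u powr (p - 1))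
         - h * (lam k * real (near_start k) powr p - (1 - p) / p * ?f k * u powr p)
         + ((1 - a) * ?f k + a * (?f k * u powr (p - 1)) - h * ((1 - p) / p * ?f k * u powr p))"
      by (simp add: algebra_simps)
    also have "\<bar>\<dots>\<bar> \<le> (1 - a) * B1 + a * B2 + h * B3"
    proof -
      have "\<bar>(1 - a) * (b k - ?f k)\<bar> \<le> (1 - a) * B1" using 1 a by (simp add: abs_mult mult_left_mono)
      moreover have "\<bar>a * (b (near_start k) - ?f k * u powr (p - 1))\<bar> \<le> a * B2"
        using 2 a by (simp add: abs_mult mult_left_mono)
      moreover have "\<bar>h * (lam k * real (near_start k) powr p - (1 - p) / p * ?f k * u powr p)\<bar> \<le> h * B3"
        using 3 h_pos by (simp add: abs_mult mult_left_mono)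
      ultimately show ?thesis unfolding z by linarith
    qed
    also have "\<dots> \<le> 1 * B1 + 1 * B2 + 1 * B3"
      using a h(2) C0 u by (intro add_mono mult_right_mono) (auto simp: B1_def B2_def B3_def)
    also have "\<dots> = C / real k" by (simp add: B1_def B2_def B3_def C_def add_divide_distrib)
    finally show ?case .
  qed
  moreover have "C > 0" using C0 u by (simp add: C_def add_pos_pos)
  ultimately show thesis using that by blast
qed

end

section \<open>Residuals\<close>

context greedy_parameters
begin

lemma far_sums:
  assumes "i \<ge> 1" "far i \<le> n"
  shows "(\<lambda>k. b (k + n) * G i (k + n)) sums (- hh i * b n)"
proof -
  have "(\<lambda>k. b (k + n)) \<longlonglongrightarrow> 0" using b_tendsto_0 by (rule LIMSEQ_ignore_initial_segment)
  then have "(\<lambda>k. b (k + n) - b (Suc k + n)) sums (b (0 + n) - 0)" by (rule telescope_sums')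
  then have "(\<lambda>k. - hh i * (b (k + n) - b (Suc k + n))) sums (- hh i * (b (0 + n) - 0))" by (rule sums_mult)
  moreover have "b (k + n) * G i (k + n) = - hh i * (b (k + n) - b (Suc k + n))" for k
  proof -
    have "i < k + n" "\<not> k + n < far i" using far_gt[of i] assms by linarith+
    then have "b (k + n) * G i (k + n) = - hh i * (b (k + n) * lam (k + n))" by (simp add: G_def K_def)
    then show ?thesis unfolding b_lam by simp
  qed
  ultimately show ?thesis by simp
qed

lemma hh_b_far: "hh i * b (far i) = a * lam i * (real (far i) powr p - (real i + 1) powr p)"
  using b_pos[of "far i"] by (simp add: hh_def)

text \<open>The choice of \<open>hh\<close> lets the far tail cancel the whole near range from i + 1
  on. Starting at n instead leaves minus the omitted stretch from i + 1 to n - 1.\<close>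

lemma near_sums:
  assumes "i \<ge> 1" "i < n" "n \<le> far i"
  shows "(\<lambda>k. b (k + n) * G i (k + n)) sums (- (a * lam i * (real n powr p - (real i + 1) powr p)))"
proof -
  have "(\<lambda>k. b (k + n) * G i (k + n)) sums ((\<Sum>k=n..<far i. b k * G i k) + - hh i * b (far i))"
    by (rule sums_add_prefix[OF far_sums]) (use assms in auto)
  moreover have "(\<Sum>k=n..<far i. b k * G i k) = (\<Sum>k=n..<far i. a * lam i * pdiff p (real k))"
    using assms by (intro sum.cong) (auto simp: G_def K_def b_def)
  then have "(\<Sum>k=n..<far i. b k * G i k) = a * lam i * (real (far i) powr p - real n powr p)"
    using sum_pdiff[OF assms(3), of p] by (simp add: sum_distrib_left[symmetric])
  then have "(\<Sum>k=n..<far i. b k * G i k) + - hh i * b (far i)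
      = - (a * lam i * (real n powr p - (real i + 1) powr p))"
    using hh_b_far[of i] by (simp add: right_diff_distrib)
  ultimately show ?thesis by simp
qed

text \<open>\<open>residual i n\<close> is \<open>\<langle>r\<^sub>n, d\<^sub>i\<rangle>\<close>.\<close>

definition residual :: "nat \<Rightarrow> nat \<Rightarrow> real" where
  "residual i n = (if n \<le> i then (\<Sum>k=n..<i. b k * K k i) + b i
     else if n \<le> far i then - (a * lam i * (real n powr p - (real i + 1) powr p)) else - hh i * b n)"

text \<open>For n \<le> i everything beyond the diagonal cancels (\<open>near_sums\<close> started
  at i + 1 gives zero), which leaves a finite sum and the diagonal term.\<close>

lemma residual_sums:
  assumes "i \<ge> 1" "n \<ge> 1"
  shows "(\<lambda>k. b (k + n) * G i (k + n)) sums residual i n"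
proof (cases "n \<le> i")
  case True
  have "(\<lambda>k. b (k + n) * G i (k + n)) sums ((\<Sum>k=n..<Suc i. b k * G i k)
     + - (a * lam i * (real (Suc i) powr p - (real i + 1) powr p)))"
    by (rule sums_add_prefix[OF near_sums]) (use assms True far_gt[of i] in auto)
  moreover have "(\<Sum>k=n..<i. b k * G i k) = (\<Sum>k=n..<i. b k * K k i)"
    by (intro sum.cong) (auto simp: G_def)
  ultimately show ?thesis using True by (simp add: residual_def G_def add.commute)
next
  case False
  then show ?thesis using assms near_sums[of i n] far_sums[of i n] by (simp add: residual_def)
qed

lemma residual_self: "residual n n = b n" by (simp add: residual_def)

text \<open>Not yet selected (n < i): near terms add up to at most a (b_n - b_i), so a < 1 keeps the
  correlation below b_n, while far terms remove less than 2 b_i, which keeps it above -b_n. Already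
  selected (i < n): on the near range it stays between 0 and -hh_i b(far i), afterwards it equals
  -hh_i b_n, and hh_i < 1.\<close>

lemma residual_bound:
  assumes N: "N \<ge> 1" "\<And>i. i \<ge> N \<Longrightarrow> 0 < hh i \<and> hh i < 1"
      "\<And>i. i \<ge> N \<Longrightarrow> lam i * real (near_start i) powr p < 2 * b i"
    and i: "i \<ge> N" "n \<ge> N" "i \<noteq> n"
  shows "\<bar>residual i n\<bar> < b n"
proof (cases "n \<le> i")
  case True
  then have ni: "n < i" using i by simp
  have "(\<Sum>k=n..<i. b k * K k i) \<le> (\<Sum>k=n..<i. a * (b k - b (Suc k)))"
  proof (intro sum_mono)
    fix k assume k: "k \<in> {n..<i}"
    then have kN: "k \<ge> N" "k \<ge> 1" "i \<ge> 1" using i N by auto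
    have "a * (b k * lam k) \<ge> 0" using a b_pos[of k] lam_pos[OF kN(2)] by simp
    moreover have "b k * (hh k * lam i) \<ge> 0" using N(2)[OF kN(1)] b_pos[of k] lam_pos[OF kN(3)] by simp
    ultimately show "b k * K k i \<le> a * (b k - b (Suc k))"
      unfolding b_lam[symmetric] K_def by (auto simp: mult_ac)
  qed
  also have "\<dots> = a * (b n - b i)"
    unfolding sum_distrib_left[symmetric] using sum_Suc_diff'[of n i "\<lambda>k. - b k"] True by simp
  also have "\<dots> < b n - b i" using a b_less[of n i] ni i N by simp
  finally have up: "(\<Sum>k=n..<i. b k * K k i) + b i < b n" by simp
  have "(\<Sum>k=n..<i. b k * K k i) \<ge> (\<Sum>k=n..<i. if k < near_start i then - (lam i * pdiff p (real k)) else 0)"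
  proof (intro sum_mono)
    fix k assume k: "k \<in> {n..<i}"
    then have kN: "k \<ge> N" "k \<ge> 1" "i \<ge> 1" using i N by auto
    have l: "lam i > 0" "lam k > 0" using lam_pos kN by auto
    have "b k * (hh k * lam i) \<le> b k * (1 * lam i)"
      using N(2)[OF kN(1)] b_pos[of k] l by (intro mult_left_mono mult_right_mono) auto
    moreover have "0 \<le> b k * (a * lam k)" using a b_pos[of k] l by simp
    ultimately show "(if k < near_start i then - (lam i * pdiff p (real k)) else 0) \<le> b k * K k i"
      unfolding K_def less_near_start by (auto simp: b_def mult_ac)
  qed
  also have "(\<Sum>k=n..<i. if k < near_start i then - (lam i * pdiff p (real k)) else 0)
      = - (lam i * (\<Sum>k | k \<in> {n..<i} \<and> k < near_start i. pdiff p (real k)))"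
    by (simp add: sum.inter_filter[symmetric] sum_negf sum_distrib_left)
  \<comment> \<open>Extending the range down to 0 turns the far mass into the p-th power of
    \<open>near_start i\<close>.\<close>
  also have "\<dots> \<ge> - (lam i * (\<Sum>k=0..<near_start i. pdiff p (real k)))"
    using lam_pos[of i] i N p
    by (intro le_imp_neg_le mult_left_mono sum_mono2) (auto intro!: less_imp_le[OF pdiff_pos])
  finally have "(\<Sum>k=n..<i. b k * K k i) + b i \<ge> b i - lam i * real (near_start i) powr p"
    using sum_pdiff[of 0 "near_start i" p] p by simp
  then have "(\<Sum>k=n..<i. b k * K k i) + b i > - b i" using N(3)[of i] i by linarith
  then show ?thesis using up True b_less[of n i] ni i N by (simp add: residual_def)
next
  case False
  have i1: "i \<ge> 1" using i N by simp
  have h01: "0 < hh i" "hh i < 1" using N(2)[of i] i by auto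
  show ?thesis
  proof (cases "n \<le> far i")
    case True
    have al: "a * lam i > 0" using a lam_pos[OF i1] by simp
    have "real i + 1 \<le> real n" using False by simp
    then have "(real i + 1) powr p \<le> real n powr p" using p by (intro powr_mono2) auto
    then have 0: "0 \<le> a * lam i * (real n powr p - (real i + 1) powr p)" using al by simp
    have "a * lam i * (real n powr p - (real i + 1) powr p) \<le> a * lam i * (real (far i) powr p - (real i + 1) powr p)"
      using al True p by (intro mult_left_mono diff_right_mono powr_mono2) auto
    also have "\<dots> = hh i * b (far i)" by (rule hh_b_far[symmetric])
    also have "\<dots> < b (far i)" using h01 b_pos[of "far i"] by simp
    also have "\<dots> \<le> b n" using True i N by (intro b_le) auto
    finally show ?thesis using 0 True False by (simp add: residual_def)
  next
    case False
    then show ?thesis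
      using h01 b_pos[of n] \<open>\<not> n \<le> i\<close> by (simp add: residual_def abs_mult)
  qed
qed

text \<open>By \<open>b_lam\<close> the claim is that <f, d_k> = O(lam k), for the f that starts at
  index N. At \<open>near_start k\<close> the sum splits into a near part, which telescopes, and a
  far part, where \<open>hh\<close> is replaced by its limit \<open>h\<close>. The leading terms are
  those of \<open>consistency_asymp\<close>; the replacement error is \<open>lam k\<close> times a
  bounded sum because hh_j - h = O(1 / j).\<close>

lemma residual_variation:
  assumes N: "N \<ge> 1"
  obtains C where "C \<ge> 0" "\<And>k. k \<ge> N \<Longrightarrow> b k * \<bar>residual k N\<bar> \<le> C * (b k - b (Suc k))"
proof -
  obtain C1 where C1: "C1 > 0" "\<forall>\<^sub>F i in sequentially. \<bar>hh i - h\<bar> \<le> C1 / real i" by (rule bigo_real_bound[OF hh_asymp])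
  obtain C2 where C2: "C2 > 0"
    "\<forall>\<^sub>F k in sequentially. \<bar>(1 - a) * b k + a * b (near_start k) - lam k * h * real (near_start k) powr p\<bar> \<le> C2 / real k"
    by (rule consistency_asymp)
  obtain N1 where N1: "\<And>i. i \<ge> N1 \<Longrightarrow> \<bar>hh i - h\<bar> \<le> C1 / real i \<and> 1 / real i \<le> 4 * lam i"
    using eventually_conj[OF C1(2) lam_lower] unfolding eventually_sequentially by blast
  define M where "M = max N N1"
  \<comment> \<open>Bound for the total replacement error: beyond M the inequality 1 / j \<le> 4
    lam_j lets the terms be dominated by a telescoping sum.\<close>
  define C3 where "C3 = (\<Sum>j=N..<M. b j * \<bar>hh j - h\<bar>) + 4 * C1 * b M"
  have partial: "(\<Sum>j=N..<m. b j * \<bar>hh j - h\<bar>) \<le> C3" for m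
  proof -
    have tail: "(\<Sum>j=M..<m. b j * \<bar>hh j - h\<bar>) \<le> 4 * C1 * b M"
    proof (cases "M \<le> m")
      case True
      have "(\<Sum>j=M..<m. b j * \<bar>hh j - h\<bar>) \<le> (\<Sum>j=M..<m. 4 * C1 * (b j - b (Suc j)))"
      proof (intro sum_mono)
        fix j assume "j \<in> {M..<m}"
        then have j: "\<bar>hh j - h\<bar> \<le> C1 / real j" "1 / real j \<le> 4 * lam j" using N1[of j] by (auto simp: M_def)
        have "\<bar>hh j - h\<bar> \<le> C1 * (1 / real j)" using j by simp
        also have "\<dots> \<le> C1 * (4 * lam j)" using j C1 by (intro mult_left_mono) auto
        finally have "b j * \<bar>hh j - h\<bar> \<le> b j * (C1 * (4 * lam j))"
          using b_pos[of j] by (intro mult_left_mono) auto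
        then show "b j * \<bar>hh j - h\<bar> \<le> 4 * C1 * (b j - b (Suc j))"
          unfolding b_lam[symmetric] by (simp add: mult_ac)
      qed
      also have "\<dots> = 4 * C1 * (b M - b m)"
        unfolding sum_distrib_left[symmetric] using sum_Suc_diff'[of M m "\<lambda>k. - b k"] True by simp
      also have "\<dots> \<le> 4 * C1 * b M" using C1 b_pos[of m] by simp
      finally show ?thesis .
    next
      case False
      then show ?thesis using C1 b_pos[of M] by simp
    qed
    have "(\<Sum>j=N..<m. b j * \<bar>hh j - h\<bar>) \<le> (\<Sum>j\<in>{N..<M} \<union> {M..<m}. b j * \<bar>hh j - h\<bar>)"
      using b_pos by (intro sum_mono2) (auto simp: less_imp_le)
    also have "\<dots> = (\<Sum>j=N..<M. b j * \<bar>hh j - h\<bar>) + (\<Sum>j=M..<m. b j * \<bar>hh j - h\<bar>)"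
      by (intro sum.union_disjoint) auto
    finally show ?thesis using tail by (simp add: C3_def)
  qed
  have C3: "C3 \<ge> 0"
    unfolding C3_def using C1 less_imp_le[OF b_pos] by (intro add_nonneg_nonneg sum_nonneg mult_nonneg_nonneg) auto
  define C4 where "C4 = 4 * C2 + (h * real N powr p + C3)"
  have C4: "C4 \<ge> 0" using C2 C3 h_pos by (simp add: C4_def)
  have ns_large: "\<forall>\<^sub>F k in sequentially. N \<le> near_start k"
  proof -
    have "\<forall>\<^sub>F k in sequentially. v * real N \<le> real k" by real_asymp
    then show ?thesis
    proof eventually_elim
      case (elim k)
      then have "real N \<le> real k / v" using v by (simp add: pos_le_divide_eq mult.commute)
      then show ?case using near_start(1)[of k] by linarith
    qed
  qed
  have "\<forall>\<^sub>F k in sequentially. \<bar>residual k N\<bar> \<le> C4 * lam k"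
    using C2(2) lam_lower ns_large eventually_ge_at_top[of "max N 2"]
  proof eventually_elim
    case (elim k)
    define s where "s = near_start k"
    have sN: "N \<le> s" using elim by (simp add: s_def)
    have k2: "k \<ge> 2" "k \<ge> N" using elim by auto
    have sk: "s \<le> k"
    proof -
      have "real k / v \<le> real k / 2" using v by (intro divide_left_mono) auto
      then have "real s < real k / 2 + 1 + 1/2" using near_start(2)[of k] unfolding s_def by linarith
      then show ?thesis using k2 by linarith
    qed
    have l: "lam k > 0" using lam_pos[of k] k2 by simp
    have "(\<Sum>j=N..<k. b j * K j k) = (\<Sum>j=N..<s. b j * K j k) + (\<Sum>j=s..<k. b j * K j k)"
      using sN sk by (simp add: sum.atLeastLessThan_concat)
    also have "(\<Sum>j=s..<k. b j * K j k) = (\<Sum>j=s..<k. a * (b j - b (Suc j)))"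
    proof (intro sum.cong refl)
      fix j assume "j \<in> {s..<k}"
      then have "k < far j" using less_near_start[of j k] by (auto simp: s_def)
      then show "b j * K j k = a * (b j - b (Suc j))"
        unfolding b_lam[symmetric] by (simp add: K_def mult_ac)
    qed
    also have "\<dots> = a * (b s - b k)"
      unfolding sum_distrib_left[symmetric] using sum_Suc_diff'[of s k "\<lambda>k. - b k"] sk by simp
    also have "(\<Sum>j=N..<s. b j * K j k) = (\<Sum>j=N..<s. - (lam k * (b j * hh j)))"
    proof (intro sum.cong refl)
      fix j assume "j \<in> {N..<s}"
      then have "\<not> k < far j" using less_near_start[of j k] by (auto simp: s_def)
      then show "b j * K j k = - (lam k * (b j * hh j))" by (simp add: K_def mult_ac)
    qed
    also have "\<dots> = - (lam k * (\<Sum>j=N..<s. b j * hh j))" by (simp add: sum_negf sum_distrib_left)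
    also have "(\<Sum>j=N..<s. b j * hh j) = h * (\<Sum>j=N..<s. pdiff p (real j)) + (\<Sum>j=N..<s. b j * (hh j - h))"
      by (simp add: sum_distrib_left sum.distrib[symmetric] b_def algebra_simps)
    also have "(\<Sum>j=N..<s. pdiff p (real j)) = real s powr p - real N powr p" by (rule sum_pdiff[OF sN])
    finally have "residual k N = ((1 - a) * b k + a * b s - lam k * h * real s powr p)
        + lam k * (h * real N powr p - (\<Sum>j=N..<s. b j * (hh j - h)))"
      using k2 by (simp add: residual_def algebra_simps)
    also have "\<bar>\<dots>\<bar> \<le> C2 / real k + lam k * (h * real N powr p + C3)"
    proof -
      have "\<bar>\<Sum>j=N..<s. b j * (hh j - h)\<bar> \<le> (\<Sum>j=N..<s. \<bar>b j * (hh j - h)\<bar>)" by (rule sum_abs)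
      also have "\<dots> = (\<Sum>j=N..<s. b j * \<bar>hh j - h\<bar>)" using b_pos by (simp add: abs_mult less_imp_le)
      also have "\<dots> \<le> C3" by (rule partial)
      finally have "\<bar>h * real N powr p - (\<Sum>j=N..<s. b j * (hh j - h))\<bar> \<le> h * real N powr p + C3"
      proof -
        assume "\<bar>\<Sum>j=N..<s. b j * (hh j - h)\<bar> \<le> C3"
        moreover have "0 \<le> h * real N powr p" using h_pos by simp
        ultimately show ?thesis by linarith
      qed
      then have "\<bar>lam k * (h * real N powr p - (\<Sum>j=N..<s. b j * (hh j - h)))\<bar> \<le> lam k * (h * real N powr p + C3)"
        using l by (simp add: abs_mult)
      then show ?thesis using elim(1) unfolding s_def[symmetric] by linarith
    qed
    also have "C2 / real k = C2 * (1 / real k)" by simp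
    also have "\<dots> \<le> C2 * (4 * lam k)" using elim(2) C2 by (intro mult_left_mono) auto
    finally show ?case by (simp add: C4_def algebra_simps)
  qed
  then obtain N2 where N2: "\<And>k. k \<ge> N2 \<Longrightarrow> \<bar>residual k N\<bar> \<le> C4 * lam k"
    unfolding eventually_sequentially by blast
  \<comment> \<open>The finitely many k below N2 are absorbed into the constant.\<close>
  define C where "C = C4 + (\<Sum>k=N..<N2. \<bar>residual k N\<bar> / lam k)"
  have rl: "\<bar>residual k N\<bar> / lam k \<ge> 0" if "k \<ge> N" for k
    using lam_pos[of k] that N by simp
  have "b k * \<bar>residual k N\<bar> \<le> C * (b k - b (Suc k))" if "k \<ge> N" for k
  proof -
    have l: "lam k > 0" using lam_pos[of k] that N by simp
    have "\<bar>residual k N\<bar> \<le> C * lam k"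
    proof (cases "k \<ge> N2")
      case True
      have "0 \<le> (\<Sum>k=N..<N2. \<bar>residual k N\<bar> / lam k)" by (intro sum_nonneg rl) auto
      then have "C4 \<le> C" by (simp add: C_def)
      then have "C4 * lam k \<le> C * lam k" using l by simp
      then show ?thesis using N2[OF True] by linarith
    next
      case False
      have "\<bar>residual k N\<bar> / lam k \<le> (\<Sum>k=N..<N2. \<bar>residual k N\<bar> / lam k)"
        using False that rl by (intro member_le_sum) auto
      then have "\<bar>residual k N\<bar> / lam k \<le> C" using C4 by (simp add: C_def)
      then show ?thesis using l by (simp add: field_simps)
    qed
    then have "b k * \<bar>residual k N\<bar> \<le> b k * (C * lam k)" using b_pos[of k] by (intro mult_left_mono) auto
    then show ?thesis unfolding b_lam[symmetric] by (simp add: mult_ac)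
  qed
  moreover have "C \<ge> 0"
    unfolding C_def by (intro add_nonneg_nonneg C4 sum_nonneg rl) auto
  ultimately show thesis using that by blast
qed

end

section \<open>The starting index and the rate of decay\<close>

context greedy_parameters
begin

text \<open>Near entries are of size 1 / i while errors are measured in 1 / k; as k < v i there, the
  factor a (1 - p) has to be within \<delta> / v of q.\<close>

lemma eventually_admissible:
  assumes \<delta>: "\<delta> > 0" and near: "\<bar>a * (1 - p) - q\<bar> < \<delta> / v" and far: "\<bar>h * (1 - p) - q\<bar> < \<delta>"
  obtains N where "N \<ge> N0" "N \<ge> 1" "\<And>i. i \<ge> N \<Longrightarrow> 0 < hh i \<and> hh i < 1"
    "\<And>i. i \<ge> N \<Longrightarrow> lam i * real (near_start i) powr p < 2 * b i"
    "\<And>i k. N \<le> i \<Longrightarrow> i < k \<Longrightarrow>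
      \<bar>G i k - (if real k < v * real i then q / real i else - q / real k)\<bar> \<le> \<delta> / real k"
proof -
  \<comment> \<open>A far entry is a product of two convergent factors; each contributes an error of
    at most \<eta>, and 2 \<eta> fits into the slack.\<close>
  define \<eta> where "\<eta> = (\<delta> - \<bar>h * (1 - p) - q\<bar>) / 4"
  have \<eta>: "\<eta> > 0" using far by (simp add: \<eta>_def)
  have a1: "(\<lambda>k. \<bar>a * (real k * lam k) - q\<bar>) \<longlonglongrightarrow> \<bar>a * (1 - p) - q\<bar>"
    by (intro tendsto_intros lam_tendsto)
  have "\<forall>\<^sub>F i in sequentially. \<bar>a * (real i * lam i) - q\<bar> < \<delta> / v" by (rule order_tendstoD(2)[OF a1 near])
  moreover have "\<forall>\<^sub>F i in sequentially. 0 < hh i" by (rule order_tendstoD(1)[OF hh_tendsto h_pos])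
  moreover have "\<forall>\<^sub>F i in sequentially. hh i < 1" by (rule order_tendstoD(2)[OF hh_tendsto h(2)])
  moreover have "\<forall>\<^sub>F i in sequentially. dist (hh i) h < \<eta>" by (rule tendstoD[OF hh_tendsto \<eta>])
  moreover have "\<forall>\<^sub>F i in sequentially. dist (real i * lam i) (1 - p) < \<eta>" by (rule tendstoD[OF lam_tendsto \<eta>])
  ultimately have "\<forall>\<^sub>F i in sequentially. \<bar>a * (real i * lam i) - q\<bar> < \<delta> / v \<and> 0 < hh i \<and> hh i < 1
      \<and> \<bar>hh i - h\<bar> < \<eta> \<and> \<bar>real i * lam i - (1 - p)\<bar> < \<eta> \<and> lam i * real (near_start i) powr p < 2 * b i"
    using mass_bound by eventually_elim (simp add: dist_real_def)
  then obtain N1 where N1: "\<And>i. i \<ge> N1 \<Longrightarrow> \<bar>a * (real i * lam i) - q\<bar> < \<delta> / v \<and> 0 < hh i \<and> hh i < 1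
      \<and> \<bar>hh i - h\<bar> < \<eta> \<and> \<bar>real i * lam i - (1 - p)\<bar> < \<eta> \<and> lam i * real (near_start i) powr p < 2 * b i"
    unfolding eventually_sequentially by blast
  define N where "N = max N1 (max N0 1)"
  have approx: "\<bar>G i k - (if real k < v * real i then q / real i else - q / real k)\<bar> \<le> \<delta> / real k"
    if ik: "N \<le> i" "i < k" for i k
  proof (cases "real k < v * real i")
    case True
    have i: "real i > 0" "real k > 0" using ik by (auto simp: N_def)
    have "G i k = a * lam i" using ik True by (simp add: G_def K_def less_far)
    moreover have "a * lam i - q / real i = (a * (real i * lam i) - q) / real i" using i by (simp add: field_simps)
    ultimately have "\<bar>G i k - q / real i\<bar> = \<bar>a * (real i * lam i) - q\<bar> / real i" using i by (simp add: abs_divide)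
    also have "\<dots> \<le> \<delta> / v / real i"
      using N1[of i] ik i by (intro divide_right_mono) (auto simp: N_def)
    also have "\<dots> \<le> \<delta> / real k"
      using True i v \<delta> by (simp add: field_simps)
    finally show ?thesis using True by simp
  next
    case False
    have k: "real k > 0" "k \<ge> N1" "i \<ge> N1" using ik by (auto simp: N_def)
    have "G i k = - hh i * lam k" using ik False by (simp add: G_def K_def less_far)
    moreover have "- hh i * lam k - (- q / real k) = - (hh i * (real k * lam k) - q) / real k"
      using k by (simp add: field_simps)
    ultimately have eq: "\<bar>G i k - (- q / real k)\<bar> = \<bar>hh i * (real k * lam k) - q\<bar> / real k"
      using k by (simp add: abs_divide)
    have "hh i * (real k * lam k) - q = hh i * (real k * lam k - (1 - p)) + (hh i - h) * (1 - p) + (h * (1 - p) - q)"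
      by (simp add: algebra_simps)
    moreover have "\<bar>hh i * (real k * lam k - (1 - p))\<bar> \<le> 1 * \<eta>"
      unfolding abs_mult using N1[OF k(2)] N1[OF k(3)] by (intro mult_mono) auto
    moreover have "\<bar>(hh i - h) * (1 - p)\<bar> \<le> \<eta> * 1"
      unfolding abs_mult using N1[OF k(3)] p \<eta> by (intro mult_mono) auto
    ultimately have "\<bar>hh i * (real k * lam k) - q\<bar> \<le> 2 * \<eta> + \<bar>h * (1 - p) - q\<bar>" by linarith
    also have "\<dots> \<le> \<delta>" using far by (simp add: \<eta>_def field_simps)
    finally have "\<bar>hh i * (real k * lam k) - q\<bar> / real k \<le> \<delta> / real k" using k by (intro divide_right_mono) auto
    then show ?thesis using False eq by simp
  qed
  show thesis
    by (rule that[of N]) (use N1 approx in \<open>auto simp: N_def\<close>)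
qed

text \<open>The run uses only the vectors with index at least \<open>N\<close>, renumbered from 0.
  \<open>form\<close> gives the lower bound on the Gram form; the upper one is the Schur test, as
  off-diagonal entries are O(1 / max(i, k)).\<close>

lemma slow_greedy:
  assumes \<delta>: "\<delta> > 0" and near: "\<bar>a * (1 - p) - q\<bar> < \<delta> / v" and far: "\<bar>h * (1 - p) - q\<bar> < \<delta>" and q: "q > 0"
    and form: "\<And>N G c n. N \<ge> N0 \<Longrightarrow> (\<And>i k. G i k = G k i) \<Longrightarrow> (\<And>i. N \<le> i \<Longrightarrow> G i i = 1) \<Longrightarrow>
      (\<And>i k. N \<le> i \<Longrightarrow> i < k \<Longrightarrow>
        \<bar>G i k - (if real k < v * real i then q / real i else - q / real k)\<bar> \<le> \<delta> / real k) \<Longrightarrow>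
      (\<Sum>i=N..n. \<Sum>k=N..n. c i * c k * G i k) \<ge> 1/1000 * (\<Sum>i=N..n. (c i)\<^sup>2)"
  obtains D :: "ell2 set" and f :: ell2 and s c :: real where
    "dictionary D" "f \<noteq> 0" "pga_well_defined D f" "s > 0" "variation_norm D f \<le> ereal s" "c > 0"
    "\<And>n g. n \<ge> 1 \<Longrightarrow> pga_iterate D f n g \<Longrightarrow> c * real n powr (p - 1/2) \<le> norm (f - g)"
proof -
  obtain N where N: "N \<ge> N0" "N \<ge> 1" "\<And>i. i \<ge> N \<Longrightarrow> 0 < hh i \<and> hh i < 1"
    "\<And>i. i \<ge> N \<Longrightarrow> lam i * real (near_start i) powr p < 2 * b i"
    and approx: "\<And>i k. N \<le> i \<Longrightarrow> i < k \<Longrightarrow>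
      \<bar>G i k - (if real k < v * real i then q / real i else - q / real k)\<bar> \<le> \<delta> / real k"
    using eventually_admissible[OF \<delta> near far] by metis
  obtain C where C: "C \<ge> 0" "\<And>k. k \<ge> N \<Longrightarrow> b k * \<bar>residual k N\<bar> \<le> C * (b k - b (Suc k))"
    using residual_variation[OF N(2)] by metis
  define \<beta> where "\<beta> k = b (k + N)" for k
  define G1 where "G1 i k = G (i + N) (k + N)" for i k
  define R where "R i n = residual (i + N) (n + N)" for i n
  have Gd: "G i i = 1" for i by (simp add: G_def)
  have shift: "(\<Sum>i\<le>n. F (i + N)) = (\<Sum>i=N..n+N. F i)" for F :: "nat \<Rightarrow> real" and n
    using sum.shift_bounds_cl_nat_ivl[of F 0 N n] by (simp add: atLeast0AtMost)
  define up where "up c i = c (i - N)" for c :: "nat \<Rightarrow> real" and i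
  have form_shift: "(\<Sum>i\<le>n. \<Sum>k\<le>n. c i * c k * G1 i k) = (\<Sum>i=N..n+N. \<Sum>k=N..n+N. up c i * up c k * G i k)" for c n
    by (simp add: shift[symmetric] up_def G1_def)
  have sq_shift: "(\<Sum>i\<le>n. (c i)\<^sup>2) = (\<Sum>i=N..n+N. (up c i)\<^sup>2)" for c n
    by (simp add: shift[symmetric] up_def)
  have lower: "1/1000 * (\<Sum>i\<le>n. (c i)\<^sup>2) \<le> (\<Sum>i\<le>n. \<Sum>k\<le>n. c i * c k * G1 i k)" for c n
    unfolding form_shift sq_shift by (rule form[OF N(1) G_sym Gd approx])
  define L where "L = q * v + \<delta>"
  have L: "L > 0" using q v \<delta> by (simp add: L_def add_pos_pos)
  have Gb: "\<bar>G i k\<bar> \<le> L / real k" if "N \<le> i" "i < k" for i k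
  proof -
    have ik: "real i > 0" "real k > 0" using that N by auto
    have "\<bar>if real k < v * real i then q / real i else - q / real k\<bar> \<le> q * v / real k"
    proof (cases "real k < v * real i")
      case True
      then show ?thesis using ik q by (simp add: field_simps)
    next
      case False
      have "q * 1 \<le> q * v" using q v by (intro mult_left_mono) auto
      then show ?thesis using False ik q by (simp add: divide_right_mono)
    qed
    then show ?thesis using approx[OF that] unfolding L_def add_divide_distrib by linarith
  qed
  have upper: "(\<Sum>i\<le>n. \<Sum>k\<le>n. c i * c k * G1 i k) \<le> (1 + 4 * L) * (\<Sum>i\<le>n. (c i)\<^sup>2)" for c n
  proof -
    let ?c = "up c" and ?S = "{N..n+N}"
    have "(\<Sum>i\<in>?S. \<Sum>k\<in>?S. ?c i * ?c k * G i k)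
      \<le> (\<Sum>i\<in>?S. \<Sum>k\<in>?S. (if i = k then (?c i)\<^sup>2 else 0) + L * (\<bar>?c i\<bar> * \<bar>?c k\<bar> / max (real i) (real k)))"
    proof (intro sum_mono)
      fix i k assume ik: "i \<in> ?S" "k \<in> ?S"
      show "?c i * ?c k * G i k \<le> (if i = k then (?c i)\<^sup>2 else 0) + L * (\<bar>?c i\<bar> * \<bar>?c k\<bar> / max (real i) (real k))"
      proof (cases "i = k")
        case True
        then show ?thesis using L by (simp add: Gd power2_eq_square)
      next
        case False
        have "\<bar>G i k\<bar> \<le> L / max (real i) (real k)"
        proof (cases "i < k")
          case True
          then show ?thesis using Gb[of i k] ik by simp
        next
          case F: False
          then show ?thesis using Gb[of k i] ik False G_sym[of i k] by simp
        qed
        then have "\<bar>?c i * ?c k\<bar> * \<bar>G i k\<bar> \<le> \<bar>?c i * ?c k\<bar> * (L / max (real i) (real k))"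
          by (intro mult_left_mono) auto
        then have "\<bar>?c i * ?c k * G i k\<bar> \<le> L * (\<bar>?c i\<bar> * \<bar>?c k\<bar> / max (real i) (real k))"
          by (simp add: abs_mult mult_ac)
        then show ?thesis using False by simp
      qed
    qed
    also have "\<dots> = (\<Sum>i\<in>?S. (?c i)\<^sup>2) + L * (\<Sum>i\<in>?S. \<Sum>k\<in>?S. \<bar>?c i\<bar> * \<bar>?c k\<bar> / max (real i) (real k))"
      by (simp add: sum.distrib sum_distrib_left)
    also have "\<dots> \<le> (\<Sum>i\<in>?S. (?c i)\<^sup>2) + L * (4 * (\<Sum>i\<in>?S. (?c i)\<^sup>2))"
      using L by (intro add_left_mono mult_left_mono hardy_schur_tail N) auto
    finally show ?thesis unfolding form_shift sq_shift by (simp add: algebra_simps)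
  qed
  have res: "(\<lambda>k. \<beta> (k + n) * G1 i (k + n)) sums R i n" for i n
    using residual_sums[of "i + N" "n + N"] N(2) by (simp add: \<beta>_def G1_def R_def add.assoc)
  have R1: "R n n = \<beta> n" for n by (simp add: R_def \<beta>_def residual_self)
  have R2: "\<bar>R i n\<bar> < \<beta> n" if "i \<noteq> n" for i n
    unfolding R_def \<beta>_def by (rule residual_bound[OF N(2,3,4)]) (use that in auto)
  have var: "\<beta> k * \<bar>R k 0\<bar> \<le> C * (\<beta> k - \<beta> (Suc k))" for k
    using C(2)[of "k + N"] by (simp add: R_def \<beta>_def)
  have sm: "summable (\<lambda>k. (\<beta> k)\<^sup>2)"
    unfolding \<beta>_def using b_sq_summable by (rule summable_ignore_initial_segment)
  have lim: "\<beta> \<longlonglongrightarrow> 0"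
    unfolding \<beta>_def using b_tendsto_0 by (rule LIMSEQ_ignore_initial_segment)
  have pos: "\<beta> k > 0" for k unfolding \<beta>_def by (rule b_pos)
  have sym1: "G1 i k = G1 k i" for i k unfolding G1_def by (rule G_sym)
  have diag1: "G1 i i = 1" for i unfolding G1_def by (rule Gd)
  have mu: "(1/1000::real) > 0" by simp
  show thesis
  proof (rule prescribed_greedy[OF sym1 diag1 lower mu upper pos sm lim res R1 _ var C(1)])
    show "\<And>i n. i \<noteq> n \<Longrightarrow> \<bar>R i n\<bar> < \<beta> n" by (rule R2)
    fix D :: "ell2 set" and f :: ell2 and s :: real
    assume D: "dictionary D" "f \<noteq> 0" "pga_well_defined D f" "s > 0" "variation_norm D f \<le> ereal s"
      and decay: "\<And>n g m. pga_iterate D f n g \<Longrightarrow> (\<Sum>k=n..<n+m. (\<beta> k)\<^sup>2) \<le> (norm (f - g))\<^sup>2"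
    \<comment> \<open>For n \<le> k < 2 n, the inequality k + N + 1 \<le> (N + 3) n gives \<beta>_k
      \<ge> c n^(p-1); the n squares then add up to at least c^2 n^(2p-1).\<close>
    define c where "c = p * (real N + 3) powr (p - 1)"
    have c: "c > 0" using p by (simp add: c_def)
    have "c * real n powr (p - 1/2) \<le> norm (f - g)" if n: "n \<ge> 1" and g: "pga_iterate D f n g" for n g
    proof -
      have \<beta>l: "c * real n powr (p - 1) \<le> \<beta> k" if k: "k \<in> {n..<n+n}" for k
      proof -
        have "real k + real N + 1 \<le> (real N + 3) * real n"
        proof -
          have "real N + 1 \<le> (real N + 1) * real n" using n by simp
          moreover have "real k \<le> 2 * real n" using k by simp
          ultimately show ?thesis by (simp add: algebra_simps)
        qed
        then have "((real N + 3) * real n) powr (p - 1) \<le> (real k + real N + 1) powr (p - 1)"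
          using p by (intro powr_mono2') auto
        then have "p * ((real N + 3) * real n) powr (p - 1) \<le> p * (real (k + N) + 1) powr (p - 1)"
          using p by simp
        also have "\<dots> \<le> \<beta> k" unfolding \<beta>_def b_def using p by (intro pdiff_bounds) auto
        finally show ?thesis by (simp add: c_def powr_mult)
      qed
      have "(c * real n powr (p - 1/2))\<^sup>2 = real n * (c * real n powr (p - 1))\<^sup>2"
      proof -
        have "real n powr (p - 1/2) = real n powr (p - 1) * real n powr (1/2)"
          by (simp add: powr_add[symmetric])
        then show ?thesis using n by (simp add: power_mult_distrib powr_half_sqrt)
      qed
      also have "\<dots> = (\<Sum>k=n..<n+n. (c * real n powr (p - 1))\<^sup>2)" by simp
      also have "\<dots> \<le> (\<Sum>k=n..<n+n. (\<beta> k)\<^sup>2)"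
        using \<beta>l c by (intro sum_mono power_mono) auto
      also have "\<dots> \<le> (norm (f - g))\<^sup>2" by (rule decay[OF g])
      finally show ?thesis by (rule power2_le_imp_le) simp
    qed
    then show thesis using that[OF D c] by blast
  qed
qed

end

section \<open>Choice of the parameters\<close>

text \<open>With X = v^(1/(1+v)) the equation reads X (1 + v) / v = v / (v - 1), that is X = v^2 /
  (v^2 - 1). Then ln X \<le> X - 1 gives ln v \<le> 1 / (v - 1), which is false from v = 2.3
  on.\<close>

lemma gamma_root:
  fixes \<gamma> :: real
  assumes \<gamma>: "\<gamma> > 1"
    and root: "(1 + \<gamma>) powr (1 / (2 + \<gamma>)) * (1 + 1 / (1 + \<gamma>)) - 1 - 1 / \<gamma> = 0"
  defines "v \<equiv> 1 + \<gamma>"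
  shows "v powr (- (1 / (1 + v))) = 1 - 1 / v\<^sup>2" "v < 2.3"
proof -
  have v: "v > 2" using \<gamma> by (simp add: v_def)
  have v2: "v\<^sup>2 > 1" "v\<^sup>2 = v * v" using v by (auto simp: power2_eq_square less_1_mult)
  define X where "X = v powr (1 / (1 + v))"
  have X0: "X > 0" using v by (simp add: X_def)
  have "X * ((1 + v) / v) = v / (v - 1)"
  proof -
    have "1 + 1 / v = (1 + v) / v" "1 + 1 / (v - 1) = v / (v - 1)" using v by (auto simp: field_simps)
    moreover have "X * (1 + 1 / v) = 1 + 1 / (v - 1)"
      using root by (simp add: X_def v_def add.commute add.left_commute)
    ultimately show ?thesis by simp
  qed
  then have "X * (v\<^sup>2 - 1) = v\<^sup>2" using v by (simp add: field_simps power2_eq_square)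
  then have X: "1 / X = 1 - 1 / v\<^sup>2" using X0 v v2 by (simp add: field_simps)
  then show eq: "v powr (- (1 / (1 + v))) = 1 - 1 / v\<^sup>2"
    by (simp add: X_def powr_minus_divide)
  show "v < 2.3"
  proof (rule ccontr)
    assume "\<not> v < 2.3"
    then have v23: "v \<ge> 2.3" by simp
    have "ln v / (1 + v) = ln X" using v by (simp add: X_def ln_powr)
    also have "\<dots> \<le> X - 1" using X0 by (rule ln_le_minus_one)
    also have "X = v\<^sup>2 / (v\<^sup>2 - 1)" using \<open>X * (v\<^sup>2 - 1) = v\<^sup>2\<close> v2 by (simp add: field_simps)
    also have "v\<^sup>2 / (v\<^sup>2 - 1) - 1 = 1 / ((v - 1) * (1 + v))"
      using v v2(1) by (simp add: field_simps power2_eq_square)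
    finally have "ln v / (1 + v) * (1 + v) \<le> 1 / ((v - 1) * (1 + v)) * (1 + v)"
      using v by (intro mult_right_mono) auto
    then have "ln v \<le> 1 / (v - 1)" using v by simp
    also have "\<dots> \<le> 1 / 1.3" using v23 by (intro divide_left_mono) auto
    finally have 1: "ln v \<le> 1 / 1.3" .
    have "ln (2 * 1.15) \<le> ln v" using v23 by (subst ln_le_cancel_iff) auto
    moreover have "ln (2 * 1.15) = ln 2 + ln (1.15::real)" by (subst ln_mult) auto
    moreover have "1 - 1 / 1.15 \<le> ln (1.15::real)"
      using ln_le_minus_one[of "1 / 1.15::real"] by (simp add: ln_div)
    ultimately have "2/3 + (1 - 1 / 1.15) \<le> ln v" using ln2_ge_two_thirds by linarith
    then show False using 1 by simp
  qed
qed

text \<open>Here \<open>V\<close> stands for \<open>v powr (- 1 / (1 + w))\<close>.\<close>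

lemma parameter_algebra:
  fixes v w V :: real
  assumes v: "2 < v" "v < w" and V: "0 < V" "V < 1" "1 < v * V"
  defines "\<phi> \<equiv> w\<^sup>2 * (1 - V)"
  defines "a \<equiv> 1 / (1 + v * V * (\<phi> - 1))"
  assumes \<phi>: "1 < \<phi>"
  shows "0 < a" "a < 1" "a * w * (v - v * V) < 1" "1 - a + a * (v * V) = w * (a * w * (v - v * V)) * V"
proof -
  \<comment> \<open>Inserting h = a w (v - v V) makes the consistency relation linear in a: it says
    a T = 1. Moreover h = (v / w) (\<phi> / T), and both fractions are below 1, by v < w and by v V
    > 1.\<close>
  define T where "T = 1 + v * V * (\<phi> - 1)"
  define d where "d = v * V * (\<phi> - 1)"
  have "1 * (\<phi> - 1) < d" unfolding d_def using \<phi> V by (intro mult_strict_right_mono) auto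
  then have T: "T > \<phi>" by (simp add: T_def d_def[symmetric])
  then have "T > 1" using \<phi> by linarith
  note T = T this
  have a: "a = 1 / T" by (simp add: a_def T_def)
  show a01: "0 < a" "a < 1" using T by (auto simp: a)
  have "w * (v - v * V) = v / w * \<phi>"
  proof -
    have "v / w * \<phi> = v / w * w * (w * (1 - V))" unfolding \<phi>_def power2_eq_square by (simp only: mult.assoc)
    also have "v / w * w = v" using v by simp
    finally show ?thesis by (simp add: algebra_simps)
  qed
  also have "\<dots> < 1 * \<phi>" using v \<phi> by (intro mult_strict_right_mono) auto
  also have "\<dots> < T" using T by simp
  finally show "a * w * (v - v * V) < 1" using T by (simp add: a)
  have "a * T = 1" using T by (simp add: a)
  then have "1 - a + a * (v * V) = a * (T - 1 + v * V)" by (simp add: algebra_simps)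
  also have "T - 1 + v * V = v * V * \<phi>" by (simp add: T_def algebra_simps)
  also have "a * (v * V * \<phi>) = w * (a * w * (v - v * V)) * V"
    unfolding \<phi>_def power2_eq_square by (simp only: algebra_simps)
  finally show "1 - a + a * (v * V) = w * (a * w * (v - v * V)) * V" .
qed

text \<open>At w = v the right side would be exactly 1, by \<open>root\<close>. For w > v put t = (1
  + v) / (1 + w): weighted AM-GM gives (1 - 1 / v^2)^t \<le> 1 - t / v^2, and w^2 t / v^2 > 1
  because x^2 / (1 + x) increases.\<close>

lemma phi_gt_1:
  fixes v w :: real
  assumes v: "2 < v" "v < w" and root: "v powr (- (1 / (1 + v))) = 1 - 1 / v\<^sup>2"
  shows "1 < w\<^sup>2 * (1 - v powr (- (1 / (1 + w))))"
proof -
  define t where "t = (1 + v) / (1 + w)"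
  have t: "0 < t" "t < 1" using v by (auto simp: t_def)
  have X: "1 - 1 / v\<^sup>2 > 0" unfolding root[symmetric] using v by simp
  have "v powr (- (1 / (1 + w))) = (1 - 1 / v\<^sup>2) powr t"
    unfolding root[symmetric] powr_powr using v by (simp add: t_def)
  also have "\<dots> \<le> t * (1 - 1 / v\<^sup>2) + (1 - t) * 1"
    using Youngs_inequality_0[of t "1 - t" "1 - 1 / v\<^sup>2" 1] t X by simp
  finally have "t / v\<^sup>2 \<le> 1 - v powr (- (1 / (1 + w)))" by (simp add: algebra_simps)
  then have "w\<^sup>2 * (t / v\<^sup>2) \<le> w\<^sup>2 * (1 - v powr (- (1 / (1 + w))))"
    by (intro mult_left_mono) auto
  moreover have "1 < w\<^sup>2 * (t / v\<^sup>2)"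
  proof -
    have "0 < (w - v) * (w + v + w * v)" using v by (intro mult_pos_pos add_pos_pos) auto
    then have "v\<^sup>2 * (1 + w) < w\<^sup>2 * (1 + v)" by (simp add: power2_eq_square algebra_simps)
    moreover have "0 < v\<^sup>2 * (1 + w)" using v by simp
    moreover have "w\<^sup>2 * (t / v\<^sup>2) = w\<^sup>2 * (1 + v) / (v\<^sup>2 * (1 + w))" by (simp add: t_def mult.commute)
    ultimately show ?thesis by (simp add: less_divide_eq_1_pos)
  qed
  ultimately show ?thesis by linarith
qed

theorem theorem1:
  fixes \<gamma> \<alpha> :: real
  assumes "\<gamma> > 1"
    and "(1 + \<gamma>) powr (1 / (2 + \<gamma>)) * (1 + 1 / (1 + \<gamma>)) - 1 - 1 / \<gamma> = 0"
    and "\<alpha> > \<gamma> / (2 * (2 + \<gamma>))"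
  shows "\<exists>(D :: ell2 set) (f :: ell2) (C :: real).
    dictionary D \<and> f \<in> variation_space D \<and> f \<noteq> 0 \<and> C > 0 \<and>
    pga_well_defined D f \<and>
    (\<forall>n g. n \<ge> 1 \<longrightarrow> pga_iterate D f n g \<longrightarrow>
       ereal (norm (f - g)) \<ge> ereal C * variation_norm D f * ereal (real n powr (- \<alpha>)))"
proof -
  define v where "v = 1 + \<gamma>"
  have v2: "v > 2" using assms(1) by (simp add: v_def)
  note root = gamma_root(1)[OF assms(1,2), folded v_def] and v23 = gamma_root(2)[OF assms(1,2), folded v_def]
  define q where "q = v / (1 + v)"
  show ?thesis
  proof (rule form_positive[OF v2 v23, folded q_def])
    fix \<delta> :: real and N0 :: nat
    assume \<delta>: "\<delta> > 0"
      and form: "\<And>N G c n. N \<ge> N0 \<Longrightarrow> (\<And>i k. G i k = G k i) \<Longrightarrow> (\<And>i. N \<le> i \<Longrightarrow> G i i = 1) \<Longrightarrow>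
        (\<And>i k. N \<le> i \<Longrightarrow> i < k \<Longrightarrow>
          \<bar>G i k - (if real k < v * real i then q / real i else - q / real k)\<bar> \<le> \<delta> / real k) \<Longrightarrow>
        (\<Sum>i=N..n. \<Sum>k=N..n. c i * c k * G i k) \<ge> 1/1000 * (\<Sum>i=N..n. (c i)\<^sup>2)"
    \<comment> \<open>The parameters as functions of w, with p = P w and (1 - p) / p = w. At w = v
      they are critical: \<phi> = A = H = 1 and 1 - P = q. Conditions that are strict at v persist
      to its right by continuity; A < 1 and H < 1 come from w > v.\<close>
    define P V \<phi> A H where "P w = 1 / (1 + w)" and "V w = v powr (- P w)"
      and "\<phi> w = w\<^sup>2 * (1 - V w)" and "A w = 1 / (1 + v * V w * (\<phi> w - 1))"
      and "H w = A w * w * (v - v * V w)" for w :: real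
    have Vv: "V v = 1 - 1 / v\<^sup>2" using root by (simp add: V_def P_def)
    have \<phi>v: "\<phi> v = 1" using v2 by (simp add: \<phi>_def Vv)
    have Av: "A v = 1" by (simp add: A_def \<phi>v)
    have Hv: "H v = 1"
    proof -
      have "H v = \<phi> v" by (simp add: H_def Av \<phi>_def power2_eq_square algebra_simps)
      then show ?thesis by (simp add: \<phi>v)
    qed
    have cont: "isCont P v" "isCont V v" "isCont \<phi> v" "isCont A v" "isCont H v"
    proof -
      show P: "isCont P v" unfolding P_def using v2 by (intro continuous_intros) auto
      show V: "isCont V v" unfolding V_def using v2 P by (intro continuous_intros) auto
      show \<phi>: "isCont \<phi> v" unfolding \<phi>_def using V by (intro continuous_intros)
      show A: "isCont A v" unfolding A_def using V \<phi> \<phi>v by (intro continuous_intros) auto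
      show "isCont H v" unfolding H_def using V A by (intro continuous_intros)
    qed
    have lim: "(g \<longlongrightarrow> g v) (at_right v)" if "isCont g v" for g :: "real \<Rightarrow> real"
      using that unfolding isCont_def by (rule tendsto_within_subset) auto
    have q1: "1 - P v = q" using v2 by (simp add: P_def q_def field_simps)
    have l1: "((\<lambda>w. \<bar>A w * (1 - P w) - q\<bar>) \<longlongrightarrow> \<bar>A v * (1 - P v) - q\<bar>) (at_right v)"
      by (intro tendsto_intros lim cont)
    have l2: "((\<lambda>w. \<bar>H w * (1 - P w) - q\<bar>) \<longlongrightarrow> \<bar>H v * (1 - P v) - q\<bar>) (at_right v)"
      by (intro tendsto_intros lim cont)
    have l3: "((\<lambda>w. w * V w) \<longlongrightarrow> v * V v) (at_right v)"
      by (intro tendsto_intros lim cont)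
    have l4: "((\<lambda>w. v * V w) \<longlongrightarrow> v * V v) (at_right v)"
      by (intro tendsto_intros lim cont)
    have vV: "v * V v = v - 1 / v" using v2 by (simp add: Vv power2_eq_square right_diff_distrib)
    have iv: "1 / v < 1 / 2" "1 / v > 1 / 2.3" using v2 v23 by (simp_all add: field_simps)
    have "\<forall>\<^sub>F w in at_right v. \<bar>A w * (1 - P w) - q\<bar> < \<delta> / v"
      by (rule order_tendstoD(2)[OF l1]) (use \<delta> v2 in \<open>simp add: Av q1\<close>)
    moreover have "\<forall>\<^sub>F w in at_right v. \<bar>H w * (1 - P w) - q\<bar> < \<delta>"
      by (rule order_tendstoD(2)[OF l2]) (use \<delta> in \<open>simp add: Hv q1\<close>)
    \<comment> \<open>This is \<open>mass\<close>: at w = v the value is v - 1 / v, which is below 2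
      for v < 2.3.\<close>
    moreover have "\<forall>\<^sub>F w in at_right v. w * V w < 2"
      by (rule order_tendstoD(2)[OF l3]) (use iv v23 in \<open>simp add: vV\<close>)
    moreover have "\<forall>\<^sub>F w in at_right v. 1 < v * V w"
      by (rule order_tendstoD(1)[OF l4]) (unfold vV, use iv v2 in linarith)
    \<comment> \<open>1/2 - 1 / (2 + \<gamma>) equals \<gamma> / (2 (2 + \<gamma>)), so every
      \<alpha> above this value leaves room for w slightly larger than v.\<close>
    moreover have "\<forall>\<^sub>F w in at_right v. 1 / 2 - \<alpha> < P w"
    proof (rule order_tendstoD(1)[OF lim[OF cont(1)]])
      have "P v = 1 / 2 - \<gamma> / (2 * (2 + \<gamma>))" using assms(1) by (simp add: P_def v_def field_simps)
      then show "1 / 2 - \<alpha> < P v" using assms(3) by simp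
    qed
    moreover have "\<forall>\<^sub>F w in at_right v. v < w" by (rule eventually_at_right_less)
    ultimately have "\<forall>\<^sub>F w in at_right v. \<bar>A w * (1 - P w) - q\<bar> < \<delta> / v \<and> \<bar>H w * (1 - P w) - q\<bar> < \<delta>
       \<and> w * V w < 2 \<and> 1 < v * V w \<and> 1 / 2 - \<alpha> < P w \<and> v < w"
      by eventually_elim simp
    then obtain w where w: "\<bar>A w * (1 - P w) - q\<bar> < \<delta> / v" "\<bar>H w * (1 - P w) - q\<bar> < \<delta>"
       "w * V w < 2" "1 < v * V w" "1 / 2 - \<alpha> < P w" "v < w"
      using eventually_happens'[of "at_right v"] by auto
    have P: "0 < P w" "P w < 1 / 2" "(1 - P w) / P w = w" using w v2 by (auto simp: P_def field_simps)
    have V0: "0 < V w" "V w < 1"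
      using P v2 powr_less_mono[of "- P w" 0 v] by (auto simp: V_def)
    have \<phi>w: "1 < \<phi> w" using phi_gt_1[OF v2 w(6) root] by (simp add: \<phi>_def V_def P_def)
    note alg = parameter_algebra[OF v2 w(6) V0 w(4) \<phi>w[unfolded \<phi>_def], folded \<phi>_def, folded A_def, folded H_def]
    have vq: "v powr (1 - P w) = v * V w" using v2 powr_add[of v 1 "- P w"] by (simp add: V_def)
    interpret greedy_parameters "P w" v "A w" "H w"
    proof
      show "H w = A w * ((1 - P w) / P w) * (v - v powr (1 - P w))" unfolding P(3) vq H_def ..
      show "1 - A w + A w * v powr (1 - P w) = (1 - P w) / P w * H w * v powr - P w"
        unfolding P(3) vq using alg(4) by (simp add: V_def)
      show "(1 - P w) / P w * v powr - P w < 2" unfolding P(3) using w(3) by (simp add: V_def)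
    qed (use P v2 alg(1-3) in auto)
    have q0: "q > 0" using v2 by (simp add: q_def)
    show ?thesis
    proof (rule slow_greedy[OF \<delta> w(1,2) q0])
      show "(\<Sum>i=N..n. \<Sum>k=N..n. c i * c k * G i k) \<ge> 1/1000 * (\<Sum>i=N..n. (c i)\<^sup>2)"
        if "N \<ge> N0" "\<And>i k. G i k = G k i" "\<And>i. N \<le> i \<Longrightarrow> G i i = 1"
          "\<And>i k. N \<le> i \<Longrightarrow> i < k \<Longrightarrow>
            \<bar>G i k - (if real k < v * real i then q / real i else - q / real k)\<bar> \<le> \<delta> / real k"
        for N n :: nat and G c
        using that by (rule form)
      fix D :: "ell2 set" and f :: ell2 and s c :: real
      assume D: "dictionary D" "f \<noteq> 0" "pga_well_defined D f" "s > 0" "variation_norm D f \<le> ereal s" "c > 0"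
        and slow: "\<And>n g. n \<ge> 1 \<Longrightarrow> pga_iterate D f n g \<Longrightarrow> c * real n powr (P w - 1/2) \<le> norm (f - g)"
      \<comment> \<open>The variation norm enters only through its upper bound s, which the constant
        c / s absorbs.\<close>
      have "ereal (c / s) * variation_norm D f * ereal (real n powr (- \<alpha>)) \<le> ereal (norm (f - g))"
        if n: "n \<ge> 1" and g: "pga_iterate D f n g" for n g
      proof -
        have "ereal (c / s) * variation_norm D f \<le> ereal (c / s) * ereal s"
          using D by (intro ereal_mult_left_mono) auto
        also have "\<dots> = ereal c" using D by simp
        finally have "ereal (c / s) * variation_norm D f * ereal (real n powr (- \<alpha>)) \<le> ereal c * ereal (real n powr (- \<alpha>))"
          by (rule ereal_mult_right_mono) simp
        also have "\<dots> = ereal (c * real n powr (- \<alpha>))" by simp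
        also have "c * real n powr (- \<alpha>) \<le> c * real n powr (P w - 1/2)"
          using n w(5) D by (intro mult_left_mono powr_mono) auto
        also have "\<dots> \<le> norm (f - g)" by (rule slow[OF n g])
        finally show ?thesis by simp
      qed
      moreover have "f \<in> variation_space D"
        unfolding variation_space_def using D(5) by (auto intro: le_less_trans)
      ultimately show ?thesis using D by (intro exI[of _ D] exI[of _ f] exI[of _ "c / s"]) auto
    qed
  qed
qed

end
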